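(* Let $\mathscr C$ be a non-empty set of finite-dimensional vector spaces over a field $\mathbb F$, let $P\mathcal L=P\mathcal L(\mathscr C)$ be the projective linear category over $\mathscr C$, let $\xi$ be the least cardinal strictly greater than $\dim(V)$ for every $V\in\mathscr C$, let $I_r=\{\overline\alpha\in P\mathcal L:\operatorname{rank}(\alpha)\le r\}$ for $0\le r<\xi$, with $I_\omega=P\mathcal L$ if $\xi=\omega$, and for each $0\le q<\xi$ let $\mathcal G_q$ be a group $\mathscr H$-class of $P\mathcal L$ contained in $D_q=\{\overline\alpha:\operatorname{rank}(\alpha)=q\}$ (so $\mathcal G_q\cong\operatorname{PGL}_q(\mathbb F)$). Then for any $r\ge0$ (i.e. $0\le r<\xi$, and also $r=\omega$ if $\xi=\omega$), $$\operatorname{Cong}(I_r)=\{R^{I_r}_{I_q,N}:0\le q<r,\ N\unlhd\mathcal G_{q+1}\}\cup\{\widetilde\nabla_{I_r}\}.$$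
   Context: **Categories.** The linear category $\mathcal L=\mathcal L(\mathscr C)$ has morphisms $(U,\alpha,V)$ with $U,V\in\mathscr C$ and $\alpha:U\to V$ linear; $\mathbf d(U,\alpha,V)=U$, $\mathbf r(U,\alpha,V)=V$, and composition is composition of maps. The relation $\zeta=\{(\alpha,\beta):\alpha,\beta\text{ in the same hom-set and }\alpha=c\beta\text{ for some }c\in\mathbb F\setminus\{0\}\}$ is a congruence on $\mathcal L$; $\overline\alpha$ is the $\zeta$-class of $\alpha$, and $P\mathcal L=\mathcal L/\zeta$. $\operatorname{rank}(\alpha)=\dim(\operatorname{im}\alpha)$. The $\mathscr J=\mathscr D$-classes of $P\mathcal L$ are the $D_q$, $0\le q<\xi$, all stable and regular. $\operatorname{PGL}_q(\mathbb F)=\operatorname{GL}_q(\mathbb F)/Z(\operatorname{GL}_q(\mathbb F))$. **Congruences.** For a partial semigroup (category without necessarily having identities) $S$ with domain/range maps $\mathbf d,\mathbf r$, write $x\sim y$ if $\mathbf d(x)=\mathbf d(y)$ and $\mathbf r(x)=\mathbf r(y)$. A congruence on $S$ is an equivalence contained in $\sim$ and compatible with all defined left and right multiplications by elements of $S$; $\operatorname{Cong}(S)$ is the lattice of congruences under inclusion. $\Delta_S$ is equality, $\widetilde\nabla_S=\{(x,y)\in S\times S:x\sim y\}$; for an ideal $I$ of $S$ (non-empty, closed under defined multiplication by elements of $S$ on either side), $R_I^S=\widetilde\nabla_I\cup\Delta_S$. Green's relations: $x\mathrel{\mathscr R}y\Leftrightarrow xS^1=yS^1$, $x\mathrel{\mathscr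 L}y\Leftrightarrow S^1x=S^1y$, $x\mathrel{\mathscr J}y\Leftrightarrow S^1xS^1=S^1yS^1$, $\mathscr H=\mathscr R\cap\mathscr L$ ($S^1$ is $S$ with identities adjoined where needed). For $N\unlhd\mathcal G_{q+1}$, $\nu_N=\{(axb,ayb):x,y\in N,\ a,b\in P\mathcal L,\ axb,ayb\in D_{q+1}\}$ and $R^{I_r}_{I_q,N}=R^{I_r}_{I_q}\cup\nu_N$. *)

theory Defs
  imports
    "HOL-Library.Extended_Nat"
    "HOL-Algebra.Coset"
    "Jordan_Normal_Form.Missing_VectorSpace"
begin

section \<open>Partial semigroups (categories possibly without identities)\<close>

text \<open>
  The product \<open>x \<star> y\<close> is meaningful only when \<open>tgt x = src y\<close>; in this
  left-to-right convention \<open>x\<close> is the arrow performed first.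
\<close>

record ('o, 'a) psemigroup =
  arrows :: "'a set"
  src :: "'a \<Rightarrow> 'o"
  tgt :: "'a \<Rightarrow> 'o"
  pcomp :: "'a \<Rightarrow> 'a \<Rightarrow> 'a"  (infixl \<open>\<star>\<index>\<close> 70)

definition composable :: "('o, 'a) psemigroup \<Rightarrow> 'a \<Rightarrow> 'a \<Rightarrow> bool" where
  "composable S x y \<longleftrightarrow> tgt S x = src S y"

text \<open>The relation \<open>\<sim>\<close> on \<open>S\<close>, which is also the largest congruence of \<open>S\<close>.\<close>

definition nabla :: "('o, 'a) psemigroup \<Rightarrow> ('a \<times> 'a) set" where
  "nabla S = {(x, y). x \<in> arrows S \<and> y \<in> arrows S \<and> src S x = src S y \<and> tgt S x = tgt S y}"

definition congruence :: "('o, 'a) psemigroup \<Rightarrow> ('a \<times> 'a) set \<Rightarrow> bool" where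
  "congruence S \<sigma> \<longleftrightarrow>
     equiv (arrows S) \<sigma> \<and> \<sigma> \<subseteq> nabla S \<and>
     (\<forall>(x, y) \<in> \<sigma>. \<forall>a \<in> arrows S.
        (composable S a x \<longrightarrow> (a \<star>\<^bsub>S\<^esub> x, a \<star>\<^bsub>S\<^esub> y) \<in> \<sigma>) \<and>
        (composable S x a \<longrightarrow> (x \<star>\<^bsub>S\<^esub> a, y \<star>\<^bsub>S\<^esub> a) \<in> \<sigma>))"

definition Cong :: "('o, 'a) psemigroup \<Rightarrow> ('a \<times> 'a) set set" where
  "Cong S = {\<sigma>. congruence S \<sigma>}"

definition sub_psemigroup :: "('o, 'a) psemigroup \<Rightarrow> 'a set \<Rightarrow> ('o, 'a) psemigroup" where
  "sub_psemigroup S A = S\<lparr>arrows := A\<rparr>"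

definition rees :: "('o, 'a) psemigroup \<Rightarrow> 'a set \<Rightarrow> ('a \<times> 'a) set" where
  "rees S I = nabla (sub_psemigroup S I) \<union> Id_on (arrows S)"

text \<open>
  For a congruence \<open>\<sigma>\<close> all members of a class have the same source and target, and
  the set on the right of \<open>pcomp\<close> is the single class of \<open>x \<star> y\<close>.
\<close>

definition quotient_psemigroup ::
    "('o, 'a) psemigroup \<Rightarrow> ('a \<times> 'a) set \<Rightarrow> ('o, 'a set) psemigroup" where
  "quotient_psemigroup S \<sigma> =
     \<lparr>arrows = arrows S // \<sigma>,
      src = (\<lambda>X. the_elem (src S ` X)),
      tgt = (\<lambda>X. the_elem (tgt S ` X)),
      pcomp = (\<lambda>X Y. \<Union>x\<in>X. \<Union>y\<in>Y. \<sigma> `` {x \<star>\<^bsub>S\<^esub> y})\<rparr>"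


section \<open>Green's relations and group \<open>\<H>\<close>-classes\<close>

text \<open>\<open>x S\<^sup>1\<close> and \<open>S\<^sup>1 x\<close>; the adjoined identities contribute exactly \<open>x\<close> itself.\<close>

definition right_principal :: "('o, 'a) psemigroup \<Rightarrow> 'a \<Rightarrow> 'a set" where
  "right_principal S x = insert x {x \<star>\<^bsub>S\<^esub> s | s. s \<in> arrows S \<and> composable S x s}"

definition left_principal :: "('o, 'a) psemigroup \<Rightarrow> 'a \<Rightarrow> 'a set" where
  "left_principal S x = insert x {s \<star>\<^bsub>S\<^esub> x | s. s \<in> arrows S \<and> composable S s x}"

definition green_R :: "('o, 'a) psemigroup \<Rightarrow> ('a \<times> 'a) set" where
  "green_R S = {(x, y). x \<in> arrows S \<and> y \<in> arrows S \<and> right_principal S x = right_principal S y}"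

definition green_L :: "('o, 'a) psemigroup \<Rightarrow> ('a \<times> 'a) set" where
  "green_L S = {(x, y). x \<in> arrows S \<and> y \<in> arrows S \<and> left_principal S x = left_principal S y}"

definition green_H :: "('o, 'a) psemigroup \<Rightarrow> ('a \<times> 'a) set" where
  "green_H S = green_R S \<inter> green_L S"

definition monoid_on :: "('o, 'a) psemigroup \<Rightarrow> 'a set \<Rightarrow> 'a monoid" where
  "monoid_on S H =
     \<lparr>carrier = H, mult = pcomp S,
      one = (THE e. e \<in> H \<and> (\<forall>x\<in>H. e \<star>\<^bsub>S\<^esub> x = x \<and> x \<star>\<^bsub>S\<^esub> e = x))\<rparr>"

definition group_H_class :: "('o, 'a) psemigroup \<Rightarrow> 'a set \<Rightarrow> bool" where
  "group_H_class S H \<longleftrightarrow>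
     H \<in> arrows S // green_H S \<and> (\<forall>x\<in>H. \<forall>y\<in>H. composable S x y) \<and> group (monoid_on S H)"


section \<open>The projective linear category\<close>

text \<open>
  A vector space is a module record over the field \<open>F\<close>.  The underlying map of a
  morphism from \<open>U\<close> is extensional, i.e. \<open>undefined\<close> outside \<open>carrier U\<close>, so that
  equality of morphisms is equality of linear maps.
\<close>

type_synonym ('f, 'v) lin_mor = "('f, 'v) module \<times> ('v \<Rightarrow> 'v) \<times> ('f, 'v) module"

definition lin_cat ::
    "'f ring \<Rightarrow> ('f, 'v) module set \<Rightarrow> (('f, 'v) module, ('f, 'v) lin_mor) psemigroup" where
  "lin_cat F C =
     \<lparr>arrows = {(U, \<alpha>, V). U \<in> C \<and> V \<in> C \<and> linear_map F U V \<alpha> \<and> \<alpha> \<in> extensional (carrier U)},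
      src = (\<lambda>(U, \<alpha>, V). U),
      tgt = (\<lambda>(U, \<alpha>, V). V),
      pcomp = (\<lambda>(U, \<alpha>, V) (V', \<beta>, W). (U, compose (carrier U) \<beta> \<alpha>, W))\<rparr>"

definition scalar_rel ::
    "'f ring \<Rightarrow> ('f, 'v) module set \<Rightarrow> (('f, 'v) lin_mor \<times> ('f, 'v) lin_mor) set" where
  "scalar_rel F C =
     {((U, \<alpha>, V), (U', \<beta>, V')).
        ((U, \<alpha>, V), (U', \<beta>, V')) \<in> nabla (lin_cat F C) \<and>
        (\<exists>c \<in> carrier F - {\<zero>\<^bsub>F\<^esub>}. \<forall>u \<in> carrier U. \<alpha> u = c \<odot>\<^bsub>V\<^esub> \<beta> u)}"

definition proj_lin_cat ::
    "'f ring \<Rightarrow> ('f, 'v) module set \<Rightarrow> (('f, 'v) module, ('f, 'v) lin_mor set) psemigroup" where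
  "proj_lin_cat F C = quotient_psemigroup (lin_cat F C) (scalar_rel F C)"

definition lin_rank :: "'f ring \<Rightarrow> ('f, 'v) lin_mor \<Rightarrow> nat" where
  "lin_rank F = (\<lambda>(U, \<alpha>, V). vectorspace.dim F (V\<lparr>carrier := \<alpha> ` carrier U\<rparr>))"

text \<open>All dimensions are finite, so the least strict upper bound is at most \<open>\<omega>\<close>, written \<open>\<infinity>\<close>.\<close>

definition dim_bound :: "'f ring \<Rightarrow> ('f, 'v) module set \<Rightarrow> enat" where
  "dim_bound F C = (LEAST \<xi>. \<forall>V\<in>C. enat (vectorspace.dim F V) < \<xi>)"

definition rank_ideal :: "'f ring \<Rightarrow> ('f, 'v) module set \<Rightarrow> enat \<Rightarrow> ('f, 'v) lin_mor set set" where
  "rank_ideal F C r =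
     {scalar_rel F C `` {\<alpha>} | \<alpha>. \<alpha> \<in> arrows (lin_cat F C) \<and> enat (lin_rank F \<alpha>) \<le> r}"

definition rank_class :: "'f ring \<Rightarrow> ('f, 'v) module set \<Rightarrow> nat \<Rightarrow> ('f, 'v) lin_mor set set" where
  "rank_class F C q =
     {scalar_rel F C `` {\<alpha>} | \<alpha>. \<alpha> \<in> arrows (lin_cat F C) \<and> lin_rank F \<alpha> = q}"

definition rank_ideal_psg ::
    "'f ring \<Rightarrow> ('f, 'v) module set \<Rightarrow> enat \<Rightarrow> (('f, 'v) module, ('f, 'v) lin_mor set) psemigroup" where
  "rank_ideal_psg F C r = sub_psemigroup (proj_lin_cat F C) (rank_ideal F C r)"

text \<open>\<open>nu S D N\<close> is \<open>\<nu>\<^sub>N\<close> for a subgroup \<open>N\<close> of a group \<open>\<H>\<close>-class of \<open>S\<close> contained in \<open>D\<close>.\<close>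

definition nu :: "('o, 'a) psemigroup \<Rightarrow> 'a set \<Rightarrow> 'a set \<Rightarrow> ('a \<times> 'a) set" where
  "nu S D N =
     {(a \<star>\<^bsub>S\<^esub> x \<star>\<^bsub>S\<^esub> b, a \<star>\<^bsub>S\<^esub> y \<star>\<^bsub>S\<^esub> b) | a b x y.
        x \<in> N \<and> y \<in> N \<and> a \<in> arrows S \<and> b \<in> arrows S \<and>
        composable S a x \<and> composable S a y \<and> composable S x b \<and> composable S y b \<and>
        a \<star>\<^bsub>S\<^esub> x \<star>\<^bsub>S\<^esub> b \<in> D \<and> a \<star>\<^bsub>S\<^esub> y \<star>\<^bsub>S\<^esub> b \<in> D}"

definition rees_nu ::
    "'f ring \<Rightarrow> ('f, 'v) module set \<Rightarrow> enat \<Rightarrow> nat \<Rightarrow> ('f, 'v) lin_mor set set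
      \<Rightarrow> (('f, 'v) lin_mor set \<times> ('f, 'v) lin_mor set) set" where
  "rees_nu F C r q N =
     rees (rank_ideal_psg F C r) (rank_ideal F C (enat q)) \<union>
     nu (proj_lin_cat F C) (rank_class F C (Suc q)) N"

end

theory Submission
  imports Defs
begin

text \<open>
  Let \<open>\<sigma>\<close> be a congruence on \<open>I\<^sub>r\<close> and \<open>(x, y) \<in> \<sigma>\<close> with \<open>rank y \<le> rank x = p\<close>.  If \<open>x\<close> and \<open>y\<close> are not
  \<open>\<H>\<close>-related, their kernels or their images differ, and multiplying on one side by a suitable map
  of rank at most \<open>p\<close> keeps the rank of \<open>x\<close> but lowers that of \<open>y\<close>.  Once \<open>rank y < p\<close>, a map that kills
  one line in the image of \<open>x\<close> gives such a pair of rank \<open>p - 1\<close>, so by induction \<open>\<sigma>\<close> identifies all parallel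
  arrows of rank \<open>< p\<close>; hence \<open>y\<close>, and with it \<open>x\<close>, is related to zero, and \<open>\<sigma>\<close> contains the universal
  relation of \<open>I\<^sub>p\<close>.  If \<open>x \<noteq> y\<close> are \<open>\<H>\<close>-related, they are not proportional, and killing the line of some
  value \<open>x u\<close> not parallel to \<open>y u\<close> gives a pair of rank \<open>p - 1\<close> with different kernels, so \<open>\<sigma>\<close> contains
  the universal relation of the ideal of rank \<open>p - 1\<close>.  Taking \<open>q\<close> maximal such that all of \<open>I\<^sub>q\<close> collapses, \<open>\<sigma>\<close> can
  only identify further \<open>\<H>\<close>-related arrows of rank \<open>q + 1\<close>, and these are governed by the normal
  subgroup of those elements of the group \<open>\<H>\<close>-class that are related to the identity.
\<close>

section \<open>Linear maps between finite-dimensional spaces\<close>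

text \<open>The obstacle is that an ideal need not contain identities: a congruence on it admits
  only multipliers of rank at most \<open>r\<close>. A map that kills a line has rank one less than
  the dimension of its whole space, which may exceed \<open>r\<close>. It is therefore combined with
  a projection onto the image of the map at hand, and every separating multiplier carries the bound
  that its rank is at most that of \<open>x\<close>. Factorisations obtain the same bound from
  regularity. Passing to projective classes is what makes the descent of \<H>-related pairs
  possible: for linear maps themselves, \<open>f\<close> and \<open>c f\<close> with
  \<open>c\<close> other than 0 and 1 are \<H>-related and stay so under all multiplications, so no
  pair with different kernels could arise. Each hom-set has exactly one arrow of rank zero. Hence
  collapsing rank zero costs nothing, and for positive \<open>r\<close> equality itself appears in
  the list with \<open>q = 0\<close> and trivial \<open>N\<close>. The classification is carried out
  for any category with a rank function satisfying a short list of axioms; linear algebra serves to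
  verify them.\<close>

lemma (in vectorspace) span_in_subspace:
  assumes "subspace K W V" "A \<subseteq> W"
  shows "span A \<subseteq> W"
  using span_is_subset[OF assms(2)] assms(1) by (simp add: subspace_def)

lemma (in vectorspace) subspaceI:
  assumes "W \<subseteq> carrier V" "\<zero>\<^bsub>V\<^esub> \<in> W"
    and "\<And>v w. v \<in> W \<Longrightarrow> w \<in> W \<Longrightarrow> v \<oplus>\<^bsub>V\<^esub> w \<in> W"
    and "\<And>c v. c \<in> carrier K \<Longrightarrow> v \<in> W \<Longrightarrow> c \<odot>\<^bsub>V\<^esub> v \<in> W"
  shows "subspace K W V"
  using assms vectorspace_axioms module_axioms
  by (auto simp: subspace_def submodule_def)

lemma (in vectorspace) subspace_subset: "subspace K W V \<Longrightarrow> W \<subseteq> carrier V"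
  by (simp add: subspace_def submodule_def)

text \<open>A maximal independent superset of \<open>A\<close> exists because independent sets have
  at most \<open>dim\<close> elements. It is maximal among all independent sets too, since every set
  above it contains \<open>A\<close>.\<close>

lemma (in vectorspace) li_subset_basis:
  assumes "fin_dim" "lin_indpt A" "A \<subseteq> carrier V"
  obtains B where "finite B" "A \<subseteq> B" "basis B"
proof -
  let ?P = "\<lambda>S. A \<subseteq> S \<and> S \<subseteq> carrier V \<and> lin_indpt S"
  have "\<exists>B. finite B \<and> maximal B ?P"
  proof (rule maximal_exists)
    show "finite S \<and> card S \<le> dim" if "?P S" for S
      using li_le_dim[OF assms(1), of S] that by simp
    show "?P A"
      using assms(2,3) by simp
  qed
  then obtain B where fin: "finite B" and maxB: "maximal B ?P"
    by (elim exE conjE)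
  have B: "finite B" "?P B" and max: "\<And>S. B \<subseteq> S \<Longrightarrow> ?P S \<Longrightarrow> S = B"
    using fin maxB unfolding maximal_def by simp_all
  have "maximal B (\<lambda>S. S \<subseteq> carrier V \<and> lin_indpt S)"
    unfolding maximal_def
  proof (intro conjI allI impI)
    fix S
    assume S: "B \<subseteq> S \<and> S \<subseteq> carrier V \<and> lin_indpt S"
    then have "A \<subseteq> S"
      using B(2) by blast
    then show "S = B"
      using max[of S] S by simp
  qed (use B(2) in simp_all)
  then have "basis B"
    by (rule max_li_is_basis)
  then show thesis
    using that[of B] B by simp
qed

lemma (in vectorspace) singleton_li:
  assumes "v \<in> carrier V" "v \<noteq> \<zero>\<^bsub>V\<^esub>"
  shows "lin_indpt {v}"
proof (rule finite_lin_indpt2)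
  fix a
  assume a: "a \<in> {v} \<rightarrow> carrier K" "lincomb a {v} = \<zero>\<^bsub>V\<^esub>"
  then have "a v \<odot>\<^bsub>V\<^esub> v = \<zero>\<^bsub>V\<^esub>"
    using assms by (simp add: lincomb_def)
  then have "a v = \<zero>\<^bsub>K\<^esub> \<or> v = inv\<^bsub>K\<^esub> (a v) \<odot>\<^bsub>V\<^esub> \<zero>\<^bsub>V\<^esub>"
    using mult_inverse[of "a v" v] a(1) assms(1) by blast
  moreover have "inv\<^bsub>K\<^esub> (a v) \<odot>\<^bsub>V\<^esub> \<zero>\<^bsub>V\<^esub> = \<zero>\<^bsub>V\<^esub>" if "a v \<noteq> \<zero>\<^bsub>K\<^esub>"
    using a(1) that by (simp add: field_Units)
  ultimately show "\<forall>v\<in>{v}. a v = \<zero>\<^bsub>K\<^esub>"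
    using assms(2) by (metis singletonD)
qed (use assms in auto)

section \<open>Linear maps given on a basis, projections and liftings\<close>

lemma linear_mapI:
  assumes "vectorspace K V" "vectorspace K W"
    and "\<And>v. v \<in> carrier V \<Longrightarrow> f v \<in> carrier W"
    and "\<And>v w. v \<in> carrier V \<Longrightarrow> w \<in> carrier V \<Longrightarrow> f (v \<oplus>\<^bsub>V\<^esub> w) = f v \<oplus>\<^bsub>W\<^esub> f w"
    and "\<And>c v. c \<in> carrier K \<Longrightarrow> v \<in> carrier V \<Longrightarrow> f (c \<odot>\<^bsub>V\<^esub> v) = c \<odot>\<^bsub>W\<^esub> f v"
  shows "linear_map K V W f"
  using assms
  by (auto simp: linear_map_def mod_hom_def mod_hom_axioms_def module_hom_def vectorspace_def)

lemma linear_map_cong: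
  assumes "linear_map K V W f" "\<And>v. v \<in> carrier V \<Longrightarrow> g v = f v"
  shows "linear_map K V W g"
proof -
  interpret linear_map K V W f by fact
  show ?thesis
    using assms(2) V.vectorspace_axioms W.vectorspace_axioms by (intro linear_mapI) auto
qed

lemma linear_map_comp:
  assumes "linear_map K U V f" "linear_map K V W g"
  shows "linear_map K U W (\<lambda>u. g (f u))"
proof -
  interpret f: linear_map K U V f by fact
  interpret g: linear_map K V W g by fact
  show ?thesis
    using f.V.vectorspace_axioms g.W.vectorspace_axioms by (intro linear_mapI) auto
qed

lemma linear_map_into_subspace:
  assumes "linear_map K U (V\<lparr>carrier := W\<rparr>) f" "vectorspace K V" "subspace K W V"
  shows "linear_map K U V f"
proof -
  interpret f: linear_map K U "V\<lparr>carrier := W\<rparr>" f by fact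
  have "W \<subseteq> carrier V"
    using assms(3) by (simp add: subspace_def submodule_def)
  then show ?thesis
    using assms(2) f.V.vectorspace_axioms f.T_add f.T_smult f.T_im by (intro linear_mapI) auto
qed

lemma linear_map_from_subspace:
  assumes "linear_map K V U f" "subspace K W V"
  shows "linear_map K (V\<lparr>carrier := W\<rparr>) U f"
proof -
  interpret f: linear_map K V U f by fact
  have "W \<subseteq> carrier V"
    using assms(2) by (simp add: subspace_def submodule_def)
  then show ?thesis
    using f.V.subspace_is_vs[OF assms(2)] f.W.vectorspace_axioms
    by (intro linear_mapI) (auto simp: subset_iff)
qed

lemma linear_maps_agree_on_span:
  assumes "linear_map K V W f" "linear_map K V W g" "A \<subseteq> carrier V"
    and "\<And>a. a \<in> A \<Longrightarrow> f a = g a" and "v \<in> module.span K V A"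
  shows "f v = g v"
proof -
  interpret f: linear_map K V W f by fact
  interpret g: linear_map K V W g by fact
  have "subspace K {v \<in> carrier V. f v = g v} V"
    by (rule f.V.subspaceI) auto
  then have "f.V.module.span A \<subseteq> {v \<in> carrier V. f v = g v}"
    using assms by (intro f.V.span_in_subspace) auto
  then show ?thesis
    using assms by auto
qed

text \<open>The value at \<open>v\<close> is read off from the coordinates of \<open>v\<close>.
  Requiring the coordinate functions to be extensional makes them unique, so a definite description
  can name them.\<close>

lemma linear_map_on_basis:
  assumes V: "vectorspace K V" and W: "vectorspace K W"
    and B: "finite B" "vectorspace.basis K V B" and f: "f \<in> B \<rightarrow> carrier W"
  obtains T where "linear_map K V W T" "\<And>b. b \<in> B \<Longrightarrow> T b = f b"
proof -
  interpret V: vectorspace K V by fact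
  interpret W: vectorspace K W by fact
  have BV: "B \<subseteq> carrier V"
    using B by (simp add: V.basis_def)
  have ex1: "\<exists>!a. a \<in> B \<rightarrow>\<^sub>E carrier K \<and> V.lincomb a B = v" if "v \<in> carrier V" for v
    using V.basis_criterion[OF B(1) BV] B(2) that by blast
  define coeff where "coeff v = (THE a. a \<in> B \<rightarrow>\<^sub>E carrier K \<and> V.lincomb a B = v)" for v
  have coeff: "coeff v \<in> B \<rightarrow>\<^sub>E carrier K" "V.lincomb (coeff v) B = v" if "v \<in> carrier V" for v
    using theI'[OF ex1[OF that]] by (simp_all add: coeff_def)
  have coeffK: "coeff v b \<in> carrier K" if "v \<in> carrier V" "b \<in> B" for v b
    using coeff(1)[OF that(1)] that(2) by blast
  have coeffPi: "coeff v \<in> B \<rightarrow> carrier K" if "v \<in> carrier V" for v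
    using coeffK[OF that] by blast
  \<comment> \<open>Linearity of \<open>T\<close> is checked on coordinates: any function that
    reproduces \<open>v\<close> agrees with \<open>coeff v\<close> on \<open>B\<close>, extensional
    or not.\<close>
  have coeff_unique: "coeff v b = a b"
    if "a \<in> B \<rightarrow> carrier K" "V.lincomb a B = v" "b \<in> B" for a v b
  proof -
    have "V.lincomb (restrict a B) B = v"
      using that V.lincomb_cong[OF refl BV, of "restrict a B" a] by simp
    moreover have "restrict a B \<in> B \<rightarrow>\<^sub>E carrier K" "v \<in> carrier V"
      using that BV by auto
    ultimately have "coeff v = restrict a B"
      using ex1 coeff by blast
    then show ?thesis
      using that by simp
  qed
  define T where "T v = (\<Oplus>\<^bsub>W\<^esub>b\<in>B. coeff v b \<odot>\<^bsub>W\<^esub> f b)" for v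
  have fW: "f b \<in> carrier W" if "b \<in> B" for b
    using f that by blast
  have closed: "T v \<in> carrier W" if "v \<in> carrier V" for v
    unfolding T_def using coeffK[OF that] fW by (intro W.finsum_closed) auto
  have "linear_map K V W T"
  proof (rule linear_mapI[OF V W closed])
    fix v w
    assume vw: "v \<in> carrier V" "w \<in> carrier V"
    have "coeff (v \<oplus>\<^bsub>V\<^esub> w) b = coeff v b \<oplus>\<^bsub>K\<^esub> coeff w b" if "b \<in> B" for b
    proof (rule coeff_unique[OF _ _ that])
      show "V.lincomb (\<lambda>b. coeff v b \<oplus>\<^bsub>K\<^esub> coeff w b) B = v \<oplus>\<^bsub>V\<^esub> w"
        using V.lincomb_sum[OF B(1) BV coeffPi[OF vw(1)] coeffPi[OF vw(2)]] coeff(2) vw by simp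
    qed (use coeffK vw in auto)
    then have "T (v \<oplus>\<^bsub>V\<^esub> w) = (\<Oplus>\<^bsub>W\<^esub>b\<in>B. coeff v b \<odot>\<^bsub>W\<^esub> f b \<oplus>\<^bsub>W\<^esub> coeff w b \<odot>\<^bsub>W\<^esub> f b)"
      unfolding T_def using coeffK vw fW
      by (intro W.finsum_cong') (auto simp: W.smult_l_distr)
    also have "\<dots> = T v \<oplus>\<^bsub>W\<^esub> T w"
      unfolding T_def using coeffK vw fW by (intro W.finsum_addf) auto
    finally show "T (v \<oplus>\<^bsub>V\<^esub> w) = T v \<oplus>\<^bsub>W\<^esub> T w" .
  next
    fix c v
    assume cv: "c \<in> carrier K" "v \<in> carrier V"
    have "coeff (c \<odot>\<^bsub>V\<^esub> v) b = c \<otimes>\<^bsub>K\<^esub> coeff v b" if "b \<in> B" for b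
    proof (rule coeff_unique[OF _ _ that])
      show "V.lincomb (\<lambda>b. c \<otimes>\<^bsub>K\<^esub> coeff v b) B = c \<odot>\<^bsub>V\<^esub> v"
        using V.lincomb_smult[OF BV coeffPi[OF cv(2)] cv(1)] coeff(2) cv by simp
    qed (use coeffK cv in auto)
    then have "T (c \<odot>\<^bsub>V\<^esub> v) = (\<Oplus>\<^bsub>W\<^esub>b\<in>B. c \<odot>\<^bsub>W\<^esub> (coeff v b \<odot>\<^bsub>W\<^esub> f b))"
      unfolding T_def using coeffK cv fW
      by (intro W.finsum_cong') (auto simp: W.smult_assoc1)
    also have "\<dots> = c \<odot>\<^bsub>W\<^esub> T v"
      unfolding T_def using coeffK cv fW B(1) by (intro W.finsum_smult[symmetric]) auto
    finally show "T (c \<odot>\<^bsub>V\<^esub> v) = c \<odot>\<^bsub>W\<^esub> T v" .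
  qed
  moreover have "T b = f b" if b: "b \<in> B" for b
  proof -
    let ?d = "\<lambda>x. if x = b then \<one>\<^bsub>K\<^esub> else \<zero>\<^bsub>K\<^esub>"
    have "V.lincomb ?d B = (\<Oplus>\<^bsub>V\<^esub>x\<in>B. if b = x then x else \<zero>\<^bsub>V\<^esub>)"
      unfolding V.lincomb_def using BV by (intro V.finsum_cong') auto
    also have "\<dots> = b"
      using V.finsum_singleton[OF b B(1), of "\<lambda>x. x"] BV by auto
    finally have "V.lincomb ?d B = b" .
    then have c: "coeff b x = ?d x" if "x \<in> B" for x
      using coeff_unique[of ?d b x] that by simp
    have "T b = (\<Oplus>\<^bsub>W\<^esub>x\<in>B. if b = x then f x else \<zero>\<^bsub>W\<^esub>)"
      unfolding T_def using c fW by (intro W.finsum_cong') auto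
    also have "\<dots> = f b"
      using W.finsum_singleton[OF b B(1), of f] fW by auto
    finally show ?thesis .
  qed
  ultimately show thesis
    using that by blast
qed

text \<open>For subsets of \<open>W\<close>, independence and span mean the same in \<open>W\<close>
  as in \<open>V\<close>. So a maximal independent subset of \<open>W\<close> has at most
  \<open>dim V\<close> elements, and one of full size is already a basis of
  \<open>V\<close>.\<close>

lemma subspace_fin_dim:
  assumes V: "vectorspace K V" "vectorspace.fin_dim K V" and W: "subspace K W V"
  shows "vectorspace.fin_dim K (V\<lparr>carrier := W\<rparr>)"
    and "vectorspace.dim K (V\<lparr>carrier := W\<rparr>) \<le> vectorspace.dim K V"
    and "vectorspace.dim K (V\<lparr>carrier := W\<rparr>) = vectorspace.dim K V \<Longrightarrow> W = carrier V"
proof -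
  interpret V: vectorspace K V by fact
  interpret W: vectorspace K "V\<lparr>carrier := W\<rparr>"
    by (rule V.subspace_is_vs[OF W])
  have sub: "submodule K W V" and WV: "W \<subseteq> carrier V"
    using W V.subspace_subset by (simp_all add: subspace_def)
  note same = V.span_li_not_depend[OF _ sub]
  have li: "finite A \<and> card A \<le> V.dim" if "A \<subseteq> W" "W.lin_indpt A" for A
    using V.li_le_dim[OF V(2), of A] that WV same(2)[of A] by auto
  moreover have "W.lin_indpt {}"
    by (simp add: W.lin_dep_def)
  ultimately obtain A where A: "finite A" "maximal A (\<lambda>S. S \<subseteq> carrier (V\<lparr>carrier := W\<rparr>) \<and> W.lin_indpt S)"
    using maximal_exists[of "\<lambda>S. S \<subseteq> W \<and> W.lin_indpt S" V.dim "{}"] by auto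
  then have bas: "W.basis A"
    using W.max_li_is_basis by blast
  then have AW: "A \<subseteq> W" "W.span A = W" "W.lin_indpt A"
    by (simp_all add: W.basis_def)
  show "W.fin_dim"
    using A AW by (auto simp: W.fin_dim_def)
  have dimW: "W.dim = card A"
    using W.dim_basis[OF A(1) bas] .
  show "W.dim \<le> V.dim"
    using li[OF AW(1,3)] dimW by simp
  show "W = carrier V" if "W.dim = V.dim"
  proof -
    have "V.basis A"
      using V.dim_li_is_basis[OF V(2) A(1)] AW WV same(2)[OF AW(1)] dimW that by auto
    then show ?thesis
      using AW same(1)[OF AW(1)] by (simp add: V.basis_def)
  qed
qed

lemma subspace_nested:
  assumes "vectorspace K V" "subspace K W V" "subspace K W' V" "W \<subseteq> W'"
  shows "subspace K W (V\<lparr>carrier := W'\<rparr>)"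
proof -
  interpret V: vectorspace K V by fact
  interpret W': vectorspace K "V\<lparr>carrier := W'\<rparr>"
    by (rule V.subspace_is_vs) fact
  show ?thesis
    using assms(2,4) by (intro W'.subspaceI) (auto simp: subspace_def submodule_def)
qed

lemma dim_mono:
  assumes "vectorspace K V" "vectorspace.fin_dim K V" "subspace K W V" "subspace K W' V" "W \<subseteq> W'"
  shows "vectorspace.dim K (V\<lparr>carrier := W\<rparr>) \<le> vectorspace.dim K (V\<lparr>carrier := W'\<rparr>)"
    and "vectorspace.dim K (V\<lparr>carrier := W\<rparr>) = vectorspace.dim K (V\<lparr>carrier := W'\<rparr>) \<Longrightarrow> W = W'"
  using subspace_fin_dim(2,3)[OF vectorspace.subspace_is_vs[OF assms(1,4)]
      subspace_fin_dim(1)[OF assms(1,2,4)] subspace_nested[OF assms(1,3,4,5)]]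
  by simp_all

text \<open>A basis of \<open>W\<close> is extended to one of \<open>V\<close> and the added vectors
  are sent to zero. Such a projection plays the part of the identity wherever the rank of a
  multiplier has to stay small.\<close>

lemma subspace_projection:
  assumes V: "vectorspace K V" "vectorspace.fin_dim K V" and W: "subspace K W V"
  obtains p where "linear_map K V V p" "p ` carrier V = W" "\<And>w. w \<in> W \<Longrightarrow> p w = w"
proof -
  interpret V: vectorspace K V by fact
  interpret W: vectorspace K "V\<lparr>carrier := W\<rparr>"
    by (rule V.subspace_is_vs[OF W])
  have sub: "submodule K W V" and WV: "W \<subseteq> carrier V"
    using W V.subspace_subset by (simp_all add: subspace_def)
  obtain A where A: "finite A" "W.basis A"
    using W.finite_basis_exists subspace_fin_dim(1)[OF V W] by blast
  then have AW: "A \<subseteq> W" "W.span A = W" "W.lin_indpt A"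
    by (simp_all add: W.basis_def)
  have "V.lin_indpt A" and span: "V.span A = W"
    using V.span_li_not_depend[OF AW(1) sub] AW by simp_all
  then obtain B where B: "finite B" "A \<subseteq> B" "V.basis B"
    using V.li_subset_basis[OF V(2) _ subset_trans[OF AW(1) WV]] by blast
  have zW: "\<zero>\<^bsub>V\<^esub> \<in> W"
    using W.zero_closed by simp
  have "(\<lambda>b. if b \<in> A then b else \<zero>\<^bsub>V\<^esub>) \<in> B \<rightarrow> carrier (V\<lparr>carrier := W\<rparr>)"
    using AW(1) zW by auto
  then obtain p where p: "linear_map K V (V\<lparr>carrier := W\<rparr>) p"
    and pB: "\<And>b. b \<in> B \<Longrightarrow> p b = (if b \<in> A then b else \<zero>\<^bsub>V\<^esub>)"
    by (rule linear_map_on_basis[OF V(1) W.vectorspace_axioms B(1,3)]) (rule that)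
  interpret p: linear_map K V "V\<lparr>carrier := W\<rparr>" p by fact
  have pV: "linear_map K V V p"
    by (rule linear_map_into_subspace[OF p V(1) W])
  have idw: "p w = w" if w: "w \<in> W" for w
  proof -
    have id: "linear_map K V V (\<lambda>v. v)"
      using V(1) by (intro linear_mapI) auto
    have "p a = a" if "a \<in> A" for a
      using pB[of a] that B(2) by auto
    then show ?thesis
      by (rule linear_maps_agree_on_span[OF pV id subset_trans[OF AW(1) WV]]) (simp_all add: span w)
  qed
  moreover have "p ` carrier V = W"
  proof
    show "p ` carrier V \<subseteq> W"
      using p.T_im by auto
    show "W \<subseteq> p ` carrier V"
      using idw WV by (metis image_eqI subset_iff)
  qed
  ultimately show thesis
    using that[OF pV] by simp
qed

lemma linear_map_im_subspace:
  assumes "linear_map K U V f"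
  shows "subspace K (f ` carrier U) V"
proof -
  interpret linear_map K U V f by fact
  show ?thesis
    using imT_is_subspace by (simp add: im_def)
qed

text \<open>Only the value at one vector of \<open>U\<close> can be prescribed freely, because a single nonzero vector
  always extends to a basis.\<close>

lemma linear_lift:
  assumes U: "vectorspace.fin_dim K U" and f: "linear_map K U V f" and g: "linear_map K W V g"
    and im: "f ` carrier U \<subseteq> g ` carrier W"
    and u: "u \<in> carrier U" "u \<noteq> \<zero>\<^bsub>U\<^esub>" and w: "w \<in> carrier W" "g w = f u"
  obtains h where "linear_map K U W h" "\<And>x. x \<in> carrier U \<Longrightarrow> g (h x) = f x" "h u = w"
proof -
  interpret f: linear_map K U V f by fact
  interpret g: linear_map K W V g by fact
  obtain B where B: "finite B" "{u} \<subseteq> B" "f.V.basis B"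
    using f.V.li_subset_basis[OF U f.V.singleton_li[OF u]] u by blast
  then have BU: "B \<subseteq> carrier U" "f.V.module.span B = carrier U"
    by (simp_all add: f.V.basis_def)
  have "\<exists>y\<in>carrier W. g y = f b" if "b \<in> B" for b
    using im BU that by force
  then obtain c where c: "\<And>b. b \<in> B \<Longrightarrow> c b \<in> carrier W \<and> g (c b) = f b"
    by metis
  obtain h where h: "linear_map K U W h" "\<And>b. b \<in> B \<Longrightarrow> h b = (c(u := w)) b"
    using linear_map_on_basis[OF f.V.vectorspace_axioms g.V.vectorspace_axioms B(1,3), of "c(u := w)"]
      c w by auto
  have "g (h x) = f x" if "x \<in> carrier U" for x
    using linear_maps_agree_on_span[OF linear_map_comp[OF h(1) g] f BU(1), of x] h(2) c w BU that
    by auto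
  moreover have "h u = w"
    using h(2)[of u] B by simp
  ultimately show thesis
    using that h(1) by blast
qed

lemma linear_lift_simple:
  assumes U: "vectorspace.fin_dim K U" and f: "linear_map K U V f" and g: "linear_map K W V g"
    and im: "f ` carrier U \<subseteq> g ` carrier W"
  obtains h where "linear_map K U W h" "\<And>x. x \<in> carrier U \<Longrightarrow> g (h x) = f x"
proof -
  interpret f: linear_map K U V f by fact
  interpret g: linear_map K W V g by fact
  show thesis
  proof (cases "carrier U \<subseteq> {\<zero>\<^bsub>U\<^esub>}")
    \<comment> \<open>A zero space has no nonzero vector at which to anchor
      \<open>linear_lift\<close>; only the zero map is possible.\<close>
    case True
    have "linear_map K U W (\<lambda>_. \<zero>\<^bsub>W\<^esub>)"
      using f.V.vectorspace_axioms g.V.vectorspace_axioms by (intro linear_mapI) auto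
    moreover have "g \<zero>\<^bsub>W\<^esub> = f x" if "x \<in> carrier U" for x
      using True that by auto
    ultimately show thesis
      by (rule that)
  next
    case False
    then obtain u where u: "u \<in> carrier U" "u \<noteq> \<zero>\<^bsub>U\<^esub>"
      by blast
    then have "f u \<in> g ` carrier W"
      using im by blast
    then obtain w where w: "w \<in> carrier W" "g w = f u"
      by (metis imageE)
    show thesis
      by (rule linear_lift[OF U f g im u w]) (rule that)
  qed
qed

text \<open>An injection of a basis of \<open>W\<close> into a basis of \<open>V\<close> is inverted
  on its image, and the remaining basis vectors go to zero. The values then include a basis of
  \<open>W\<close>.\<close>

lemma linear_surjection:
  assumes V: "vectorspace K V" "vectorspace.fin_dim K V" and W: "vectorspace K W" "vectorspace.fin_dim K W"
    and le: "vectorspace.dim K W \<le> vectorspace.dim K V"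
  obtains T where "linear_map K V W T" "T ` carrier V = carrier W"
proof -
  interpret V: vectorspace K V by fact
  interpret W: vectorspace K W by fact
  obtain A where A: "finite A" "V.basis A"
    using V.finite_basis_exists V(2) by blast
  obtain B where B: "finite B" "W.basis B"
    using W.finite_basis_exists W(2) by blast
  have "card B \<le> card A"
    using le V.dim_basis[OF A] W.dim_basis[OF B] by simp
  then obtain i where i: "inj_on i B" "i ` B \<subseteq> A"
    using card_le_inj[OF B(1) A(1)] by blast
  have BW: "B \<subseteq> carrier W" "W.span B = carrier W"
    using B by (simp_all add: W.basis_def)
  let ?f = "\<lambda>a. if a \<in> i ` B then inv_into B i a else \<zero>\<^bsub>W\<^esub>"
  have "?f \<in> A \<rightarrow> carrier W"
    using subsetD[OF BW(1)] by (auto simp: inv_into_f_f[OF i(1)])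
  then obtain T where T: "linear_map K V W T" "\<And>a. a \<in> A \<Longrightarrow> T a = ?f a"
    using linear_map_on_basis[OF V(1) W(1) A] by blast
  interpret T: linear_map K V W T by fact
  have "B \<subseteq> T ` carrier V"
  proof
    fix b
    assume b: "b \<in> B"
    then have "T (i b) = b" "i b \<in> carrier V"
      using T(2)[of "i b"] i A by (auto simp: V.basis_def)
    then show "b \<in> T ` carrier V"
      by force
  qed
  then have "W.span B \<subseteq> T ` carrier V"
    by (rule W.span_in_subspace[OF linear_map_im_subspace[OF T(1)]])
  then show thesis
    using that T BW T.T_im by blast
qed

section \<open>Rank and kernel\<close>

text \<open>Rank and kernel are stated outside the locale of a fixed linear map, so that two maps
  and their composites can be compared.\<close>

definition map_rank where
  "map_rank K U V f = vectorspace.dim K (V\<lparr>carrier := f ` carrier U\<rparr>)"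

definition map_ker where
  "map_ker U V f = {u \<in> carrier U. f u = \<zero>\<^bsub>V\<^esub>}"

definition fdvs where
  "fdvs K V \<longleftrightarrow> vectorspace K V \<and> vectorspace.fin_dim K V"

lemma fdvsD: "fdvs K V \<Longrightarrow> vectorspace K V" "fdvs K V \<Longrightarrow> vectorspace.fin_dim K V"
  by (simp_all add: fdvs_def)

lemma fdvs_subspace: "fdvs K V \<Longrightarrow> subspace K W V \<Longrightarrow> fdvs K (V\<lparr>carrier := W\<rparr>)"
  unfolding fdvs_def using subspace_fin_dim(1) vectorspace.subspace_is_vs by blast

lemma (in abelian_group) minus_eq_zero_iff:
  "a \<in> carrier G \<Longrightarrow> b \<in> carrier G \<Longrightarrow> a \<ominus> b = \<zero> \<longleftrightarrow> a = b"
  using minus_equality[of a "\<ominus> b"] by (auto simp: minus_eq r_neg)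

lemma vectorspace_minus_eq_zero_iff:
  assumes "vectorspace K V" "a \<in> carrier V" "b \<in> carrier V"
  shows "a \<ominus>\<^bsub>V\<^esub> b = \<zero>\<^bsub>V\<^esub> \<longleftrightarrow> a = b"
  using assms by (intro abelian_group.minus_eq_zero_iff) (simp_all add: vectorspace_def module_def)

lemma vectorspace_inv_closed:
  assumes "vectorspace K V" "c \<in> carrier K" "c \<noteq> \<zero>\<^bsub>K\<^esub>"
  shows "inv\<^bsub>K\<^esub> c \<in> carrier K"
proof -
  interpret field K
    using assms(1) by (simp add: vectorspace_def)
  show ?thesis
    using assms by (simp add: field_Units)
qed

lemma map_ker_subspace:
  assumes "linear_map K U V f"
  shows "subspace K (map_ker U V f) U"
proof -
  interpret linear_map K U V f by fact
  show ?thesis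
    using kerT_is_subspace by (simp add: map_ker_def ker_def)
qed

lemma map_rank_nullity:
  assumes "fdvs K U" "linear_map K U V f"
  shows "map_rank K U V f + vectorspace.dim K (U\<lparr>carrier := map_ker U V f\<rparr>) = vectorspace.dim K U"
proof -
  interpret linear_map K U V f by fact
  show ?thesis
    using rank_nullity assms(1) by (simp add: map_rank_def map_ker_def ker_def im_def fdvs_def)
qed

lemma map_rank_cong: "(\<And>u. u \<in> carrier U \<Longrightarrow> f u = g u) \<Longrightarrow> map_rank K U V f = map_rank K U V g"
  unfolding map_rank_def by (metis image_cong)

lemma map_rank_eq_ker:
  assumes "fdvs K U" "linear_map K U V f" "linear_map K U W g" "map_ker U V f = map_ker U W g"
  shows "map_rank K U V f = map_rank K U W g"
  using map_rank_nullity[OF assms(1,2)] map_rank_nullity[OF assms(1,3)] assms(4) by simp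

text \<open>Rank-nullity on the common domain \<open>U\<close>. The codomains may differ, which is
  what allows a map to be compared with its composites.\<close>

lemma map_rank_ker_antimono:
  assumes U: "fdvs K U" and f: "linear_map K U V f" and g: "linear_map K U W g"
    and sub: "map_ker U V f \<subseteq> map_ker U W g"
  shows "map_rank K U W g \<le> map_rank K U V f"
    and "map_ker U V f \<noteq> map_ker U W g \<Longrightarrow> map_rank K U W g < map_rank K U V f"
proof -
  let ?d = "\<lambda>X. vectorspace.dim K (U\<lparr>carrier := X\<rparr>)"
  have le: "?d (map_ker U V f) \<le> ?d (map_ker U W g)"
    and eq: "?d (map_ker U V f) = ?d (map_ker U W g) \<Longrightarrow> map_ker U V f = map_ker U W g"
    using dim_mono[OF fdvsD[OF U] map_ker_subspace[OF f] map_ker_subspace[OF g] sub] by blast+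
  note rn = map_rank_nullity[OF U f] map_rank_nullity[OF U g]
  show "map_rank K U W g \<le> map_rank K U V f"
    using le rn by linarith
  show "map_rank K U W g < map_rank K U V f" if "map_ker U V f \<noteq> map_ker U W g"
  proof -
    have "?d (map_ker U V f) \<noteq> ?d (map_ker U W g)"
      using eq that by blast
    then show ?thesis
      using le rn by linarith
  qed
qed

lemma map_rank_im_mono:
  assumes V: "fdvs K V" and f: "linear_map K U V f" and g: "linear_map K W V g"
    and sub: "f ` carrier U \<subseteq> g ` carrier W"
  shows "map_rank K U V f \<le> map_rank K W V g"
    and "map_rank K U V f = map_rank K W V g \<Longrightarrow> f ` carrier U = g ` carrier W"
  unfolding map_rank_def
  using dim_mono[OF fdvsD[OF V] linear_map_im_subspace[OF f] linear_map_im_subspace[OF g] sub] by blast+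

text \<open>The composite has a larger kernel, which bounds its rank by that of \<open>f\<close>,
  and a smaller image, which bounds it by that of \<open>g\<close>.\<close>

lemma map_rank_comp_le:
  assumes "fdvs K U" "fdvs K W" "linear_map K U V f" "linear_map K V W g"
  shows "map_rank K U W (\<lambda>u. g (f u)) \<le> map_rank K U V f"
    and "map_rank K U W (\<lambda>u. g (f u)) \<le> map_rank K V W g"
proof -
  interpret f: linear_map K U V f by fact
  interpret g: linear_map K V W g by fact
  have gf: "linear_map K U W (\<lambda>u. g (f u))"
    by (rule linear_map_comp) fact+
  show "map_rank K U W (\<lambda>u. g (f u)) \<le> map_rank K U V f"
    by (rule map_rank_ker_antimono(1)[OF assms(1,3) gf]) (auto simp: map_ker_def)
  show "map_rank K U W (\<lambda>u. g (f u)) \<le> map_rank K V W g"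
    by (rule map_rank_im_mono(1)[OF assms(2) gf assms(4)]) auto
qed

lemma zero_subspace_dim:
  assumes "vectorspace K V"
  shows "vectorspace.dim K (V\<lparr>carrier := {\<zero>\<^bsub>V\<^esub>}\<rparr>) = 0" and "subspace K {\<zero>\<^bsub>V\<^esub>} V"
proof -
  interpret V: vectorspace K V by fact
  show sub: "subspace K {\<zero>\<^bsub>V\<^esub>} V"
    by (rule V.subspaceI) simp_all
  interpret Z: vectorspace K "V\<lparr>carrier := {\<zero>\<^bsub>V\<^esub>}\<rparr>"
    by (rule V.subspace_is_vs[OF sub])
  show "Z.dim = 0"
    using Z.dim_basis[of "{}"] Z.span_empty
    by (simp add: Z.basis_def Z.lin_dep_def)
qed

lemma map_rank_0_iff:
  assumes "fdvs K V" "linear_map K U V f"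
  shows "map_rank K U V f = 0 \<longleftrightarrow> (\<forall>u\<in>carrier U. f u = \<zero>\<^bsub>V\<^esub>)"
proof -
  interpret f: linear_map K U V f by fact
  note V = fdvsD[OF assms(1)]
  have sub: "{\<zero>\<^bsub>V\<^esub>} \<subseteq> f ` carrier U"
    using f.f0_is_0 subspace.submod[OF zero_subspace_dim(2)[OF f.V.vectorspace_axioms]]
    by (force simp: submodule_def)
  have "map_rank K U V f = 0 \<longleftrightarrow> f ` carrier U = {\<zero>\<^bsub>V\<^esub>}"
    using dim_mono(2)[OF V zero_subspace_dim(2)[OF V(1)] linear_map_im_subspace[OF assms(2)] sub]
      zero_subspace_dim(1)[OF V(1)] by (auto simp: map_rank_def)
  also have "\<dots> \<longleftrightarrow> (\<forall>u\<in>carrier U. f u = \<zero>\<^bsub>V\<^esub>)"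
    using sub by auto
  finally show ?thesis .
qed

section \<open>Generalised inverses and factorisation\<close>

text \<open>\<open>f\<close> need not be onto, so what is lifted through \<open>f\<close> is the
  projection onto its image, not the identity of \<open>V\<close>.\<close>

lemma linear_map_pseudo_inverse:
  assumes "fdvs K V" and f: "linear_map K U V f"
  obtains h where "linear_map K V U h" "\<And>u. u \<in> carrier U \<Longrightarrow> f (h (f u)) = f u"
proof -
  note V = fdvsD[OF assms(1)]
  obtain p where p: "linear_map K V V p" "p ` carrier V = f ` carrier U" "\<And>v. v \<in> f ` carrier U \<Longrightarrow> p v = v"
    by (rule subspace_projection[OF V linear_map_im_subspace[OF f]]) (rule that)
  obtain h where h: "linear_map K V U h" "\<And>v. v \<in> carrier V \<Longrightarrow> f (h v) = p v"
    by (rule linear_lift_simple[OF V(2) p(1) f equalityD1[OF p(2)]]) (rule that)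
  interpret f: linear_map K U V f by fact
  have "f (h (f u)) = f u" if "u \<in> carrier U" for u
    using h(2)[of "f u"] p(3)[of "f u"] that by simp
  then show thesis
    using that h(1) by blast
qed

text \<open>The extra equation makes the idempotent \<open>h\<close> after \<open>f\<close> fix the
  chosen vector \<open>u\<close>; in general such an idempotent moves \<open>u\<close> within its
  coset of the kernel of \<open>f\<close>.\<close>

lemma linear_map_pseudo_inverse_at:
  assumes "fdvs K V" and f: "linear_map K U V f" and u: "u \<in> carrier U" "f u \<noteq> \<zero>\<^bsub>V\<^esub>"
  obtains h where "linear_map K V U h" "\<And>u. u \<in> carrier U \<Longrightarrow> f (h (f u)) = f u" "h (f u) = u"
proof -
  note V = fdvsD[OF assms(1)]
  interpret f: linear_map K U V f by fact
  obtain p where p: "linear_map K V V p" "p ` carrier V = f ` carrier U" "\<And>v. v \<in> f ` carrier U \<Longrightarrow> p v = v"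
    by (rule subspace_projection[OF V linear_map_im_subspace[OF f]]) (rule that)
  have fu: "f u \<in> carrier V" "f u = p (f u)"
    using u p(3)[of "f u"] by simp_all
  obtain h where h: "linear_map K V U h" "\<And>v. v \<in> carrier V \<Longrightarrow> f (h v) = p v" "h (f u) = u"
    by (rule linear_lift[OF V(2) p(1) f equalityD1[OF p(2)] fu(1) u(2) u(1) fu(2)]) (rule that)
  have "f (h (f u)) = f u" if "u \<in> carrier U" for u
    using h(2)[of "f u"] p(3)[of "f u"] that by simp
  then show thesis
    using that h(1,3) by blast
qed

lemma linear_map_ker_diff:
  assumes "linear_map K U V f" "u \<in> carrier U" "v \<in> carrier U" "f u = f v"
  shows "u \<ominus>\<^bsub>U\<^esub> v \<in> map_ker U V f"
proof -
  interpret linear_map K U V f by fact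
  show ?thesis
    using assms vectorspace_minus_eq_zero_iff[OF W.vectorspace_axioms, of "f u" "f v"]
    by (simp add: map_ker_def)
qed

text \<open>\<open>x\<close> after a generalised inverse \<open>h\<close> of \<open>z\<close> works:
  \<open>h (z u)\<close> and \<open>u\<close> differ by an element of the kernel of
  \<open>z\<close>, on which \<open>x\<close> vanishes.\<close>

lemma linear_factor_right:
  assumes W: "fdvs K W" and z: "linear_map K U W z" and x: "linear_map K U V x"
    and ker: "map_ker U W z \<subseteq> map_ker U V x"
  obtains b where "linear_map K W V b" "\<And>u. u \<in> carrier U \<Longrightarrow> b (z u) = x u"
proof -
  obtain h where h: "linear_map K W U h" "\<And>u. u \<in> carrier U \<Longrightarrow> z (h (z u)) = z u"
    by (rule linear_map_pseudo_inverse[OF W z]) (rule that)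
  interpret h: linear_map K W U h by fact
  interpret z: linear_map K U W z by fact
  interpret x: linear_map K U V x by fact
  have "x (h (z u)) = x u" if u: "u \<in> carrier U" for u
  proof -
    have "h (z u) \<in> carrier U"
      using u by simp
    then have "h (z u) \<ominus>\<^bsub>U\<^esub> u \<in> map_ker U V x"
      using linear_map_ker_diff[OF z _ u h(2)[OF u]] ker by blast
    then have "x (h (z u)) \<ominus>\<^bsub>V\<^esub> x u = \<zero>\<^bsub>V\<^esub>"
      using u x.f_minus[of "h (z u)" u] by (simp add: map_ker_def)
    then show ?thesis
      using u vectorspace_minus_eq_zero_iff[OF x.W.vectorspace_axioms, of "x (h (z u))" "x u"] by simp
  qed
  then show thesis
    using that[OF linear_map_comp[OF h(1) x]] by blast
qed

text \<open>The rank inequality gives a surjection of the image of \<open>g\<close> onto that of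
  \<open>f\<close>. Preceded by a projection it becomes \<open>b\<close>, and \<open>f\<close> then
  lifts through \<open>b\<close> after \<open>g\<close>.\<close>

lemma linear_factor:
  assumes U: "fdvs K U" and V: "fdvs K V" and W: "fdvs K W" and Y: "fdvs K Y"
    and f: "linear_map K U V f" and g: "linear_map K W Y g"
    and le: "map_rank K U V f \<le> map_rank K W Y g"
  obtains a b where "linear_map K U W a" "linear_map K Y V b" "\<And>u. u \<in> carrier U \<Longrightarrow> b (g (a u)) = f u"
proof -
  note subf = linear_map_im_subspace[OF f] and subg = linear_map_im_subspace[OF g]
  obtain p where p: "linear_map K Y Y p" "p ` carrier Y = g ` carrier W" "\<And>v. v \<in> g ` carrier W \<Longrightarrow> p v = v"
    by (rule subspace_projection[OF fdvsD[OF Y] subg]) (rule that)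
  obtain T where T: "linear_map K (Y\<lparr>carrier := g ` carrier W\<rparr>) (V\<lparr>carrier := f ` carrier U\<rparr>) T"
    and surj: "T ` carrier (Y\<lparr>carrier := g ` carrier W\<rparr>) = carrier (V\<lparr>carrier := f ` carrier U\<rparr>)"
    by (rule linear_surjection[OF fdvsD[OF fdvs_subspace[OF Y subg]] fdvsD[OF fdvs_subspace[OF V subf]]])
      (use le in \<open>simp add: map_rank_def\<close>)
  interpret p: linear_map K Y Y p by fact
  interpret g: linear_map K W Y g by fact
  have p': "linear_map K Y (Y\<lparr>carrier := g ` carrier W\<rparr>) p"
    using p(2) by (intro linear_mapI fdvsD(1)[OF Y] fdvsD(1)[OF fdvs_subspace[OF Y subg]]) auto
  have b: "linear_map K Y V (\<lambda>y. T (p y))"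
    by (rule linear_map_comp[OF p' linear_map_into_subspace[OF T fdvsD(1)[OF V] subf]])
  have im: "f ` carrier U \<subseteq> (\<lambda>w. T (p (g w))) ` carrier W"
  proof
    fix v
    assume "v \<in> f ` carrier U"
    then have "v \<in> T ` (g ` carrier W)"
      using surj by simp
    then obtain w where "w \<in> carrier W" "v = T (g w)"
      by (elim imageE) simp
    then show "v \<in> (\<lambda>w. T (p (g w))) ` carrier W"
      using p(3)[of "g w"] by (intro image_eqI[of _ _ w]) simp_all
  qed
  show thesis
    by (rule linear_lift_simple[OF fdvsD(2)[OF U] f linear_map_comp[OF g b] im]) (rule that[OF _ b])
qed

section \<open>Lines and the maps that kill them\<close>

definition line where
  "line K V w = {c \<odot>\<^bsub>V\<^esub> w | c. c \<in> carrier K}"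

lemma line_subspace:
  assumes "vectorspace K V" "w \<in> carrier V"
  shows "subspace K (line K V w) V" and "w \<in> line K V w"
    and "w \<noteq> \<zero>\<^bsub>V\<^esub> \<Longrightarrow> vectorspace.dim K (V\<lparr>carrier := line K V w\<rparr>) = 1"
proof -
  interpret V: vectorspace K V by fact
  have "V.span {w} = {V.lincomb a {w} | a. a \<in> {w} \<rightarrow> carrier K}"
    using assms(2) by (intro V.finite_span) simp_all
  also have "\<dots> = {a w \<odot>\<^bsub>V\<^esub> w | a. a \<in> {w} \<rightarrow> carrier K}"
  proof -
    have "V.lincomb a {w} = a w \<odot>\<^bsub>V\<^esub> w" if "a \<in> {w} \<rightarrow> carrier K" for a
      using assms(2) that by (simp add: V.lincomb_def)
    then show ?thesis
      by (intro Collect_cong ex_cong1) auto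
  qed
  also have "\<dots> = line K V w"
  proof (intro subset_antisym subsetI)
    fix v
    assume "v \<in> line K V w"
    then obtain c where "c \<in> carrier K" "v = c \<odot>\<^bsub>V\<^esub> w"
      unfolding line_def by (elim CollectE exE conjE)
    then show "v \<in> {a w \<odot>\<^bsub>V\<^esub> w | a. a \<in> {w} \<rightarrow> carrier K}"
      by (intro CollectI exI[of _ "\<lambda>_. c"]) simp
  next
    fix v
    assume "v \<in> {a w \<odot>\<^bsub>V\<^esub> w | a. a \<in> {w} \<rightarrow> carrier K}"
    then show "v \<in> line K V w"
      unfolding line_def by auto
  qed
  finally have span: "V.span {w} = line K V w" .
  show sub: "subspace K (line K V w) V"
    unfolding span[symmetric] using assms(2) by (intro V.span_is_subspace) simp
  show w: "w \<in> line K V w"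
    unfolding line_def using assms(2) by (intro CollectI exI[of _ "\<one>\<^bsub>K\<^esub>"]) simp
  interpret W: vectorspace K "V\<lparr>carrier := line K V w\<rparr>"
    by (rule V.subspace_is_vs[OF sub])
  show "W.dim = 1" if "w \<noteq> \<zero>\<^bsub>V\<^esub>"
  proof -
    have m: "submodule K (line K V w) V"
      using sub by (simp add: subspace_def)
    have ww: "{w} \<subseteq> line K V w"
      using w by simp
    have "W.basis {w}"
      using V.span_li_not_depend[OF ww m] V.singleton_li[OF assms(2) that] span w
      by (simp add: W.basis_def)
    then show ?thesis
      using W.dim_basis[of "{w}"] by simp
  qed
qed

lemma lineE:
  assumes "v \<in> line K V w"
  obtains c where "c \<in> carrier K" "v = c \<odot>\<^bsub>V\<^esub> w"
  using assms unfolding line_def by (elim CollectE exE conjE)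

lemma kill_line:
  assumes V: "fdvs K V" and w: "w \<in> carrier V"
  obtains \<rho> where "linear_map K V V \<rho>" "map_ker V V \<rho> = line K V w"
proof -
  interpret V: vectorspace K V by (rule fdvsD(1)[OF V])
  note line = line_subspace[OF fdvsD(1)[OF V] w]
  obtain p where p: "linear_map K V V p" "p ` carrier V = line K V w" "\<And>v. v \<in> line K V w \<Longrightarrow> p v = v"
    by (rule subspace_projection[OF fdvsD[OF V] line(1)]) (rule that)
  interpret p: linear_map K V V p by fact
  define \<rho> where "\<rho> v = v \<ominus>\<^bsub>V\<^esub> p v" for v
  have "linear_map K V V \<rho>"
  proof (rule linear_mapI[OF fdvsD(1)[OF V] fdvsD(1)[OF V]])
    show "\<rho> v \<in> carrier V" if "v \<in> carrier V" for v
      using that by (simp add: \<rho>_def)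
    show "\<rho> (u \<oplus>\<^bsub>V\<^esub> v) = \<rho> u \<oplus>\<^bsub>V\<^esub> \<rho> v" if "u \<in> carrier V" "v \<in> carrier V" for u v
      using that by (simp add: \<rho>_def V.minus_eq V.minus_add V.a_ac)
    show "\<rho> (c \<odot>\<^bsub>V\<^esub> v) = c \<odot>\<^bsub>V\<^esub> \<rho> v" if "c \<in> carrier K" "v \<in> carrier V" for c v
      using that by (simp add: \<rho>_def V.minus_eq V.smult_r_distr V.smult_r_minus)
  qed
  moreover have "map_ker V V \<rho> = line K V w"
  proof (intro subset_antisym subsetI)
    fix v
    assume "v \<in> map_ker V V \<rho>"
    then have v: "v \<in> carrier V" "v \<ominus>\<^bsub>V\<^esub> p v = \<zero>\<^bsub>V\<^esub>"
      by (simp_all add: map_ker_def \<rho>_def)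
    then have "v = p v"
      using vectorspace_minus_eq_zero_iff[OF fdvsD(1)[OF V], of v "p v"] by simp
    moreover have "p v \<in> line K V w"
      using v(1) p(2) by (metis imageI)
    ultimately show "v \<in> line K V w"
      by simp
  next
    fix v
    assume v: "v \<in> line K V w"
    then have "v \<in> carrier V"
      using V.subspace_subset[OF line(1)] by (rule subsetD[rotated])
    then show "v \<in> map_ker V V \<rho>"
      using p(3)[OF v] vectorspace_minus_eq_zero_iff[OF fdvsD(1)[OF V]] by (simp add: map_ker_def \<rho>_def)
  qed
  ultimately show thesis
    by (rule that)
qed

text \<open>Rank-nullity for \<open>\<rho>\<close> restricted to the image of \<open>f\<close>: the
  line through \<open>w\<close> lies in that image, so the kernel of the restriction is exactly this
  line.\<close>

lemma map_rank_kill_line: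
  assumes U: "fdvs K U" and V: "fdvs K V" and f: "linear_map K U V f"
    and w: "w \<in> f ` carrier U" "w \<noteq> \<zero>\<^bsub>V\<^esub>"
    and \<rho>: "linear_map K V V \<rho>" "map_ker V V \<rho> = line K V w"
  shows "Suc (map_rank K U V (\<lambda>u. \<rho> (f u))) = map_rank K U V f"
proof -
  interpret f: linear_map K U V f by fact
  note subf = linear_map_im_subspace[OF f]
  let ?W = "V\<lparr>carrier := f ` carrier U\<rparr>"
  have wV: "w \<in> carrier V"
    using w by auto
  note line = line_subspace[OF fdvsD(1)[OF V] wV]
  have "line K V w \<subseteq> f ` carrier U"
  proof
    fix v
    assume "v \<in> line K V w"
    then obtain c where "c \<in> carrier K" "v = c \<odot>\<^bsub>V\<^esub> w"
      by (rule lineE)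
    then show "v \<in> f ` carrier U"
      using submodule.smult_closed[OF subspace.submod[OF subf] _ w(1)] by simp
  qed
  then have "map_ker ?W V \<rho> = line K V w"
    using \<rho>(2) f.W.subspace_subset[OF subf] by (auto simp: map_ker_def)
  moreover have "map_rank K ?W V \<rho> = map_rank K U V (\<lambda>u. \<rho> (f u))"
    by (simp add: map_rank_def image_image)
  ultimately show ?thesis
    using map_rank_nullity[OF fdvs_subspace[OF V subf] linear_map_from_subspace[OF \<rho>(1) subf]] line(3)[OF w(2)]
    by (simp add: map_rank_def)
qed

section \<open>Multipliers that separate or lower ranks\<close>

text \<open>A kernel of \<open>g\<close> not inside that of \<open>f\<close> is exploited by
  precomposition, an image of \<open>g\<close> not inside that of \<open>f\<close> by
  postcomposition. If both inclusions hold, the smaller kernel of \<open>g\<close> gives it at least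
  the rank of \<open>f\<close>; so the ranks agree and both inclusions are equalities.\<close>

lemma linear_separate:
  assumes U: "fdvs K U" and V: "fdvs K V" and f: "linear_map K U V f" and g: "linear_map K U V g"
    and le: "map_rank K U V g \<le> map_rank K U V f"
    and neq: "\<not> (f ` carrier U = g ` carrier U \<and> map_ker U V f = map_ker U V g)"
  shows "(\<exists>a. linear_map K U U a \<and> map_rank K U U a \<le> map_rank K U V f \<and>
        map_rank K U V (\<lambda>u. f (a u)) = map_rank K U V f \<and>
        map_rank K U V (\<lambda>u. g (a u)) < map_rank K U V f) \<or>
    (\<exists>b. linear_map K V V b \<and> map_rank K V V b \<le> map_rank K U V f \<and>
        map_rank K U V (\<lambda>u. b (f u)) = map_rank K U V f \<and>
        map_rank K U V (\<lambda>u. b (g u)) < map_rank K U V f)"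
    (is "(\<exists>a. ?A a) \<or> (\<exists>b. ?B b)")
proof -
  interpret f: linear_map K U V f by fact
  interpret g: linear_map K U V g by fact
  consider (ker) u where "u \<in> carrier U" "g u = \<zero>\<^bsub>V\<^esub>" "f u \<noteq> \<zero>\<^bsub>V\<^esub>"
    | (im) w where "w \<in> g ` carrier U" "w \<notin> f ` carrier U"
    | (eq) "map_ker U V g \<subseteq> map_ker U V f" "g ` carrier U \<subseteq> f ` carrier U"
    unfolding map_ker_def by auto
  then show ?thesis
  proof cases
    case ker
    \<comment> \<open>The choice \<open>h (f u) = u\<close> makes \<open>g\<close> still vanish at
      \<open>u\<close> after precomposition with \<open>h\<close> after \<open>f\<close>, although
      \<open>f u\<close> is nonzero.\<close>
    obtain h where h: "linear_map K V U h" "\<And>u. u \<in> carrier U \<Longrightarrow> f (h (f u)) = f u" "h (f u) = u"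
      by (rule linear_map_pseudo_inverse_at[OF V f ker(1,3)]) (rule that)
    interpret h: linear_map K V U h by fact
    let ?a = "\<lambda>u. h (f u)"
    have a: "linear_map K U U ?a" and ga: "linear_map K U V (\<lambda>u. g (?a u))"
      by (rule linear_map_comp[OF f h(1)], rule linear_map_comp[OF linear_map_comp[OF f h(1)] g])
    have "map_rank K U V (\<lambda>u. g (?a u)) < map_rank K U V f"
    proof (rule map_rank_ker_antimono(2)[OF U f ga])
      show "map_ker U V f \<subseteq> map_ker U V (\<lambda>u. g (?a u))"
        unfolding map_ker_def by auto
      have "u \<in> map_ker U V (\<lambda>u. g (?a u))" "u \<notin> map_ker U V f"
        unfolding map_ker_def using ker h(3) by simp_all
      then show "map_ker U V f \<noteq> map_ker U V (\<lambda>u. g (?a u))"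
        by blast
    qed
    moreover have "map_rank K U V (\<lambda>u. f (?a u)) = map_rank K U V f"
      by (rule map_rank_cong) (rule h(2))
    ultimately have "?A ?a"
      using a map_rank_comp_le(1)[OF U U f h(1)] by simp
    then show ?thesis
      by blast
  next
    case im
    obtain u where u: "u \<in> carrier U" "w = g u"
      using im(1) by (elim imageE) simp
    have wV: "w \<in> carrier V"
      using u by simp
    note line = line_subspace[OF fdvsD(1)[OF V] wV]
    have w0: "w \<noteq> \<zero>\<^bsub>V\<^esub>"
    proof
      assume "w = \<zero>\<^bsub>V\<^esub>"
      then have "w = f \<zero>\<^bsub>U\<^esub>"
        by simp
      moreover have "\<zero>\<^bsub>U\<^esub> \<in> carrier U"
        using zero_subspace_dim(2)[OF fdvsD(1)[OF U]] by (simp add: subspace_def submodule_def)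
      ultimately show False
        using im(2) by blast
    qed
    obtain \<rho> where \<rho>: "linear_map K V V \<rho>" "map_ker V V \<rho> = line K V w"
      by (rule kill_line[OF V wV]) (rule that)
    interpret \<rho>: linear_map K V V \<rho> by fact
    have \<rho>f: "linear_map K U V (\<lambda>u. \<rho> (f u))" and \<rho>g: "linear_map K U V (\<lambda>u. \<rho> (g u))"
      by (rule linear_map_comp[OF f \<rho>(1)], rule linear_map_comp[OF g \<rho>(1)])
    \<comment> \<open>The line through \<open>w\<close> meets the image of \<open>f\<close> only in
      zero, as \<open>w\<close> is not a value of \<open>f\<close>; so \<open>\<rho>\<close> is
      injective on that image and costs \<open>f\<close> no rank.\<close>
    have "map_ker U V (\<lambda>u. \<rho> (f u)) \<subseteq> map_ker U V f"
    proof
      fix v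
      assume v: "v \<in> map_ker U V (\<lambda>u. \<rho> (f u))"
      then have "f v \<in> map_ker V V \<rho>" and vU: "v \<in> carrier U"
        by (simp_all add: map_ker_def)
      then have "f v \<in> line K V w"
        by (simp add: \<rho>(2))
      then obtain c where c: "c \<in> carrier K" "f v = c \<odot>\<^bsub>V\<^esub> w"
        by (rule lineE)
      have "c = \<zero>\<^bsub>K\<^esub>"
      proof (rule ccontr)
        assume c0: "c \<noteq> \<zero>\<^bsub>K\<^esub>"
        have "w = inv\<^bsub>K\<^esub> c \<odot>\<^bsub>V\<^esub> f v"
          using f.W.mult_inverse[OF c(1) wV c(2)[symmetric] c0] .
        also have "\<dots> = f (inv\<^bsub>K\<^esub> c \<odot>\<^bsub>U\<^esub> v)"
          using vU vectorspace_inv_closed[OF fdvsD(1)[OF U] c(1) c0] by simp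
        finally have "w = f (inv\<^bsub>K\<^esub> c \<odot>\<^bsub>U\<^esub> v)" .
        moreover have "inv\<^bsub>K\<^esub> c \<odot>\<^bsub>U\<^esub> v \<in> carrier U"
          using vU vectorspace_inv_closed[OF fdvsD(1)[OF U] c(1) c0] by simp
        ultimately show False
          using im(2) by blast
      qed
      then have "f v = \<zero>\<^bsub>V\<^esub>"
        using c wV by simp
      then show "v \<in> map_ker U V f"
        using vU by (simp add: map_ker_def)
    qed
    then have "map_ker U V (\<lambda>u. \<rho> (f u)) = map_ker U V f"
      unfolding map_ker_def by auto
    then have rf: "map_rank K U V (\<lambda>u. \<rho> (f u)) = map_rank K U V f"
      by (rule map_rank_eq_ker[OF U \<rho>f f])
    have rg: "map_rank K U V (\<lambda>u. \<rho> (g u)) < map_rank K U V g"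
    proof (rule map_rank_ker_antimono(2)[OF U g \<rho>g])
      show "map_ker U V g \<subseteq> map_ker U V (\<lambda>u. \<rho> (g u))"
        unfolding map_ker_def by auto
      have "w \<in> map_ker V V \<rho>"
        unfolding \<rho>(2) by (rule line(2))
      then have "u \<in> map_ker U V (\<lambda>u. \<rho> (g u))" "u \<notin> map_ker U V g"
        using u w0 by (simp_all add: map_ker_def)
      then show "map_ker U V g \<noteq> map_ker U V (\<lambda>u. \<rho> (g u))"
        by blast
    qed
    \<comment> \<open>\<open>\<rho>\<close> alone may have too large a rank. The projection onto the
      image of \<open>\<rho>\<close> after \<open>f\<close> cuts it down to the rank of
      \<open>f\<close> and changes nothing on that image.\<close>
    obtain p where p: "linear_map K V V p" "p ` carrier V = (\<lambda>u. \<rho> (f u)) ` carrier U"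
      "\<And>v. v \<in> (\<lambda>u. \<rho> (f u)) ` carrier U \<Longrightarrow> p v = v"
      by (rule subspace_projection[OF fdvsD[OF V] linear_map_im_subspace[OF \<rho>f]]) (rule that)
    let ?b = "\<lambda>v. p (\<rho> v)"
    have b: "linear_map K V V ?b"
      by (rule linear_map_comp[OF \<rho>(1) p(1)])
    have "map_rank K V V p = map_rank K U V (\<lambda>u. \<rho> (f u))"
      by (simp add: map_rank_def p(2))
    then have "map_rank K V V ?b \<le> map_rank K U V f"
      using map_rank_comp_le(2)[OF V V \<rho>(1) p(1)] rf by simp
    moreover have "map_rank K U V (\<lambda>u. ?b (f u)) = map_rank K U V (\<lambda>u. \<rho> (f u))"
      by (rule map_rank_cong) (rule p(3), rule imageI)
    moreover have "map_rank K U V (\<lambda>u. ?b (g u)) \<le> map_rank K U V (\<lambda>u. \<rho> (g u))"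
      by (rule map_rank_comp_le(1)[OF U V \<rho>g p(1)])
    ultimately have "?B ?b"
      using b rf rg le by simp
    then show ?thesis
      by blast
  next
    case eq
    have "map_rank K U V f = map_rank K U V g"
      using le map_rank_ker_antimono(1)[OF U g f eq(1)] by simp
    then have "map_ker U V g = map_ker U V f"
      using map_rank_ker_antimono(2)[OF U g f eq(1)] by linarith
    moreover have "g ` carrier U = f ` carrier U"
      using map_rank_im_mono(2)[OF V g f eq(2)] \<open>map_rank K U V f = map_rank K U V g\<close> by simp
    ultimately show ?thesis
      using neq by simp
  qed
qed

text \<open>After projection onto the image of \<open>f\<close>, every value coming from
  \<open>g\<close> is also a value of \<open>f\<close>. Killing the line of a nonzero one lowers
  both ranks, that of \<open>f\<close> by exactly one, so the strict inequality survives. If the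
  projection annihilates \<open>g\<close>, then \<open>f\<close> has kept its rank against zero,
  which is the second alternative.\<close>

lemma linear_descend:
  assumes U: "fdvs K U" and V: "fdvs K V" and f: "linear_map K U V f" and g: "linear_map K U V g"
    and less: "map_rank K U V g < map_rank K U V f"
  shows "\<exists>b. linear_map K V V b \<and> map_rank K V V b \<le> map_rank K U V f \<and>
    map_rank K U V (\<lambda>u. b (g u)) < map_rank K U V (\<lambda>u. b (f u)) \<and>
    (Suc (map_rank K U V (\<lambda>u. b (f u))) = map_rank K U V f \<or>
     map_rank K U V (\<lambda>u. b (f u)) = map_rank K U V f \<and> map_rank K U V (\<lambda>u. b (g u)) = 0)"
proof -
  interpret f: linear_map K U V f by fact
  interpret g: linear_map K U V g by fact
  obtain p where p: "linear_map K V V p" "p ` carrier V = f ` carrier U" "\<And>v. v \<in> f ` carrier U \<Longrightarrow> p v = v"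
    by (rule subspace_projection[OF fdvsD[OF V] linear_map_im_subspace[OF f]]) (rule that)
  interpret p: linear_map K V V p by fact
  have rp: "map_rank K V V p = map_rank K U V f"
    by (simp add: map_rank_def p(2))
  have pg: "linear_map K U V (\<lambda>u. p (g u))"
    by (rule linear_map_comp[OF g p(1)])
  have pf: "p (f u) = f u" if "u \<in> carrier U" for u
    using that by (intro p(3) imageI)
  have rpg: "map_rank K U V (\<lambda>u. p (g u)) \<le> map_rank K U V g"
    by (rule map_rank_comp_le(1)[OF U V g p(1)])
  show ?thesis
  proof (cases "\<forall>u\<in>carrier U. p (g u) = \<zero>\<^bsub>V\<^esub>")
    case True
    then have "map_rank K U V (\<lambda>u. p (g u)) = 0"
      using map_rank_0_iff[OF V pg] by simp
    moreover have "map_rank K U V (\<lambda>u. p (f u)) = map_rank K U V f"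
      by (rule map_rank_cong) (rule pf)
    ultimately show ?thesis
      using p(1) rp less by (intro exI[of _ p]) simp
  next
    case False
    then obtain u where u: "u \<in> carrier U" "p (g u) \<noteq> \<zero>\<^bsub>V\<^esub>"
      by blast
    let ?w = "p (g u)"
    have w: "?w \<in> carrier V" "?w \<in> f ` carrier U"
      using u p(2) by (simp_all add: p(2)[symmetric])
    obtain \<rho> where \<rho>: "linear_map K V V \<rho>" "map_ker V V \<rho> = line K V ?w"
      by (rule kill_line[OF V w(1)]) (rule that)
    interpret \<rho>: linear_map K V V \<rho> by fact
    have \<rho>pg: "linear_map K U V (\<lambda>u. \<rho> (p (g u)))"
      by (rule linear_map_comp[OF pg \<rho>(1)])
    let ?b = "\<lambda>v. \<rho> (p v)"
    have b: "linear_map K V V ?b"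
      by (rule linear_map_comp[OF p(1) \<rho>(1)])
    have "map_rank K U V (\<lambda>u. ?b (f u)) = map_rank K U V (\<lambda>u. \<rho> (f u))"
      by (rule map_rank_cong) (simp add: pf)
    then have bf: "Suc (map_rank K U V (\<lambda>u. ?b (f u))) = map_rank K U V f"
      using map_rank_kill_line[OF U V f w(2) u(2) \<rho>] by simp
    have "map_rank K U V (\<lambda>u. ?b (g u)) < map_rank K U V (\<lambda>u. p (g u))"
    proof (rule map_rank_ker_antimono(2)[OF U pg \<rho>pg])
      show "map_ker U V (\<lambda>u. p (g u)) \<subseteq> map_ker U V (\<lambda>u. \<rho> (p (g u)))"
        unfolding map_ker_def by auto
      have "?w \<in> map_ker V V \<rho>"
        unfolding \<rho>(2) by (rule line_subspace(2)[OF fdvsD(1)[OF V] w(1)])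
      then have "u \<in> map_ker U V (\<lambda>u. \<rho> (p (g u)))" "u \<notin> map_ker U V (\<lambda>u. p (g u))"
        using u by (simp_all add: map_ker_def)
      then show "map_ker U V (\<lambda>u. p (g u)) \<noteq> map_ker U V (\<lambda>u. \<rho> (p (g u)))"
        by blast
    qed
    moreover have "map_rank K V V ?b \<le> map_rank K U V f"
      using map_rank_comp_le(1)[OF V V p(1) \<rho>(1)] rp by simp
    ultimately show ?thesis
      using b bf less rpg by (intro exI[of _ ?b]) simp
  qed
qed

section \<open>Pointwise parallel maps\<close>

lemma (in vectorspace) in_line_of_smult_eq:
  assumes "u \<in> carrier V" "v \<in> carrier V" "a \<in> carrier K" "b \<in> carrier K" "a \<noteq> \<zero>\<^bsub>K\<^esub>"
    and "a \<odot>\<^bsub>V\<^esub> u = b \<odot>\<^bsub>V\<^esub> v"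
  shows "u \<in> line K V v"
proof -
  have i: "inv\<^bsub>K\<^esub> a \<in> carrier K"
    by (rule vectorspace_inv_closed[OF vectorspace_axioms assms(3,5)])
  have "u = inv\<^bsub>K\<^esub> a \<odot>\<^bsub>V\<^esub> (b \<odot>\<^bsub>V\<^esub> v)"
    by (rule mult_inverse[OF assms(3,1,6,5)])
  also have "\<dots> = (inv\<^bsub>K\<^esub> a \<otimes>\<^bsub>K\<^esub> b) \<odot>\<^bsub>V\<^esub> v"
    using i assms(2,4) by (simp add: smult_assoc1)
  finally show ?thesis
    unfolding line_def using i assms(4) by (intro CollectI exI[of _ "inv\<^bsub>K\<^esub> a \<otimes>\<^bsub>K\<^esub> b"]) simp
qed

lemma (in vectorspace) add_nonzero_off_line:
  assumes "u \<in> carrier V" "v \<in> carrier V" "u \<notin> line K V v"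
  shows "u \<oplus>\<^bsub>V\<^esub> v \<noteq> \<zero>\<^bsub>V\<^esub>"
proof
  assume "u \<oplus>\<^bsub>V\<^esub> v = \<zero>\<^bsub>V\<^esub>"
  then have "u = \<ominus>\<^bsub>V\<^esub> v"
    using assms M.minus_equality[of u v] by simp
  also have "\<dots> = (\<ominus>\<^bsub>K\<^esub> \<one>\<^bsub>K\<^esub>) \<odot>\<^bsub>V\<^esub> v"
    using assms by (simp add: smult_l_minus)
  finally have "u \<in> line K V v"
    unfolding line_def by (intro CollectI exI[of _ "\<ominus>\<^bsub>K\<^esub> \<one>\<^bsub>K\<^esub>"]) simp
  then show False
    using assms(3) by simp
qed

text \<open>Coefficients are compared without completing \<open>u\<close> and \<open>v\<close> to a
  basis: collecting terms gives \<open>(a - c) u = (c - b) v\<close>. As \<open>u\<close> is off the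
  line of \<open>v\<close>, first \<open>a = c\<close>, and then \<open>c = b\<close> because
  \<open>v\<close> is nonzero.\<close>

lemma (in vectorspace) equal_factors_off_line:
  assumes uv: "u \<in> carrier V" "v \<in> carrier V" "v \<noteq> \<zero>\<^bsub>V\<^esub>" "u \<notin> line K V v"
    and abc: "a \<in> carrier K" "b \<in> carrier K" "c \<in> carrier K"
    and eq: "a \<odot>\<^bsub>V\<^esub> u \<oplus>\<^bsub>V\<^esub> b \<odot>\<^bsub>V\<^esub> v = c \<odot>\<^bsub>V\<^esub> (u \<oplus>\<^bsub>V\<^esub> v)"
  shows "a = b"
proof -
  have minus: "(a \<ominus>\<^bsub>K\<^esub> b) \<odot>\<^bsub>V\<^esub> x = a \<odot>\<^bsub>V\<^esub> x \<oplus>\<^bsub>V\<^esub> \<ominus>\<^bsub>V\<^esub> (b \<odot>\<^bsub>V\<^esub> x)"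
    if "a \<in> carrier K" "b \<in> carrier K" "x \<in> carrier V" for a b x
    using that by (simp add: R.minus_eq smult_l_distr smult_l_minus)
  let ?au = "a \<odot>\<^bsub>V\<^esub> u" and ?bv = "b \<odot>\<^bsub>V\<^esub> v" and ?cu = "c \<odot>\<^bsub>V\<^esub> u" and ?cv = "c \<odot>\<^bsub>V\<^esub> v"
  have cl: "?au \<in> carrier V" "?bv \<in> carrier V" "?cu \<in> carrier V" "?cv \<in> carrier V"
    using uv abc by simp_all
  have "?au \<oplus>\<^bsub>V\<^esub> \<ominus>\<^bsub>V\<^esub> ?cu = (?au \<oplus>\<^bsub>V\<^esub> ?bv) \<oplus>\<^bsub>V\<^esub> (\<ominus>\<^bsub>V\<^esub> ?bv \<oplus>\<^bsub>V\<^esub> \<ominus>\<^bsub>V\<^esub> ?cu)"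
    using cl by (simp add: M.a_assoc M.r_neg1 M.r_neg2)
  also have "?au \<oplus>\<^bsub>V\<^esub> ?bv = ?cv \<oplus>\<^bsub>V\<^esub> ?cu"
    using eq uv abc by (simp add: smult_r_distr M.a_comm)
  also have "(?cv \<oplus>\<^bsub>V\<^esub> ?cu) \<oplus>\<^bsub>V\<^esub> (\<ominus>\<^bsub>V\<^esub> ?bv \<oplus>\<^bsub>V\<^esub> \<ominus>\<^bsub>V\<^esub> ?cu) = ?cv \<oplus>\<^bsub>V\<^esub> \<ominus>\<^bsub>V\<^esub> ?bv"
    using cl by (simp add: M.a_assoc M.a_comm[of "\<ominus>\<^bsub>V\<^esub> ?bv"] M.r_neg1 M.r_neg2)
  finally have eq2: "(a \<ominus>\<^bsub>K\<^esub> c) \<odot>\<^bsub>V\<^esub> u = (c \<ominus>\<^bsub>K\<^esub> b) \<odot>\<^bsub>V\<^esub> v"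
    using minus uv abc by simp
  have d: "a \<ominus>\<^bsub>K\<^esub> c \<in> carrier K" "c \<ominus>\<^bsub>K\<^esub> b \<in> carrier K"
    using abc by (simp_all add: R.minus_eq)
  have ac: "a \<ominus>\<^bsub>K\<^esub> c = \<zero>\<^bsub>K\<^esub>"
    using in_line_of_smult_eq[OF uv(1,2) d _ eq2] uv(4) by (rule contrapos_np[rotated])
  have cb: "c \<ominus>\<^bsub>K\<^esub> b = \<zero>\<^bsub>K\<^esub>"
  proof (rule ccontr)
    assume n: "c \<ominus>\<^bsub>K\<^esub> b \<noteq> \<zero>\<^bsub>K\<^esub>"
    have "(c \<ominus>\<^bsub>K\<^esub> b) \<odot>\<^bsub>V\<^esub> v = \<zero>\<^bsub>V\<^esub>"
      using eq2 ac uv(1) by simp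
    then have "v = inv\<^bsub>K\<^esub> (c \<ominus>\<^bsub>K\<^esub> b) \<odot>\<^bsub>V\<^esub> \<zero>\<^bsub>V\<^esub>"
      by (rule mult_inverse[OF d(2) uv(2) _ n])
    then show False
      using uv(3) vectorspace_inv_closed[OF vectorspace_axioms d(2) n] by simp
  qed
  show ?thesis
    using ac cb R.minus_eq_zero_iff abc by simp
qed

text \<open>Two linear maps with the same kernel that are pointwise parallel are proportional: compare the
  factors at \<open>u\<close>, at a fixed \<open>v\<close> outside the kernel, and at their sum.\<close>

lemma linear_maps_proportional:
  assumes f: "linear_map K U V f" and g: "linear_map K U V g"
    and ker: "map_ker U V f = map_ker U V g"
    and par: "\<And>u. u \<in> carrier U \<Longrightarrow> f u \<noteq> \<zero>\<^bsub>V\<^esub> \<Longrightarrow> g u \<in> line K V (f u)"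
  shows "\<exists>c\<in>carrier K - {\<zero>\<^bsub>K\<^esub>}. \<forall>u\<in>carrier U. g u = c \<odot>\<^bsub>V\<^esub> f u"
proof -
  interpret V: vectorspace K V
    using f by (simp add: linear_map_def)
  interpret U: abelian_group U
    using f by (simp add: linear_map_def vectorspace_def module_def)
  interpret f: linear_map K U V f by fact
  interpret g: linear_map K U V g by fact
  have ker0: "f u = \<zero>\<^bsub>V\<^esub> \<longleftrightarrow> g u = \<zero>\<^bsub>V\<^esub>" if "u \<in> carrier U" for u
    using ker that unfolding map_ker_def by blast
  show ?thesis
  proof (cases "\<forall>u\<in>carrier U. f u = \<zero>\<^bsub>V\<^esub>")
    case True
    then have "\<forall>u\<in>carrier U. g u = \<one>\<^bsub>K\<^esub> \<odot>\<^bsub>V\<^esub> f u"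
      using ker0 by simp
    then show ?thesis
      using V.one_not_zero by (intro bexI[of _ "\<one>\<^bsub>K\<^esub>"]) simp_all
  next
    case False
    then obtain v where v: "v \<in> carrier U" "f v \<noteq> \<zero>\<^bsub>V\<^esub>"
      by blast
    obtain c where c: "c \<in> carrier K" "g v = c \<odot>\<^bsub>V\<^esub> f v"
      using par[OF v] by (rule lineE)
    have c0: "c \<noteq> \<zero>\<^bsub>K\<^esub>"
    proof
      assume "c = \<zero>\<^bsub>K\<^esub>"
      then have "g v = \<zero>\<^bsub>V\<^esub>"
        using c v by simp
      then show False
        using ker0[OF v(1)] v(2) by simp
    qed
    have "g u = c \<odot>\<^bsub>V\<^esub> f u" if u: "u \<in> carrier U" for u
    proof (cases "f u \<in> line K V (f v)")
      case True
      then obtain d where d: "d \<in> carrier K" "f u = d \<odot>\<^bsub>V\<^esub> f v"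
        by (rule lineE)
      have dv: "d \<odot>\<^bsub>U\<^esub> v \<in> carrier U" "f u = f (d \<odot>\<^bsub>U\<^esub> v)"
        using d v by simp_all
      \<comment> \<open>Instead of the sum, the difference \<open>u - d v\<close> is used here: it
        lies in the common kernel, so \<open>g\<close> treats \<open>u\<close> like
        \<open>d v\<close>.\<close>
      then have "u \<ominus>\<^bsub>U\<^esub> d \<odot>\<^bsub>U\<^esub> v \<in> map_ker U V g"
        using linear_map_ker_diff[OF f u dv] ker by simp
      then have "g u \<ominus>\<^bsub>V\<^esub> g (d \<odot>\<^bsub>U\<^esub> v) = \<zero>\<^bsub>V\<^esub>"
        using g.f_minus[OF u dv(1)] by (simp add: map_ker_def)
      then have "g u = g (d \<odot>\<^bsub>U\<^esub> v)"
        using u dv V.M.minus_eq_zero_iff[of "g u" "g (d \<odot>\<^bsub>U\<^esub> v)"] by simp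
      also have "\<dots> = d \<odot>\<^bsub>V\<^esub> (c \<odot>\<^bsub>V\<^esub> f v)"
        using d(1) v(1) c by simp
      also have "\<dots> = c \<odot>\<^bsub>V\<^esub> (d \<odot>\<^bsub>V\<^esub> f v)"
        using d(1) v(1) c(1) by (simp add: V.smult_assoc1[symmetric] V.R.m_comm)
      finally show ?thesis
        using d(2) by simp
    next
      case False
      have fu: "f u \<in> carrier V" "f v \<in> carrier V" and uv: "u \<oplus>\<^bsub>U\<^esub> v \<in> carrier U"
        using u v by simp_all
      have "f u \<noteq> \<zero>\<^bsub>V\<^esub>"
      proof
        assume "f u = \<zero>\<^bsub>V\<^esub>"
        then have "f u = \<zero>\<^bsub>K\<^esub> \<odot>\<^bsub>V\<^esub> f v"
          using fu by simp
        then show False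
          using False unfolding line_def by (metis (mono_tags, lifting) CollectI V.R.zero_closed)
      qed
      from par[OF u this] obtain c' where c': "c' \<in> carrier K" "g u = c' \<odot>\<^bsub>V\<^esub> f u"
        by (rule lineE)
      have "f (u \<oplus>\<^bsub>U\<^esub> v) \<noteq> \<zero>\<^bsub>V\<^esub>"
        using V.add_nonzero_off_line[OF fu False] u v by simp
      from par[OF uv this] obtain c'' where c'': "c'' \<in> carrier K" "g (u \<oplus>\<^bsub>U\<^esub> v) = c'' \<odot>\<^bsub>V\<^esub> f (u \<oplus>\<^bsub>U\<^esub> v)"
        by (rule lineE)
      have "c' \<odot>\<^bsub>V\<^esub> f u \<oplus>\<^bsub>V\<^esub> c \<odot>\<^bsub>V\<^esub> f v = c'' \<odot>\<^bsub>V\<^esub> (f u \<oplus>\<^bsub>V\<^esub> f v)"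
        using c''(2) c(2) c'(2) u v by simp
      then have "c' = c"
        by (rule V.equal_factors_off_line[OF fu v(2) False c'(1) c(1) c''(1)])
      then show ?thesis
        using c' by simp
    qed
    then show ?thesis
      using c(1) c0 by (intro bexI[of _ c]) simp_all
  qed
qed

text \<open>The killed line lies in the common image, so both ranks drop by exactly one. The vector
  \<open>u\<close> enters only one of the two kernels, because \<open>g u\<close> is off the line of
  \<open>f u\<close>.\<close>

lemma linear_descend_parallel:
  assumes U: "fdvs K U" and V: "fdvs K V" and f: "linear_map K U V f" and g: "linear_map K U V g"
    and im: "f ` carrier U = g ` carrier U" and ker: "map_ker U V f = map_ker U V g"
    and neq: "\<not> (\<exists>c\<in>carrier K - {\<zero>\<^bsub>K\<^esub>}. \<forall>u\<in>carrier U. g u = c \<odot>\<^bsub>V\<^esub> f u)"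
  shows "\<exists>b. linear_map K V V b \<and> map_rank K V V b \<le> map_rank K U V f \<and>
    Suc (map_rank K U V (\<lambda>u. b (f u))) = map_rank K U V f \<and>
    map_rank K U V (\<lambda>u. b (g u)) = map_rank K U V (\<lambda>u. b (f u)) \<and>
    map_ker U V (\<lambda>u. b (f u)) \<noteq> map_ker U V (\<lambda>u. b (g u))"
proof -
  interpret f: linear_map K U V f by fact
  interpret g: linear_map K U V g by fact
  obtain u where u: "u \<in> carrier U" "f u \<noteq> \<zero>\<^bsub>V\<^esub>" "g u \<notin> line K V (f u)"
    using linear_maps_proportional[OF f g ker] neq by blast
  let ?w = "f u"
  have w: "?w \<in> carrier V" "?w \<in> f ` carrier U" "?w \<in> g ` carrier U"
    using u im by auto
  obtain p where p: "linear_map K V V p" "p ` carrier V = f ` carrier U" "\<And>v. v \<in> f ` carrier U \<Longrightarrow> p v = v"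
    by (rule subspace_projection[OF fdvsD[OF V] linear_map_im_subspace[OF f]]) (rule that)
  obtain \<rho> where \<rho>: "linear_map K V V \<rho>" "map_ker V V \<rho> = line K V ?w"
    by (rule kill_line[OF V w(1)]) (rule that)
  let ?b = "\<lambda>v. \<rho> (p v)"
  have b: "linear_map K V V ?b"
    by (rule linear_map_comp[OF p(1) \<rho>(1)])
  have pf: "p (f u) = f u" "p (g u) = g u" if "u \<in> carrier U" for u
    using that im p(3) by blast+
  have "map_rank K V V p = map_rank K U V f"
    by (simp add: map_rank_def p(2))
  then have rb: "map_rank K V V ?b \<le> map_rank K U V f"
    using map_rank_comp_le(1)[OF V V p(1) \<rho>(1)] by simp
  have "map_rank K U V (\<lambda>u. ?b (f u)) = map_rank K U V (\<lambda>u. \<rho> (f u))"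
    "map_rank K U V (\<lambda>u. ?b (g u)) = map_rank K U V (\<lambda>u. \<rho> (g u))"
    by (rule map_rank_cong; simp add: pf)+
  moreover have "map_rank K U V g = map_rank K U V f"
    by (simp add: map_rank_def im)
  ultimately have r: "Suc (map_rank K U V (\<lambda>u. ?b (f u))) = map_rank K U V f"
    "map_rank K U V (\<lambda>u. ?b (g u)) = map_rank K U V (\<lambda>u. ?b (f u))"
    using map_rank_kill_line[OF U V f w(2) u(2) \<rho>] map_rank_kill_line[OF U V g w(3) u(2) \<rho>] by simp_all
  have "?w \<in> map_ker V V \<rho>" "g u \<notin> map_ker V V \<rho>"
    unfolding \<rho>(2) using u(3) line_subspace(2)[OF fdvsD(1)[OF V] w(1)] by simp_all
  then have "u \<in> map_ker U V (\<lambda>u. ?b (f u))" "u \<notin> map_ker U V (\<lambda>u. ?b (g u))"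
    using u(1) pf[OF u(1)] by (simp_all add: map_ker_def)
  then have "map_ker U V (\<lambda>u. ?b (f u)) \<noteq> map_ker U V (\<lambda>u. ?b (g u))"
    by blast
  then show ?thesis
    using b rb r by (intro exI[of _ ?b]) simp
qed

section \<open>Congruences on the ideals of a stable regular category with a rank\<close>

locale partial_category =
  fixes S :: "('o, 'a) psemigroup" (structure)
  assumes comp_closed [simp]:
      "\<lbrakk>x \<in> arrows S; y \<in> arrows S; tgt S x = src S y\<rbrakk> \<Longrightarrow> x \<star> y \<in> arrows S"
    and src_comp [simp]:
      "\<lbrakk>x \<in> arrows S; y \<in> arrows S; tgt S x = src S y\<rbrakk> \<Longrightarrow> src S (x \<star> y) = src S x"
    and tgt_comp [simp]:
      "\<lbrakk>x \<in> arrows S; y \<in> arrows S; tgt S x = src S y\<rbrakk> \<Longrightarrow> tgt S (x \<star> y) = tgt S y"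
    and assoc:
      "\<lbrakk>x \<in> arrows S; y \<in> arrows S; z \<in> arrows S; tgt S x = src S y; tgt S y = src S z\<rbrakk>
        \<Longrightarrow> (x \<star> y) \<star> z = x \<star> (y \<star> z)"
begin

lemma green_HI:
  assumes "x \<in> arrows S" "y \<in> arrows S"
    and "s \<in> arrows S" "tgt S x = src S s" "y = x \<star> s"
    and "t \<in> arrows S" "tgt S y = src S t" "x = y \<star> t"
    and "u \<in> arrows S" "tgt S u = src S x" "y = u \<star> x"
    and "v \<in> arrows S" "tgt S v = src S y" "x = v \<star> y"
  shows "(x, y) \<in> green_H S"
proof -
  have R: "right_principal S y \<subseteq> right_principal S x"
    if "x \<in> arrows S" "s \<in> arrows S" "tgt S x = src S s" "y = x \<star> s" for x y s
  proof
    fix w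
    assume "w \<in> right_principal S y"
    then consider "w = y" | c where "w = y \<star> c" "c \<in> arrows S" "tgt S y = src S c"
      unfolding right_principal_def composable_def by auto
    then show "w \<in> right_principal S x"
    proof cases
      case 2
      then have "w = x \<star> (s \<star> c)" "s \<star> c \<in> arrows S" "tgt S x = src S (s \<star> c)"
        using that by (simp_all add: assoc)
      then show ?thesis
        unfolding right_principal_def composable_def by blast
    qed (use that in \<open>auto simp: right_principal_def composable_def\<close>)
  qed
  have L: "left_principal S y \<subseteq> left_principal S x"
    if "x \<in> arrows S" "s \<in> arrows S" "tgt S s = src S x" "y = s \<star> x" for x y s
  proof
    fix w
    assume "w \<in> left_principal S y"
    then consider "w = y" | c where "w = c \<star> y" "c \<in> arrows S" "tgt S c = src S y"
      unfolding left_principal_def composable_def by auto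
    then show "w \<in> left_principal S x"
    proof cases
      case 2
      then have "w = (c \<star> s) \<star> x" "c \<star> s \<in> arrows S" "tgt S (c \<star> s) = src S x"
        using that by (simp_all add: assoc)
      then show ?thesis
        unfolding left_principal_def composable_def by blast
    qed (use that in \<open>auto simp: left_principal_def composable_def\<close>)
  qed
  show ?thesis
    unfolding green_H_def green_R_def green_L_def
    using R[OF assms(1,3-5)] R[OF assms(2,6-8)] L[OF assms(1,9-11)] L[OF assms(2,12-14)] assms(1,2)
    by auto
qed

end

text \<open>The interface to linear algebra. The bounds by \<open>rk x\<close> in the last three
  axioms keep the multipliers inside every ideal that contains \<open>x\<close>.
  \<open>regular\<close> takes the place of identities, and \<open>stab_left\<close> and
  \<open>stab_right\<close> (stability) say that a multiplication without loss of rank can be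
  undone. Both descents multiply on the right only, while \<open>separate\<close> has to allow
  either side.\<close>

locale graded_category = partial_category S for S :: "('o, 'a) psemigroup" (structure) +
  fixes rk :: "'a \<Rightarrow> nat"
  assumes rk_comp_le1:
      "\<lbrakk>x \<in> arrows S; y \<in> arrows S; tgt S x = src S y\<rbrakk> \<Longrightarrow> rk (x \<star> y) \<le> rk x"
    and rk_comp_le2:
      "\<lbrakk>x \<in> arrows S; y \<in> arrows S; tgt S x = src S y\<rbrakk> \<Longrightarrow> rk (x \<star> y) \<le> rk y"
    and zero_ex:
      "x \<in> arrows S \<Longrightarrow> \<exists>z. (x, z) \<in> nabla S \<and> rk z = 0"
    and zero_unique:
      "\<lbrakk>(x, y) \<in> nabla S; rk x = 0; rk y = 0\<rbrakk> \<Longrightarrow> x = y"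
    and factor:
      "\<lbrakk>x \<in> arrows S; z \<in> arrows S; rk x \<le> rk z\<rbrakk>
        \<Longrightarrow> \<exists>a\<in>arrows S. \<exists>b\<in>arrows S. tgt S a = src S z \<and> tgt S z = src S b \<and> x = a \<star> z \<star> b"
    and regular:
      "x \<in> arrows S \<Longrightarrow>
        \<exists>x'\<in>arrows S. src S x' = tgt S x \<and> tgt S x' = src S x \<and> x \<star> x' \<star> x = x"
    and stab_left:
      "\<lbrakk>a \<in> arrows S; x \<in> arrows S; tgt S a = src S x; rk (a \<star> x) = rk x\<rbrakk>
        \<Longrightarrow> \<exists>a'\<in>arrows S. tgt S a' = src S a \<and> a' \<star> (a \<star> x) = x"
    and stab_right:
      "\<lbrakk>x \<in> arrows S; b \<in> arrows S; tgt S x = src S b; rk (x \<star> b) = rk x\<rbrakk>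
        \<Longrightarrow> \<exists>b'\<in>arrows S. src S b' = tgt S b \<and> (x \<star> b) \<star> b' = x"
    and separate:
      "\<lbrakk>(x, y) \<in> nabla S; rk y \<le> rk x; (x, y) \<notin> green_H S\<rbrakk> \<Longrightarrow>
        (\<exists>a\<in>arrows S. tgt S a = src S x \<and> rk a \<le> rk x \<and> rk (a \<star> x) = rk x \<and> rk (a \<star> y) < rk x) \<or>
        (\<exists>b\<in>arrows S. src S b = tgt S x \<and> rk b \<le> rk x \<and> rk (x \<star> b) = rk x \<and> rk (y \<star> b) < rk x)"
    and descend:
      "\<lbrakk>(x, y) \<in> nabla S; rk y < rk x\<rbrakk> \<Longrightarrow>
        \<exists>b\<in>arrows S. src S b = tgt S x \<and> rk b \<le> rk x \<and> rk (y \<star> b) < rk (x \<star> b) \<and>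
          (Suc (rk (x \<star> b)) = rk x \<or> rk (x \<star> b) = rk x \<and> rk (y \<star> b) = 0)"
    and descend_H:
      "\<lbrakk>(x, y) \<in> nabla S; (x, y) \<in> green_H S; x \<noteq> y\<rbrakk> \<Longrightarrow>
        \<exists>b\<in>arrows S. src S b = tgt S x \<and> rk b \<le> rk x \<and> Suc (rk (x \<star> b)) = rk x \<and>
          rk (y \<star> b) = rk (x \<star> b) \<and> (x \<star> b, y \<star> b) \<notin> green_H S"
begin

definition ideal :: "enat \<Rightarrow> 'a set" where
  "ideal r = {x \<in> arrows S. enat (rk x) \<le> r}"

lemma nablaD:
  assumes "(x, y) \<in> nabla S"
  shows "x \<in> arrows S" "y \<in> arrows S" "src S x = src S y" "tgt S x = tgt S y"
  using assms by (auto simp: nabla_def)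

lemma nabla_sym: "(x, y) \<in> nabla S \<Longrightarrow> (y, x) \<in> nabla S"
  by (auto simp: nabla_def)

lemma nabla_sub: "nabla (sub_psemigroup S A) =
    {(x, y). x \<in> A \<and> y \<in> A \<and> src S x = src S y \<and> tgt S x = tgt S y}"
  by (auto simp: nabla_def sub_psemigroup_def)

lemma ideal_arrows: "x \<in> ideal r \<Longrightarrow> x \<in> arrows S"
  by (simp add: ideal_def)

lemma in_ideal_mono: "x \<in> ideal r \<Longrightarrow> y \<in> arrows S \<Longrightarrow> rk y \<le> rk x \<Longrightarrow> y \<in> ideal r"
  unfolding ideal_def by (auto intro: order_trans[of "enat (rk y)" "enat (rk x)"])

text \<open>\<open>factor\<close> does not bound its multipliers, which could leave the ideal.
  Regularity writes \<open>x\<close> as \<open>(x x') x (x' x)\<close>; when the middle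
  \<open>x\<close> is factored, the outer parts begin and end with \<open>x\<close> and so have rank
  at most \<open>rk x\<close>.\<close>

lemma factor_bounded:
  assumes "x \<in> arrows S" "z \<in> arrows S" "rk x \<le> rk z"
  obtains a b where "a \<in> arrows S" "b \<in> arrows S" "tgt S a = src S z" "tgt S z = src S b"
    "x = a \<star> z \<star> b" "rk a \<le> rk x" "rk b \<le> rk x"
proof -
  obtain a b where ab: "a \<in> arrows S" "b \<in> arrows S" "tgt S a = src S z" "tgt S z = src S b"
    and x: "x = a \<star> z \<star> b"
    using factor[OF assms] by blast
  obtain x' where x': "x' \<in> arrows S" "src S x' = tgt S x" "tgt S x' = src S x" "x \<star> x' \<star> x = x"
    using regular[OF assms(1)] by blast
  have st: "src S x = src S a" "tgt S x = tgt S b"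
    using ab assms(2) x by simp_all
  have "x = (x \<star> x' \<star> x) \<star> x' \<star> x"
    using x'(4) by simp
  also have "\<dots> = (x \<star> x') \<star> x \<star> (x' \<star> x)"
    using assms(1) x'(1-3) by (simp add: assoc)
  also have "\<dots> = ((x \<star> x') \<star> a) \<star> z \<star> (b \<star> (x' \<star> x))"
    using assms(1,2) x'(1-3) ab st by (subst (2) x) (simp add: assoc)
  finally have "x = ((x \<star> x') \<star> a) \<star> z \<star> (b \<star> (x' \<star> x))" .
  moreover have "rk ((x \<star> x') \<star> a) \<le> rk x"
    using assms(1) x'(1-3) ab st by (simp add: assoc rk_comp_le1)
  moreover have "rk ((b \<star> x') \<star> x) \<le> rk x"
    using assms(1) x'(1-3) ab st by (intro rk_comp_le2) simp_all
  then have "rk (b \<star> (x' \<star> x)) \<le> rk x"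
    using assms(1) x'(1-3) ab st by (simp add: assoc)
  ultimately show ?thesis
    using that[of "(x \<star> x') \<star> a" "b \<star> (x' \<star> x)"] assms(1,2) x'(1-3) ab st by simp
qed

lemma green_H_rk:
  assumes "(x, y) \<in> green_H S"
  shows "rk x = rk y"
proof -
  have "rk x \<le> rk y" if "x \<in> right_principal S y" "y \<in> arrows S" for x y
    using that by (auto simp: right_principal_def composable_def rk_comp_le1)
  moreover have "x \<in> right_principal S x" for x
    by (simp add: right_principal_def)
  ultimately show ?thesis
    using assms unfolding green_H_def green_R_def by (metis (mono_tags, lifting) CollectD Int_iff case_prodD le_antisym)
qed

lemma equiv_green_H: "equiv (arrows S) (green_H S)"
  by (rule equivI) (auto simp: green_H_def green_R_def green_L_def intro!: refl_onI symI transI)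

end

section \<open>How a single related pair collapses the ranks below it\<close>

locale ideal_congruence = graded_category +
  fixes r :: enat and \<sigma>
  assumes cong: "congruence (sub_psemigroup S (ideal r)) \<sigma>"
begin

lemma equiv_\<sigma>: "equiv (ideal r) \<sigma>"
  using cong by (simp add: congruence_def sub_psemigroup_def)

lemma \<sigma>_refl: "x \<in> ideal r \<Longrightarrow> (x, x) \<in> \<sigma>"
  using equiv_\<sigma> by (simp add: equiv_def refl_on_def)

lemma \<sigma>_sym: "(x, y) \<in> \<sigma> \<Longrightarrow> (y, x) \<in> \<sigma>"
  using equiv_\<sigma> by (simp add: equiv_def sym_def)

lemma \<sigma>_trans: "(x, y) \<in> \<sigma> \<Longrightarrow> (y, z) \<in> \<sigma> \<Longrightarrow> (x, z) \<in> \<sigma>"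
  using equiv_\<sigma> by (meson equiv_def transD)

lemma \<sigma>_nabla_sub: "\<sigma> \<subseteq> nabla (sub_psemigroup S (ideal r))"
  using cong by (simp add: congruence_def)

lemma \<sigma>_ideal: assumes "(x, y) \<in> \<sigma>" shows "x \<in> ideal r" "y \<in> ideal r"
  using assms \<sigma>_nabla_sub by (auto simp: nabla_sub)

lemma \<sigma>_nabla: "(x, y) \<in> \<sigma> \<Longrightarrow> (x, y) \<in> nabla S"
  using \<sigma>_nabla_sub unfolding nabla_sub by (auto simp: nabla_def dest: ideal_arrows)

lemma \<sigma>_left: "(x, y) \<in> \<sigma> \<Longrightarrow> a \<in> ideal r \<Longrightarrow> tgt S a = src S x \<Longrightarrow> (a \<star> x, a \<star> y) \<in> \<sigma>"
  using cong by (auto simp: congruence_def sub_psemigroup_def composable_def)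

lemma \<sigma>_right: "(x, y) \<in> \<sigma> \<Longrightarrow> b \<in> ideal r \<Longrightarrow> tgt S x = src S b \<Longrightarrow> (x \<star> b, y \<star> b) \<in> \<sigma>"
  using cong by (auto simp: congruence_def sub_psemigroup_def composable_def)

text \<open>Every \<open>u\<close> of rank at most \<open>rk x\<close> is \<open>a x b\<close> with
  multipliers from the ideal, hence related to \<open>a z b\<close>, which has rank zero. The same
  holds for \<open>v\<close>, and parallel arrows of rank zero coincide.\<close>

lemma collapse_zero:
  assumes xz: "(x, z) \<in> \<sigma>" and z: "rk z = 0"
    and uv: "(u, v) \<in> nabla S" and u: "rk u \<le> rk x" and v: "rk v \<le> rk x"
  shows "(u, v) \<in> \<sigma>"
proof -
  have x: "x \<in> ideal r"
    using \<sigma>_ideal[OF xz] by blast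
  have zero: "\<exists>w. (u, w) \<in> \<sigma> \<and> rk w = 0" if u: "u \<in> arrows S" "rk u \<le> rk x" for u
  proof -
    obtain a b where ab: "a \<in> arrows S" "b \<in> arrows S" "tgt S a = src S x" "tgt S x = src S b"
      "u = a \<star> x \<star> b" "rk a \<le> rk u" "rk b \<le> rk u"
      using factor_bounded[OF u(1) ideal_arrows[OF x] u(2)] by blast
    have "a \<in> ideal r" "b \<in> ideal r"
      using in_ideal_mono[OF x] ab u(2) by auto
    then have "(a \<star> x \<star> b, a \<star> z \<star> b) \<in> \<sigma>"
      using xz ab ideal_arrows[OF x] by (intro \<sigma>_left \<sigma>_right) simp_all
    moreover have "rk (a \<star> z \<star> b) \<le> rk (a \<star> z)" "rk (a \<star> z) \<le> rk z"
      using ab nablaD[OF \<sigma>_nabla[OF xz]] by (auto intro!: rk_comp_le1 rk_comp_le2)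
    ultimately show ?thesis
      using ab z by auto
  qed
  obtain w w' where w: "(u, w) \<in> \<sigma>" "rk w = 0" "(v, w') \<in> \<sigma>" "rk w' = 0"
    using zero nablaD[OF uv] u v by metis
  have "(w, w') \<in> nabla S"
    using \<sigma>_nabla[OF w(1)] \<sigma>_nabla[OF w(3)] uv by (auto simp: nabla_def)
  then have "w = w'"
    using zero_unique w by blast
  then show ?thesis
    using w \<sigma>_sym \<sigma>_trans by blast
qed

lemma collapse:
  "\<lbrakk>(x, y) \<in> \<sigma>; rk y < rk x; (u, v) \<in> nabla S; rk u \<le> rk x; rk v \<le> rk x\<rbrakk> \<Longrightarrow> (u, v) \<in> \<sigma>"
proof (induction "rk x" arbitrary: x y u v rule: less_induct)
  case less
  have x: "x \<in> ideal r" and nab: "(x, y) \<in> nabla S"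
    using \<sigma>_ideal[OF less.prems(1)] \<sigma>_nabla[OF less.prems(1)] by blast+
  obtain b where b: "b \<in> arrows S" "src S b = tgt S x" "rk b \<le> rk x" "rk (y \<star> b) < rk (x \<star> b)"
    and alt: "Suc (rk (x \<star> b)) = rk x \<or> rk (x \<star> b) = rk x \<and> rk (y \<star> b) = 0"
    using descend[OF nab less.prems(2)] by blast
  have "b \<in> ideal r"
    using in_ideal_mono[OF x] b by blast
  then have xb: "(x \<star> b, y \<star> b) \<in> \<sigma>"
    using less.prems(1) b by (intro \<sigma>_right) simp_all
  from alt show ?case
  proof
    assume drop: "Suc (rk (x \<star> b)) = rk x"
    obtain z where z: "(y, z) \<in> nabla S" "rk z = 0"
      using zero_ex nablaD[OF nab] by blast
    \<comment> \<open>Since \<open>rk y < rk x = Suc (rk (x \<star> b))\<close>, the arrow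
      \<open>y\<close> is within the level of the smaller pair, and the induction hypothesis relates
      it to its zero arrow.\<close>
    have "(y, z) \<in> \<sigma>"
      using less.hyps[OF _ xb b(4) z(1)] drop z less.prems(2) by simp
    then have "(x, z) \<in> \<sigma>"
      using less.prems(1) \<sigma>_trans by blast
    then show ?thesis
      using collapse_zero z(2) less.prems(3-) by blast
  next
    \<comment> \<open>The second member has become zero without loss of rank in the first, so
      \<open>collapse_zero\<close> applies at the full level \<open>rk x\<close>.\<close>
    assume "rk (x \<star> b) = rk x \<and> rk (y \<star> b) = 0"
    then show ?thesis
      using collapse_zero[OF xb _ less.prems(3)] less.prems by simp
  qed
qed

text \<open>Separation produces a strict gap between the ranks while the larger one stays at
  \<open>rk x\<close>, so the collapse reaches up to \<open>rk x\<close> itself.\<close>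

lemma collapse_not_H:
  assumes "(x, y) \<in> \<sigma>" "(x, y) \<notin> green_H S" "rk y \<le> rk x"
    "(u, v) \<in> nabla S" "rk u \<le> rk x" "rk v \<le> rk x"
  shows "(u, v) \<in> \<sigma>"
proof -
  have x: "x \<in> ideal r" and nab: "(x, y) \<in> nabla S"
    using \<sigma>_ideal[OF assms(1)] \<sigma>_nabla[OF assms(1)] by blast+
  consider a where "a \<in> arrows S" "tgt S a = src S x" "rk a \<le> rk x"
      "rk (a \<star> x) = rk x" "rk (a \<star> y) < rk x"
    | b where "b \<in> arrows S" "src S b = tgt S x" "rk b \<le> rk x"
      "rk (x \<star> b) = rk x" "rk (y \<star> b) < rk x"
    using separate[OF nab assms(3,2)] by blast
  then show ?thesis
  proof cases
    case 1
    then have "(a \<star> x, a \<star> y) \<in> \<sigma>"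
      using assms(1) in_ideal_mono[OF x] by (intro \<sigma>_left) simp_all
    then show ?thesis
      using collapse[of "a \<star> x" "a \<star> y"] 1 assms by simp
  next
    case 2
    then have "(x \<star> b, y \<star> b) \<in> \<sigma>"
      using assms(1) in_ideal_mono[OF x] by (intro \<sigma>_right) simp_all
    then show ?thesis
      using collapse[of "x \<star> b" "y \<star> b"] 2 assms by simp
  qed
qed

text \<open>The inequalities are strict because telling \<H>-related arrows apart costs one rank:
  the pair that is no longer \<H>-related has rank \<open>rk x - 1\<close>. This leaves room for the
  relations \<open>nu\<close> above a collapsed ideal.\<close>

lemma collapse_H:
  assumes "(x, y) \<in> \<sigma>" "(x, y) \<in> green_H S" "x \<noteq> y"
    "(u, v) \<in> nabla S" "rk u < rk x" "rk v < rk x"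
  shows "(u, v) \<in> \<sigma>"
proof -
  have x: "x \<in> ideal r" and nab: "(x, y) \<in> nabla S"
    using \<sigma>_ideal[OF assms(1)] \<sigma>_nabla[OF assms(1)] by blast+
  obtain b where b: "b \<in> arrows S" "src S b = tgt S x" "rk b \<le> rk x" "Suc (rk (x \<star> b)) = rk x"
    "rk (y \<star> b) = rk (x \<star> b)" "(x \<star> b, y \<star> b) \<notin> green_H S"
    using descend_H[OF nab assms(2,3)] by blast
  have "(x \<star> b, y \<star> b) \<in> \<sigma>"
    using assms(1) b in_ideal_mono[OF x] by (intro \<sigma>_right) simp_all
  then show ?thesis
    using collapse_not_H[of "x \<star> b" "y \<star> b"] b assms by simp
qed

end

section \<open>The group \<H>-class and its frames\<close>

locale group_class = graded_category +
  fixes G :: "'b set" and k :: nat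
  assumes G: "group_H_class S G" and G_rk: "G \<subseteq> {x \<in> arrows S. rk x = k}"
begin

abbreviation M :: "'b monoid" where "M \<equiv> monoid_on S G"
abbreviation e :: 'b where "e \<equiv> \<one>\<^bsub>M\<^esub>"

lemma M_simps [simp]: "carrier M = G" "mult M = pcomp S"
  by (simp_all add: monoid_on_def)

sublocale M: group M
  using G by (simp add: group_H_class_def)

lemma e_G [simp]: "e \<in> G"
  using M.one_closed by simp

lemma G_e [simp]: "x \<in> G \<Longrightarrow> e \<star> x = x" "x \<in> G \<Longrightarrow> x \<star> e = x"
  using M.l_one M.r_one by simp_all

lemma G_comp [simp]: "x \<in> G \<Longrightarrow> y \<in> G \<Longrightarrow> x \<star> y \<in> G"
  using M.m_closed by simp

lemma G_inv [simp]: "x \<in> G \<Longrightarrow> inv\<^bsub>M\<^esub> x \<in> G" "x \<in> G \<Longrightarrow> x \<star> inv\<^bsub>M\<^esub> x = e" "x \<in> G \<Longrightarrow> inv\<^bsub>M\<^esub> x \<star> x = e"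
  using M.inv_closed M.r_inv M.l_inv by simp_all

lemma G_arrow [simp]: "x \<in> G \<Longrightarrow> x \<in> arrows S" "x \<in> G \<Longrightarrow> rk x = k"
  using G_rk by auto

lemma G_composable: "x \<in> G \<Longrightarrow> y \<in> G \<Longrightarrow> tgt S x = src S y"
  using G unfolding group_H_class_def composable_def by blast

definition base where
  "base = src S e"

lemma G_src [simp]: "x \<in> G \<Longrightarrow> src S x = base"
  using G_composable[OF e_G, of x] G_composable[OF e_G e_G] by (simp add: base_def)

lemma G_tgt [simp]: "x \<in> G \<Longrightarrow> tgt S x = base"
  using G_composable[of x e] by simp

lemma green_H_G:
  assumes "x \<in> G" "(x, y) \<in> green_H S"
  shows "y \<in> G"
proof -
  have "G \<in> arrows S // green_H S"
    using G by (simp add: group_H_class_def)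
  from in_quotient_imp_closed[OF equiv_green_H this assms] show ?thesis .
qed

text \<open>By stability, an \<open>h\<close> fixed by \<open>e\<close> on both sides and of full
  rank \<open>k\<close> can be multiplied back to \<open>e\<close> from either side, so it is
  \<H>-related to \<open>e\<close>.\<close>

lemma in_GI:
  assumes "h \<in> arrows S" "src S h = base" "tgt S h = base" "rk h = k" "e \<star> h = h" "h \<star> e = h"
  shows "h \<in> G"
proof -
  obtain b where b: "b \<in> arrows S" "src S b = tgt S h" "(e \<star> h) \<star> b = e"
    using stab_right[of e h] assms by auto
  obtain a where a: "a \<in> arrows S" "tgt S a = src S h" "a \<star> (h \<star> e) = e"
    using stab_left[of h e] assms by auto
  have "h \<star> b = e" "a \<star> h = e"
    using a b assms by simp_all
  then have "(e, h) \<in> green_H S"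
    by (intro green_HI[of e h h b h a]) (use assms a(1,2) b(1,2) in simp_all)
  then show ?thesis
    using green_H_G[OF e_G] by blast
qed

text \<open>By stability these are the arrows that are \<open>green_L\<close>-related to
  \<open>e\<close>; a right frame is dually \<open>green_R\<close>-related to \<open>e\<close>. A
  triple of left frame, group element and right frame gives coordinates for an arrow of rank
  \<open>k\<close>, as in a Rees matrix semigroup.\<close>

definition left_frame :: "'b \<Rightarrow> bool" where
  "left_frame a \<longleftrightarrow> a \<in> arrows S \<and> tgt S a = base \<and> a \<star> e = a \<and> rk a = k"

definition right_frame :: "'b \<Rightarrow> bool" where
  "right_frame b \<longleftrightarrow> b \<in> arrows S \<and> src S b = base \<and> e \<star> b = b \<and> rk b = k"

lemma left_frameD [simp]:
  "left_frame a \<Longrightarrow> a \<in> arrows S" "left_frame a \<Longrightarrow> tgt S a = base"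
  "left_frame a \<Longrightarrow> a \<star> e = a" "left_frame a \<Longrightarrow> rk a = k"
  by (simp_all add: left_frame_def)

lemma right_frameD [simp]:
  "right_frame b \<Longrightarrow> b \<in> arrows S" "right_frame b \<Longrightarrow> src S b = base"
  "right_frame b \<Longrightarrow> e \<star> b = b" "right_frame b \<Longrightarrow> rk b = k"
  by (simp_all add: right_frame_def)

text \<open>The factor \<open>e\<close> put in front of the inverse brings its rank down to at most
  \<open>k\<close>, so that it may serve as a multiplier inside the ideal.\<close>

lemma left_frame_inverse:
  assumes "left_frame a"
  obtains a' where "a' \<in> arrows S" "src S a' = base" "tgt S a' = src S a" "a' \<star> a = e"
    "e \<star> a' = a'" "rk a' \<le> k"
proof -
  obtain a' where a': "a' \<in> arrows S" "tgt S a' = src S a" "a' \<star> (a \<star> e) = e"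
    using stab_left[of a e] assms by auto
  then have src: "src S a' = base"
    using src_comp[of a' a] assms by simp
  have "rk (e \<star> a') \<le> k"
    using rk_comp_le1[of e a'] a' src by simp
  moreover have "(e \<star> a') \<star> a = e \<star> (a' \<star> a)" "e \<star> (e \<star> a') = (e \<star> e) \<star> a'"
    using a'(1,2) src assms by (simp_all add: assoc del: G_e)
  ultimately show ?thesis
    using that[of "e \<star> a'"] a' src assms by simp
qed

lemma right_frame_inverse:
  assumes "right_frame b"
  obtains b' where "b' \<in> arrows S" "tgt S b' = base" "src S b' = tgt S b" "b \<star> b' = e"
    "b' \<star> e = b'" "rk b' \<le> k"
proof -
  obtain b' where b': "b' \<in> arrows S" "src S b' = tgt S b" "(e \<star> b) \<star> b' = e"
    using stab_right[of e b] assms by auto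
  then have tgt: "tgt S b' = base"
    using tgt_comp[of b b'] assms by simp
  have "rk (b' \<star> e) \<le> k"
    using rk_comp_le2[of b' e] b' tgt by simp
  moreover have "b \<star> (b' \<star> e) = (b \<star> b') \<star> e" "(b' \<star> e) \<star> e = b' \<star> (e \<star> e)"
    using b'(1,2) tgt assms by (simp_all add: assoc del: G_e)
  ultimately show ?thesis
    using that[of "b' \<star> e"] b' tgt assms by simp
qed

lemma frame_cancel:
  assumes "left_frame a" "right_frame b" "x \<in> G" "y \<in> G" "a \<star> x \<star> b = a \<star> y \<star> b"
  shows "x = y"
proof -
  obtain a' where a': "a' \<in> arrows S" "tgt S a' = src S a" "a' \<star> a = e"
    using left_frame_inverse[OF assms(1)] by metis
  obtain b' where b': "b' \<in> arrows S" "src S b' = tgt S b" "b \<star> b' = e"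
    using right_frame_inverse[OF assms(2)] by metis
  have "x = (a' \<star> (a \<star> x \<star> b)) \<star> b'" if "x \<in> G" for x
  proof -
    have "(a' \<star> (a \<star> x \<star> b)) \<star> b' = (a' \<star> a) \<star> x \<star> (b \<star> b')"
      using assms(1,2) a'(1,2) b'(1,2) that by (simp add: assoc)
    then show ?thesis
      using a' b' that by simp
  qed
  then show ?thesis
    using assms by metis
qed

text \<open>No rank is lost, because the inverses of the frames recover \<open>x\<close> from the
  product.\<close>

lemma rk_frame:
  assumes "left_frame a" "right_frame b" "x \<in> G"
  shows "rk (a \<star> x \<star> b) = k"
proof (rule antisym)
  show "rk (a \<star> x \<star> b) \<le> k"
    using rk_comp_le1[of "a \<star> x" b] rk_comp_le1[of a x] assms by simp
  obtain a' where a': "a' \<in> arrows S" "tgt S a' = src S a" "a' \<star> a = e"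
    using left_frame_inverse[OF assms(1)] by metis
  obtain b' where b': "b' \<in> arrows S" "src S b' = tgt S b" "b \<star> b' = e"
    using right_frame_inverse[OF assms(2)] by metis
  have "(a' \<star> (a \<star> x \<star> b)) \<star> b' = (a' \<star> a) \<star> x \<star> (b \<star> b')"
    using assms a'(1,2) b'(1,2) by (simp add: assoc)
  then have "rk ((a' \<star> (a \<star> x \<star> b)) \<star> b') = k"
    using a' b' assms by simp
  moreover have "rk ((a' \<star> (a \<star> x \<star> b)) \<star> b') \<le> rk (a' \<star> (a \<star> x \<star> b))"
    "rk (a' \<star> (a \<star> x \<star> b)) \<le> rk (a \<star> x \<star> b)"
    using assms a' b' by (auto intro!: rk_comp_le1 rk_comp_le2)
  ultimately show "k \<le> rk (a \<star> x \<star> b)"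
    by simp
qed

text \<open>Two pairs of \<open>nu\<close> may share an arrow but describe it in different frames.
  The frames then differ by group elements, which makes the pairs comparable.\<close>

lemma frame_change:
  assumes a: "left_frame a" and b: "right_frame b" and c: "left_frame c" and d: "right_frame d"
    and y: "y \<in> G" and z: "z \<in> G" and eq: "a \<star> y \<star> b = c \<star> z \<star> d"
  obtains h t where "h \<in> G" "t \<in> G" "c = a \<star> h" "d = t \<star> b" "y = h \<star> z \<star> t"
proof -
  let ?z = "inv\<^bsub>M\<^esub> z"
  have st: "src S a = src S c" "tgt S b = tgt S d"
    using arg_cong[OF eq, of "src S"] arg_cong[OF eq, of "tgt S"] a b c d y z by simp_all
  obtain c' where c': "c' \<in> arrows S" "src S c' = base" "tgt S c' = src S c" "c' \<star> c = e" "e \<star> c' = c'"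
    using left_frame_inverse[OF c] by metis
  obtain d' where d': "d' \<in> arrows S" "tgt S d' = base" "src S d' = tgt S d" "d \<star> d' = e" "d' \<star> e = d'"
    using right_frame_inverse[OF d] by metis
  \<comment> \<open>With \<open>c'\<close> and \<open>d'\<close> inverse to the frames
    \<open>c\<close> and \<open>d\<close>, multiplying \<open>a y b = c z d\<close> by
    \<open>d' z^-1\<close> on the right must give \<open>c = a h\<close>, and by
    \<open>z^-1 c'\<close> on the left \<open>d = t b\<close>.\<close>
  define h where "h = y \<star> (b \<star> (d' \<star> ?z))"
  define t where "t = ?z \<star> (c' \<star> (a \<star> y))"
  have h_arrow: "h \<in> arrows S" "src S h = base" "tgt S h = base"
    using b d'(1-3) st y z by (simp_all add: h_def)
  have t_arrow: "t \<in> arrows S" "src S t = base" "tgt S t = base"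
    using a c'(1-3) st y z by (simp_all add: t_def)
  have "a \<star> h = (a \<star> y \<star> b) \<star> (d' \<star> ?z)"
    using a b d'(1-3) st y z by (simp add: h_def assoc)
  also have "\<dots> = c \<star> (z \<star> ((d \<star> d') \<star> ?z))"
    using c d d'(1-3) z by (simp add: eq assoc)
  also have "\<dots> = c"
    using c d' z by simp
  finally have ch: "c = a \<star> h" ..
  have "t \<star> b = (?z \<star> c') \<star> (a \<star> y \<star> b)"
    using a b c'(1-3) st y z by (simp add: t_def assoc)
  also have "\<dots> = (?z \<star> ((c' \<star> c) \<star> z)) \<star> d"
    using c d c'(1-3) z by (simp add: eq assoc)
  also have "\<dots> = d"
    using d c' z by simp
  finally have dt: "d = t \<star> b" ..
  have "e \<star> h = (e \<star> y) \<star> (b \<star> (d' \<star> ?z))"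
    unfolding h_def using b d'(1-3) st y z by (subst assoc) simp_all
  then have eh: "e \<star> h = h"
    using y by (simp add: h_def)
  have "h \<star> e = y \<star> (b \<star> (d' \<star> (?z \<star> e)))"
    using b d'(1-3) st y z by (simp add: h_def assoc del: G_e)
  then have he: "h \<star> e = h"
    using z by (simp add: h_def)
  have "e \<star> t = (e \<star> ?z) \<star> (c' \<star> (a \<star> y))"
    unfolding t_def using a c'(1-3) st y z by (subst assoc) simp_all
  then have et: "e \<star> t = t"
    using z by (simp add: t_def)
  have "t \<star> e = ?z \<star> (c' \<star> (a \<star> (y \<star> e)))"
    using a c'(1-3) st y z by (simp add: t_def assoc del: G_e)
  then have te: "t \<star> e = t"
    using y by (simp add: t_def)
  have "rk (a \<star> h) = k" "rk (t \<star> b) = k"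
    unfolding ch[symmetric] dt[symmetric] using c d by simp_all
  then have "k \<le> rk h" "k \<le> rk t"
    using rk_comp_le2[of a h] rk_comp_le1[of t b] a b h_arrow t_arrow by simp_all
  moreover have "rk (e \<star> h) \<le> rk e" "rk (e \<star> t) \<le> rk e"
    by (rule rk_comp_le1; use h_arrow t_arrow in simp)+
  then have "rk h \<le> k" "rk t \<le> k"
    unfolding eh et by simp_all
  ultimately have "rk h = k" "rk t = k"
    by (metis le_antisym)+
  then have hG: "h \<in> G" and tG: "t \<in> G"
    using in_GI[OF h_arrow _ eh he] in_GI[OF t_arrow _ et te] by blast+
  have "a \<star> y \<star> b = a \<star> (h \<star> z \<star> t) \<star> b"
    unfolding eq using a b hG tG z ch dt by (simp add: assoc)
  then have "y = h \<star> z \<star> t"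
    using frame_cancel[OF a b y] hG tG z by simp
  then show ?thesis
    using that hG tG ch dt by blast
qed

abbreviation D :: "'b set" where "D \<equiv> {x \<in> arrows S. rk x = k}"

lemma nuI:
  assumes "N \<subseteq> G" "left_frame a" "right_frame b" "x \<in> N" "y \<in> N"
  shows "(a \<star> x \<star> b, a \<star> y \<star> b) \<in> nu S D N"
proof -
  have "x \<in> G" "y \<in> G"
    using assms by auto
  then show ?thesis
    unfolding nu_def composable_def using assms rk_frame[of a b]
    by (intro CollectI exI[of _ a] exI[of _ b] exI[of _ x] exI[of _ y]) simp
qed

text \<open>The outer factors in \<open>nu\<close> are arbitrary. Replacing \<open>a\<close> by
  \<open>a e\<close> and \<open>b\<close> by \<open>e b\<close> changes no product with an element
  of \<open>G\<close>, and since the product has rank \<open>k\<close>, the new factors have rank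
  exactly \<open>k\<close>.\<close>

lemma nuE:
  assumes "N \<subseteq> G" "(u, v) \<in> nu S D N"
  obtains a b x y where "left_frame a" "right_frame b" "x \<in> N" "y \<in> N" "u = a \<star> x \<star> b" "v = a \<star> y \<star> b"
proof -
  obtain a b x y where xy: "x \<in> N" "y \<in> N" and ab: "a \<in> arrows S" "b \<in> arrows S"
    "tgt S a = src S x" "tgt S x = src S b"
    and uv: "u = a \<star> x \<star> b" "v = a \<star> y \<star> b" and rk: "rk u = k"
    using assms(2) unfolding nu_def composable_def by auto
  have G: "x \<in> G" "y \<in> G"
    using xy assms(1) by auto
  have exe: "a \<star> x \<star> b = (a \<star> e) \<star> x \<star> (e \<star> b)" if "x \<in> G" for x
  proof -
    have "(a \<star> e) \<star> x \<star> (e \<star> b) = a \<star> ((e \<star> x) \<star> e) \<star> b"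
      using ab G that by (simp add: assoc del: G_e)
    then show ?thesis
      using that by simp
  qed
  let ?a = "a \<star> e" and ?b = "e \<star> b"
  have arr: "?a \<in> arrows S" "?b \<in> arrows S" "tgt S ?a = base" "src S ?b = base"
    using ab G by simp_all
  have "rk (?a \<star> x \<star> ?b) \<le> rk (?a \<star> x)" "rk (?a \<star> x) \<le> rk ?a" "rk (?a \<star> x \<star> ?b) \<le> rk ?b"
    using ab arr G by (auto intro!: rk_comp_le1 rk_comp_le2)
  moreover have "rk ?a \<le> k" "rk ?b \<le> k"
    using rk_comp_le2[of a e] rk_comp_le1[of e b] ab G by simp_all
  moreover have "rk (?a \<star> x \<star> ?b) = k"
    unfolding exe[OF G(1), symmetric] uv(1)[symmetric] by (rule rk)
  ultimately have "rk ?a = k" "rk ?b = k"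
    by linarith+
  then have "left_frame ?a" "right_frame ?b"
    unfolding left_frame_def right_frame_def using ab G arr
    by (simp_all add: assoc assoc[symmetric, of e e])
  then show ?thesis
    using that[OF _ _ xy] uv exe G by metis
qed

lemma nu_nabla:
  assumes "N \<subseteq> G" "(u, v) \<in> nu S D N"
  shows "(u, v) \<in> nabla S" "rk u = k" "rk v = k"
proof -
  obtain a b x y where *: "left_frame a" "right_frame b" "x \<in> N" "y \<in> N" "u = a \<star> x \<star> b" "v = a \<star> y \<star> b"
    using nuE[OF assms] .
  then have "x \<in> G" "y \<in> G"
    using assms(1) by auto
  then show "(u, v) \<in> nabla S" "rk u = k" "rk v = k"
    using * rk_frame by (simp_all add: nabla_def)
qed

lemma nu_sym: "(u, v) \<in> nu S D N \<Longrightarrow> (v, u) \<in> nu S D N"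
  unfolding nu_def by blast

text \<open>Normality enters here: passing from the frames of the second pair to those of the first
  conjugates \<open>z' z^-1\<close> by \<open>h\<close>.\<close>

lemma nu_trans:
  assumes N: "N \<lhd> M" and uv: "(u, v) \<in> nu S D N" and vw: "(v, w) \<in> nu S D N"
  shows "(u, w) \<in> nu S D N"
proof -
  interpret N: normal N M by (rule N)
  have NG: "N \<subseteq> G"
    using N.subset by simp
  obtain a b x y where 1: "left_frame a" "right_frame b" "x \<in> N" "y \<in> N" "u = a \<star> x \<star> b" "v = a \<star> y \<star> b"
    using nuE[OF NG uv] .
  obtain c d z z' where 2: "left_frame c" "right_frame d" "z \<in> N" "z' \<in> N" "v = c \<star> z \<star> d" "w = c \<star> z' \<star> d"
    using nuE[OF NG vw] .
  have G: "x \<in> G" "y \<in> G" "z \<in> G" "z' \<in> G"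
    using 1 2 NG by auto
  obtain h t where ht: "h \<in> G" "t \<in> G" "c = a \<star> h" "d = t \<star> b" "y = h \<star> z \<star> t"
    using frame_change[OF 1(1,2) 2(1,2) G(2,3)] 1(6) 2(5) by metis
  \<comment> \<open>The coordinate \<open>h z' t\<close> of \<open>w\<close> equals
    \<open>h (z' z^-1) h^-1\<close> times \<open>y\<close>, because \<open>y = h z t\<close>; both
    factors lie in \<open>N\<close>.\<close>
  have "h \<star> (z' \<star> inv\<^bsub>M\<^esub> z) \<star> inv\<^bsub>M\<^esub> h \<in> N"
    using N.inv_op_closed2[of h "z' \<star> inv\<^bsub>M\<^esub> z"] N.m_closed[of z' "inv\<^bsub>M\<^esub> z"] N.m_inv_closed 2 ht by simp
  then have "(h \<star> (z' \<star> inv\<^bsub>M\<^esub> z) \<star> inv\<^bsub>M\<^esub> h) \<star> y \<in> N"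
    using N.m_closed 1(4) by simp
  also have "(h \<star> (z' \<star> inv\<^bsub>M\<^esub> z) \<star> inv\<^bsub>M\<^esub> h) \<star> y =
      h \<star> (z' \<star> (inv\<^bsub>M\<^esub> z \<star> ((inv\<^bsub>M\<^esub> h \<star> h) \<star> (z \<star> t))))"
    using ht(1,2) G by (simp add: ht(5) assoc del: G_inv(2,3))
  also have "\<dots> = h \<star> (z' \<star> ((inv\<^bsub>M\<^esub> z \<star> z) \<star> t))"
  proof -
    have "(inv\<^bsub>M\<^esub> h \<star> h) \<star> (z \<star> t) = z \<star> t"
      using ht(1,2) G by simp
    then show ?thesis
      using ht(1,2) G by (simp add: assoc del: G_inv(2,3))
  qed
  also have "\<dots> = h \<star> z' \<star> t"
  proof -
    have "h \<star> (z' \<star> ((inv\<^bsub>M\<^esub> z \<star> z) \<star> t)) = h \<star> (z' \<star> t)"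
      using ht(1,2) G by simp
    then show ?thesis
      using ht(1,2) G by (simp add: assoc)
  qed
  finally have "(a \<star> x \<star> b, a \<star> (h \<star> z' \<star> t) \<star> b) \<in> nu S D N"
    using nuI[OF NG 1(1,2,3)] by blast
  moreover have "a \<star> (h \<star> z' \<star> t) \<star> b = w"
    unfolding 2(6) using ht(1-4) 1(1,2) G by (simp add: assoc)
  ultimately show ?thesis
    using 1(5) by simp
qed

lemma rk_eq_or_in_ideal:
  assumes "x \<in> arrows S" "rk x \<le> k" "k = Suc q"
  shows "rk x = k \<or> x \<in> ideal (enat q)"
  using assms by (auto simp: ideal_def)

lemma right_frame_comp:
  assumes "right_frame b" "c \<in> arrows S" "tgt S b = src S c" "rk (b \<star> c) = k"
  shows "right_frame (b \<star> c)"
  using assms unfolding right_frame_def by (simp add: assoc[symmetric])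

lemma left_frame_comp:
  assumes "left_frame a" "c \<in> arrows S" "tgt S c = src S a" "rk (c \<star> a) = k"
  shows "left_frame (c \<star> a)"
  using assms unfolding left_frame_def by (simp add: assoc)

section \<open>The listed relations are congruences\<close>

text \<open>\<open>nu\<close> relates only arrows of rank \<open>Suc q\<close>, none of which lies
  in \<open>ideal (enat q)\<close>, so no chain mixes nontrivial pairs of the two kinds. A
  multiplication alters one frame, and this frame is common to both members of a pair: either it
  keeps rank \<open>k\<close>, or both products fall into the smaller ideal together.\<close>

lemma congruence_rees_nu:
  assumes N: "N \<lhd> M" and k: "k = Suc q" and q: "enat q < r"
  shows "congruence (sub_psemigroup S (ideal r))
           (rees (sub_psemigroup S (ideal r)) (ideal (enat q)) \<union> nu S D N)"
    (is "congruence ?I (?R \<union> ?\<nu>)")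
proof -
  interpret N: normal N M by (rule N)
  have NG: "N \<subseteq> G"
    using N.subset by simp
  have kr: "enat k \<le> r"
    using q k by (simp add: Suc_ile_eq)
  have arr: "arrows ?I = ideal r"
    by (simp add: sub_psemigroup_def)
  have D_ideal: "x \<in> ideal r" if "x \<in> arrows S" "rk x = k" for x
    using that kr by (simp add: ideal_def)
  have q_ideal: "x \<in> ideal r" if "x \<in> ideal (enat q)" for x
    using that q by (auto simp: ideal_def intro: order_trans[of "enat (rk x)" "enat q" r] less_imp_le)
  have R: "(x, y) \<in> ?R \<longleftrightarrow> (x \<in> ideal (enat q) \<and> y \<in> ideal (enat q) \<and> (x, y) \<in> nabla S) \<or> (x = y \<and> x \<in> ideal r)"
    for x y
    unfolding rees_def arr by (auto simp: sub_psemigroup_def nabla_def dest: ideal_arrows)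
  have \<nu>: "(x, y) \<in> nabla S" "x \<in> ideal r" "y \<in> ideal r" "x \<notin> ideal (enat q)" "y \<notin> ideal (enat q)"
    if "(x, y) \<in> ?\<nu>" for x y
    using nu_nabla[OF NG that] nablaD[of x y] D_ideal k by (auto simp: ideal_def)
  have sub: "?R \<union> ?\<nu> \<subseteq> nabla ?I"
  proof
    fix p
    assume p: "p \<in> ?R \<union> ?\<nu>"
    obtain x y where xy: "p = (x, y)"
      by (cases p)
    show "p \<in> nabla ?I"
      using p \<nu>[of x y] R[of x y] q_ideal unfolding xy nabla_sub by (auto simp: nabla_def)
  qed
  have equiv: "equiv (ideal r) (?R \<union> ?\<nu>)"
  proof (rule equivI)
    show "?R \<union> ?\<nu> \<subseteq> ideal r \<times> ideal r"
      using sub by (auto simp: nabla_sub)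
    show "refl_on (ideal r) (?R \<union> ?\<nu>)"
      using R by (auto intro!: refl_onI)
    show "sym (?R \<union> ?\<nu>)"
      using R nu_sym nabla_sym by (auto intro!: symI)
    show "trans (?R \<union> ?\<nu>)"
    proof (rule transI)
      fix x y z
      assume xy: "(x, y) \<in> ?R \<union> ?\<nu>" and yz: "(y, z) \<in> ?R \<union> ?\<nu>"
      have "(x, z) \<in> nabla S" if "(x, y) \<in> nabla S" "(y, z) \<in> nabla S"
        using that by (simp add: nabla_def)
      then show "(x, z) \<in> ?R \<union> ?\<nu>"
        using xy yz R[of x y] R[of y z] R[of x z] \<nu>(4,5) nu_trans[OF N, of x y z] by blast
    qed
  qed
  have rmult: "(x \<star> c, y \<star> c) \<in> ?R \<union> ?\<nu>"
    if xy: "(x, y) \<in> ?R \<union> ?\<nu>" and c: "c \<in> ideal r" "tgt S x = src S c" for x y c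
  proof -
    have n: "(x, y) \<in> nabla S"
      using sub xy unfolding nabla_sub by (auto simp: nabla_def dest: ideal_arrows)
    note nD = nablaD[OF n]
    have cS: "c \<in> arrows S"
      using c ideal_arrows by blast
    have n': "(x \<star> c, y \<star> c) \<in> nabla S"
      using nD cS c by (simp add: nabla_def)
    have id: "z \<star> c \<in> ideal s" if "z \<in> ideal s" "tgt S z = src S c" for z s
      using in_ideal_mono[OF that(1), of "z \<star> c"] rk_comp_le1[of z c] that cS ideal_arrows by simp
    show ?thesis
    proof (cases "(x, y) \<in> ?\<nu>")
      case False
      then have "(x, y) \<in> ?R"
        using xy by blast
      then show ?thesis
        using R[of x y] R[of "x \<star> c" "y \<star> c"] id n' c nD by auto
    next
      case True
      obtain a b g h where *: "left_frame a" "right_frame b" "g \<in> N" "h \<in> N" "x = a \<star> g \<star> b" "y = a \<star> h \<star> b"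
        using nuE[OF NG True] .
      have gh: "g \<in> G" "h \<in> G"
        using * NG by auto
      have bc: "tgt S b = src S c"
        using c * gh by simp
      have eq: "x \<star> c = a \<star> g \<star> (b \<star> c)" "y \<star> c = a \<star> h \<star> (b \<star> c)"
        using * gh bc cS by (simp_all add: assoc)
      have rkbc: "rk (b \<star> c) \<le> k"
        using rk_comp_le1[of b c] * bc cS by simp
      show ?thesis
      proof (cases "rk (b \<star> c) = k")
        case True
        then show ?thesis
          using nuI[OF NG *(1) right_frame_comp[OF *(2) cS bc] *(3,4)] eq by simp
      next
        case False
        then have "b \<star> c \<in> ideal (enat q)"
          using rk_eq_or_in_ideal[of "b \<star> c" q] rkbc k * bc cS by simp
        moreover have "rk (a \<star> g' \<star> (b \<star> c)) \<le> rk (b \<star> c)" if "g' \<in> G" for g'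
          using that * bc cS by (intro rk_comp_le2) simp_all
        ultimately have "x \<star> c \<in> ideal (enat q)" "y \<star> c \<in> ideal (enat q)"
          using in_ideal_mono[of "b \<star> c" "enat q"] eq gh nablaD[OF n'] by auto
        then show ?thesis
          using R[of "x \<star> c" "y \<star> c"] n' by simp
      qed
    qed
  qed
  have lmult: "(c \<star> x, c \<star> y) \<in> ?R \<union> ?\<nu>"
    if xy: "(x, y) \<in> ?R \<union> ?\<nu>" and c: "c \<in> ideal r" "tgt S c = src S x" for x y c
  proof -
    have n: "(x, y) \<in> nabla S"
      using sub xy unfolding nabla_sub by (auto simp: nabla_def dest: ideal_arrows)
    note nD = nablaD[OF n]
    have cS: "c \<in> arrows S"
      using c ideal_arrows by blast
    have n': "(c \<star> x, c \<star> y) \<in> nabla S"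
      using nD cS c by (simp add: nabla_def)
    have id: "c \<star> z \<in> ideal s" if "z \<in> ideal s" "tgt S c = src S z" for z s
      using in_ideal_mono[OF that(1), of "c \<star> z"] rk_comp_le2[of c z] that cS ideal_arrows by simp
    show ?thesis
    proof (cases "(x, y) \<in> ?\<nu>")
      case False
      then have "(x, y) \<in> ?R"
        using xy by blast
      then show ?thesis
        using R[of x y] R[of "c \<star> x" "c \<star> y"] id n' c nD by auto
    next
      case True
      obtain a b g h where *: "left_frame a" "right_frame b" "g \<in> N" "h \<in> N" "x = a \<star> g \<star> b" "y = a \<star> h \<star> b"
        using nuE[OF NG True] .
      have gh: "g \<in> G" "h \<in> G"
        using * NG by auto
      have ca: "tgt S c = src S a"
        using c * gh by simp
      have eq: "c \<star> x = (c \<star> a) \<star> g \<star> b" "c \<star> y = (c \<star> a) \<star> h \<star> b"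
        using * gh ca cS by (simp_all add: assoc)
      have rkca: "rk (c \<star> a) \<le> k"
        using rk_comp_le2[of c a] * ca cS by simp
      show ?thesis
      proof (cases "rk (c \<star> a) = k")
        case True
        then show ?thesis
          using nuI[OF NG left_frame_comp[OF *(1) cS ca] *(2,3,4)] eq by simp
      next
        case False
        then have "c \<star> a \<in> ideal (enat q)"
          using rk_eq_or_in_ideal[of "c \<star> a" q] rkca k * ca cS by simp
        moreover have "rk ((c \<star> a) \<star> g' \<star> b) \<le> rk (c \<star> a)" if "g' \<in> G" for g'
        proof -
          have "rk ((c \<star> a) \<star> g' \<star> b) \<le> rk ((c \<star> a) \<star> g')" "rk ((c \<star> a) \<star> g') \<le> rk (c \<star> a)"
            using that * ca cS by (auto intro!: rk_comp_le1)
          then show ?thesis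
            by simp
        qed
        ultimately have "c \<star> x \<in> ideal (enat q)" "c \<star> y \<in> ideal (enat q)"
          using in_ideal_mono[of "c \<star> a" "enat q"] eq gh nablaD[OF n'] by auto
        then show ?thesis
          using R[of "c \<star> x" "c \<star> y"] n' by simp
      qed
    qed
  qed
  show ?thesis
    unfolding congruence_def arr
  proof (intro conjI equiv sub ballI)
    fix p
    assume p: "p \<in> ?R \<union> ?\<nu>"
    obtain x y where xy: "p = (x, y)"
      by (cases p)
    then show "case p of (x, y) \<Rightarrow> \<forall>c\<in>ideal r.
        (composable ?I c x \<longrightarrow> (c \<star>\<^bsub>?I\<^esub> x, c \<star>\<^bsub>?I\<^esub> y) \<in> ?R \<union> ?\<nu>) \<and>
        (composable ?I x c \<longrightarrow> (x \<star>\<^bsub>?I\<^esub> c, y \<star>\<^bsub>?I\<^esub> c) \<in> ?R \<union> ?\<nu>)"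
      using lmult[of x y] rmult[of x y] p
      by (simp add: sub_psemigroup_def composable_def del: Un_iff)
  qed
qed

end

section \<open>Congruences just above the last collapsed rank\<close>

text \<open>The last two assumptions say that \<open>q\<close> is the last collapsed level.
  \<open>not_collapsed\<close> gives the contradiction whenever a related pair would force level
  \<open>k\<close> to collapse.\<close>

locale group_class_congruence = group_class S rk G k + ideal_congruence S rk r \<sigma>
  for S :: "('o, 'a) psemigroup" (structure) and rk G k r \<sigma> +
  fixes q
  assumes k: "k = Suc q" and q: "enat q < r"
    and collapsed: "\<And>u v. (u, v) \<in> nabla S \<Longrightarrow> rk u \<le> q \<Longrightarrow> rk v \<le> q \<Longrightarrow> (u, v) \<in> \<sigma>"
    and not_collapsed: "\<exists>u v. (u, v) \<in> nabla S \<and> rk u \<le> k \<and> rk v \<le> k \<and> (u, v) \<notin> \<sigma>"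
begin

definition kernel :: "'a set" where
  "kernel = {x \<in> G. (x, e) \<in> \<sigma>}"

lemma in_ideal_k: "x \<in> arrows S \<Longrightarrow> rk x \<le> k \<Longrightarrow> x \<in> ideal r"
  using q k order_trans[of "enat (rk x)" "enat k" r] by (simp add: ideal_def Suc_ile_eq)

text \<open>Products, inverses and conjugates arise by multiplying a related pair by elements of
  \<open>G\<close>, which are available as multipliers because rank \<open>k\<close> still lies in
  the ideal.\<close>

lemma kernel_normal: "kernel \<lhd> M"
proof (rule M.normal_invI)
  have inv: "inv\<^bsub>M\<^esub> x \<in> kernel" if x: "x \<in> kernel" for x
  proof -
    have "(inv\<^bsub>M\<^esub> x \<star> x, inv\<^bsub>M\<^esub> x \<star> e) \<in> \<sigma>"
      using x in_ideal_k by (intro \<sigma>_left) (auto simp: kernel_def)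
    then show ?thesis
      using x \<sigma>_sym by (auto simp: kernel_def)
  qed
  have mult: "x \<star> y \<in> kernel" if x: "x \<in> kernel" and y: "y \<in> kernel" for x y
  proof -
    have "(x \<star> y, e \<star> y) \<in> \<sigma>"
      using x y in_ideal_k by (intro \<sigma>_right) (auto simp: kernel_def)
    then show ?thesis
      using x y \<sigma>_trans by (auto simp: kernel_def)
  qed
  have "e \<in> kernel"
    using \<sigma>_refl[of e] in_ideal_k by (auto simp: kernel_def)
  then show "subgroup kernel M"
    using inv mult by (intro M.subgroupI) (auto simp: kernel_def intro: exI[of _ e])
  show "x \<otimes>\<^bsub>M\<^esub> h \<otimes>\<^bsub>M\<^esub> inv\<^bsub>M\<^esub> x \<in> kernel" if "x \<in> carrier M" "h \<in> kernel" for x h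
  proof -
    have "(x \<star> h \<star> inv\<^bsub>M\<^esub> x, x \<star> e \<star> inv\<^bsub>M\<^esub> x) \<in> \<sigma>"
      using that in_ideal_k by (intro \<sigma>_right \<sigma>_left) (auto simp: kernel_def)
    then show ?thesis
      using that by (auto simp: kernel_def)
  qed
qed

lemma kernel_G: "kernel \<subseteq> G"
  by (auto simp: kernel_def)

lemma nu_kernel_subset: "nu S D kernel \<subseteq> \<sigma>"
proof
  fix p
  assume p: "p \<in> nu S D kernel"
  obtain u v where uv: "p = (u, v)"
    by (cases p)
  obtain a b x y where *: "left_frame a" "right_frame b" "x \<in> kernel" "y \<in> kernel"
    "u = a \<star> x \<star> b" "v = a \<star> y \<star> b"
    using nuE[OF kernel_G] p unfolding uv by blast
  have "(x, y) \<in> \<sigma>"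
    using * \<sigma>_sym \<sigma>_trans unfolding kernel_def by blast
  then have "(a \<star> x \<star> b, a \<star> y \<star> b) \<in> \<sigma>"
    using * in_ideal_k by (intro \<sigma>_right \<sigma>_left) (auto simp: kernel_def)
  then show "p \<in> \<sigma>"
    using uv * by simp
qed

text \<open>A related pair of distinct arrows above level \<open>q\<close> is \<H>-related and of
  rank exactly \<open>k\<close>, for otherwise level \<open>k\<close> would collapse. In frames
  where \<open>x\<close> has coordinate \<open>e\<close>, the coordinate of \<open>y\<close> is then
  an element of the kernel.\<close>

lemma related_above_in_nu:
  assumes xy: "(x, y) \<in> \<sigma>" "x \<noteq> y" and le: "rk y \<le> rk x" and big: "q < rk x"
  shows "(x, y) \<in> nu S D kernel"
proof -
  obtain u v where uv: "(u, v) \<in> nabla S" "rk u \<le> k" "rk v \<le> k" "(u, v) \<notin> \<sigma>"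
    using not_collapsed by blast
  have n: "x \<in> arrows S" "y \<in> arrows S" "src S x = src S y" "tgt S x = tgt S y"
    using nablaD[OF \<sigma>_nabla[OF xy(1)]] by blast+
  have H: "(x, y) \<in> green_H S"
    using collapse_not_H[OF xy(1) _ le uv(1)] uv big k by force
  have rkx: "rk x = k"
  proof (rule ccontr)
    assume "rk x \<noteq> k"
    then have "k < rk x"
      using big k by simp
    then have "rk u < rk x" "rk v < rk x"
      using uv(2,3) by linarith+
    then show False
      using collapse_H[OF xy(1) H xy(2) uv(1)] uv(4) by blast
  qed
  have rky: "rk y = k"
    using trans[OF sym[OF green_H_rk[OF H]] rkx] .
  have "rk x \<le> rk e"
    using rkx by simp
  \<comment> \<open>Since \<open>e\<close> has the rank of \<open>x\<close>, the arrow
    \<open>x\<close> factors through \<open>e\<close>; multiplied by \<open>e\<close>, the factors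
    become frames.\<close>
  then obtain a b where ab: "a \<in> arrows S" "b \<in> arrows S" "tgt S a = src S e" "tgt S e = src S b"
    and xab: "x = a \<star> e \<star> b"
    using factor[OF n(1) G_arrow(1)[OF e_G]] by (metis (no_types))
  have "(a \<star> e) \<star> (e \<star> b) = a \<star> (e \<star> e) \<star> b"
    using ab by (simp add: assoc del: G_e)
  then have xG: "x \<in> arrows S" "x = (a \<star> e) \<star> (e \<star> b)"
    using n(1) xab by simp_all
  let ?a = "a \<star> e" and ?b = "e \<star> b"
  have arr: "?a \<in> arrows S" "?b \<in> arrows S" "tgt S ?a = base" "src S ?b = base"
    using ab by simp_all
  have "rk (?a \<star> ?b) \<le> rk ?a" "rk (?a \<star> ?b) \<le> rk ?b"
    using ab arr by (auto intro!: rk_comp_le1 rk_comp_le2)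
  moreover have "rk ?a \<le> k" "rk ?b \<le> k"
    using rk_comp_le2[of a e] rk_comp_le1[of e b] ab by simp_all
  moreover have "rk (?a \<star> ?b) = k"
    unfolding xG(2)[symmetric] by (rule rkx)
  ultimately have "rk ?a = k" "rk ?b = k"
    by linarith+
  then have fr: "left_frame ?a" "right_frame ?b"
    unfolding left_frame_def right_frame_def using ab arr
    by (simp_all add: assoc assoc[symmetric, of e e])
  define a0 b0 where "a0 = ?a" and "b0 = ?b"
  have a0: "left_frame a0" and b0: "right_frame b0" and x: "x = a0 \<star> b0"
    using fr xG(2) by (simp_all add: a0_def b0_def)
  obtain a' where a': "a' \<in> arrows S" "src S a' = base" "tgt S a' = src S a0" "a' \<star> a0 = e"
    "e \<star> a' = a'" "rk a' \<le> k"
    using left_frame_inverse[OF a0] .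
  obtain b' where b': "b' \<in> arrows S" "tgt S b' = base" "src S b' = tgt S b0" "b0 \<star> b' = e"
    "b' \<star> e = b'" "rk b' \<le> k"
    using right_frame_inverse[OF b0] .
  have st: "src S x = src S a0" "tgt S x = tgt S b0"
    using x a0 b0 by simp_all
  \<comment> \<open>Being \<H>-related to \<open>x = a0 b0\<close> and distinct from it,
    \<open>y\<close> has the forms \<open>a0 b0 s\<close> and \<open>t a0 b0\<close>; hence
    multiplication by \<open>a0 a'\<close> on the left and by \<open>b' b0\<close> on the right
    fixes it.\<close>
  have "y \<in> right_principal S x" "y \<in> left_principal S x"
    using H unfolding green_H_def green_R_def green_L_def right_principal_def left_principal_def by auto
  then consider "y = x" | s t where "s \<in> arrows S" "tgt S x = src S s" "y = x \<star> s"
    "t \<in> arrows S" "tgt S t = src S x" "y = t \<star> x"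
    unfolding right_principal_def left_principal_def composable_def by auto
  then have absorb: "a0 \<star> (a' \<star> y) = y \<and> (y \<star> b') \<star> b0 = y"
  proof cases
    case 1
    then show ?thesis
      using xy(2) by blast
  next
    case 2
    have "a0 \<star> (a' \<star> y) = (a0 \<star> (a' \<star> a0)) \<star> (b0 \<star> s)"
      unfolding 2(3) x using 2(1,2) st a0 b0 a'(1-3) by (simp add: assoc)
    also have "\<dots> = y"
      unfolding 2(3) x using 2(1,2) st a0 b0 a' by (simp add: assoc)
    finally have 3: "a0 \<star> (a' \<star> y) = y" .
    have "(y \<star> b') \<star> b0 = (t \<star> a0) \<star> ((b0 \<star> b') \<star> b0)"
      unfolding 2(6) x using 2(4,5) st a0 b0 b'(1-3) by (simp add: assoc)
    also have "\<dots> = y"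
      unfolding 2(6) x using 2(4,5) st a0 b0 b' by (simp add: assoc)
    finally show ?thesis
      using 3 by blast
  qed
  \<comment> \<open>The group coordinate of \<open>y\<close> in the frames of \<open>x\<close>. The
    same sandwich sends \<open>x\<close> to \<open>e\<close>, so \<open>g\<close> and
    \<open>e\<close> are related.\<close>
  define g where "g = a' \<star> y \<star> b'"
  have g: "g \<in> arrows S" "src S g = base" "tgt S g = base"
    using a' b' n st by (simp_all add: g_def)
  have "a0 \<star> g \<star> b0 = (a0 \<star> (a' \<star> y)) \<star> b' \<star> b0"
    unfolding g_def using a0 b0 a'(1-3) b'(1-3) n st by (simp add: assoc)
  then have y: "a0 \<star> g \<star> b0 = y"
    using absorb by simp
  have "(e \<star> a') \<star> y \<star> b' = e \<star> g" "a' \<star> y \<star> (b' \<star> e) = g \<star> e"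
    unfolding g_def using a'(1-3) b'(1-3) n st by (simp_all add: assoc)
  then have eg: "e \<star> g = g" "g \<star> e = g"
    using a' b' by (simp_all add: g_def)
  have "rk (a0 \<star> g \<star> b0) \<le> rk (a0 \<star> g)" "rk (a0 \<star> g) \<le> rk g"
    using g a0 b0 by (auto intro!: rk_comp_le1 rk_comp_le2)
  moreover have "rk g \<le> rk b'"
    unfolding g_def using a'(1-3) b'(1-3) n st by (intro rk_comp_le2) simp_all
  ultimately have "rk g = k"
    using y rky b' by simp
  then have gG: "g \<in> G"
    using in_GI g eg by blast
  have "(a' \<star> y \<star> b', a' \<star> x \<star> b') \<in> \<sigma>"
    using \<sigma>_sym[OF xy(1)] a' b' in_ideal_k n st by (intro \<sigma>_right \<sigma>_left) simp_all
  moreover have "a' \<star> x \<star> b' = (a' \<star> a0) \<star> (b0 \<star> b')"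
    unfolding x using a0 b0 a'(1-3) b'(1-3) by (simp add: assoc)
  then have "a' \<star> x \<star> b' = e"
    using a' b' by simp
  ultimately have "g \<in> kernel"
    using gG by (simp add: kernel_def g_def)
  moreover have "e \<in> kernel"
    using \<sigma>_refl[of e] in_ideal_k by (simp add: kernel_def)
  ultimately have "(a0 \<star> e \<star> b0, a0 \<star> g \<star> b0) \<in> nu S D kernel"
    using nuI[OF kernel_G a0 b0] by blast
  moreover have "a0 \<star> e \<star> b0 = x"
    using a0 x by simp
  ultimately show ?thesis
    using y by simp
qed

lemma congruence_eq: "\<sigma> = rees (sub_psemigroup S (ideal r)) (ideal (enat q)) \<union> nu S D kernel"
    (is "_ = ?R \<union> ?\<nu>")
proof
  have arr: "arrows (sub_psemigroup S (ideal r)) = ideal r"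
    by (simp add: sub_psemigroup_def)
  have R: "(x, y) \<in> ?R \<longleftrightarrow> (x \<in> ideal (enat q) \<and> y \<in> ideal (enat q) \<and> (x, y) \<in> nabla S) \<or> (x = y \<and> x \<in> ideal r)"
    for x y
    unfolding rees_def arr by (auto simp: sub_psemigroup_def nabla_def dest: ideal_arrows)
  have above: "(x, y) \<in> ?R \<union> ?\<nu>" if "(x, y) \<in> \<sigma>" "rk y \<le> rk x" for x y
  proof -
    consider "x = y" | "x \<noteq> y" "rk x \<le> q" | "x \<noteq> y" "q < rk x"
      by linarith
    then show ?thesis
    proof cases
      case 1
      then show ?thesis
        using R \<sigma>_ideal[OF that(1)] by blast
    next
      case 2
      then have "x \<in> ideal (enat q)" "y \<in> ideal (enat q)"
        using that \<sigma>_ideal[OF that(1)] by (auto simp: ideal_def)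
      then show ?thesis
        using R \<sigma>_nabla[OF that(1)] by blast
    next
      case 3
      then show ?thesis
        using related_above_in_nu that by blast
    qed
  qed
  show "\<sigma> \<subseteq> ?R \<union> ?\<nu>"
  proof
    fix p
    assume p: "p \<in> \<sigma>"
    obtain x y where xy: "p = (x, y)"
      by (cases p)
    show "p \<in> ?R \<union> ?\<nu>"
    \<comment> \<open>Only pairs whose first member has at least the rank of the second have been
      treated; symmetry of both relations covers the others.\<close>
    proof (cases "rk y \<le> rk x")
      case True
      then show ?thesis
        using above p xy by blast
    next
      case False
      then have "(y, x) \<in> ?R \<union> ?\<nu>"
        using above[of y x] \<sigma>_sym p xy by simp
      then show ?thesis
        using R[of x y] R[of y x] nu_sym nabla_sym xy by blast
    qed
  qed
  have "?R \<subseteq> \<sigma>"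
  proof
    fix p
    assume p: "p \<in> ?R"
    obtain x y where xy: "p = (x, y)"
      by (cases p)
    show "p \<in> \<sigma>"
      using p R[of x y] \<sigma>_refl collapsed[of x y] unfolding xy by (auto simp: ideal_def)
  qed
  then show "?R \<union> ?\<nu> \<subseteq> \<sigma>"
    using nu_kernel_subset by blast
qed

end

section \<open>The complete list of congruences\<close>

context graded_category
begin

lemma nabla_congruence: "congruence (sub_psemigroup S (ideal r)) (nabla (sub_psemigroup S (ideal r)))"
proof -
  have arr: "arrows (sub_psemigroup S (ideal r)) = ideal r"
    by (simp add: sub_psemigroup_def)
  have eq: "equiv (ideal r) (nabla (sub_psemigroup S (ideal r)))"
    unfolding nabla_sub by (rule equivI) (auto intro!: refl_onI symI transI)
  have "a \<star> x \<in> ideal r" if "a \<in> ideal r" "x \<in> ideal r" "tgt S a = src S x" for a x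
    using in_ideal_mono[OF that(1), of "a \<star> x"] that rk_comp_le1 ideal_arrows by simp
  then show ?thesis
    unfolding congruence_def arr using eq
    by (auto simp: nabla_sub) (auto simp: sub_psemigroup_def composable_def dest!: ideal_arrows)
qed

theorem Cong_ideal:
  assumes G: "\<And>q. enat q < r \<Longrightarrow> group_H_class S (G (Suc q)) \<and> G (Suc q) \<subseteq> {x \<in> arrows S. rk x = Suc q}"
  shows "Cong (sub_psemigroup S (ideal r)) =
    {rees (sub_psemigroup S (ideal r)) (ideal (enat q)) \<union> nu S {x \<in> arrows S. rk x = Suc q} N | q N.
       enat q < r \<and> N \<lhd> monoid_on S (G (Suc q))} \<union> {nabla (sub_psemigroup S (ideal r))}"
    (is "_ = ?C \<union> {?n}")
proof
  have gc: "group_class S rk (G (Suc q)) (Suc q)" if "enat q < r" for q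
    using G[OF that] graded_category_axioms by (simp add: group_class_def group_class_axioms_def)
  show "?C \<union> {?n} \<subseteq> Cong (sub_psemigroup S (ideal r))"
    using group_class.congruence_rees_nu[OF gc] nabla_congruence by (auto simp: Cong_def)
  show "Cong (sub_psemigroup S (ideal r)) \<subseteq> ?C \<union> {?n}"
  proof
    fix \<sigma>
    assume "\<sigma> \<in> Cong (sub_psemigroup S (ideal r))"
    then interpret ideal_congruence S rk r \<sigma>
      by unfold_locales (simp add: Cong_def)
    show "\<sigma> \<in> ?C \<union> {?n}"
    proof (cases "\<sigma> = ?n")
      case False
      then obtain x y where xy: "(x, y) \<in> ?n" "(x, y) \<notin> \<sigma>"
        using \<sigma>_nabla_sub by (metis subrelI subset_antisym)
      \<comment> \<open>\<open>P m\<close> says that level \<open>m\<close> does not collapse. A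
        parallel pair outside \<open>\<sigma>\<close> has finite ranks, so a least such level exists
        even for \<open>r = \<infinity>\<close>.\<close>
      define P where "P m \<longleftrightarrow> (\<exists>u v. (u, v) \<in> nabla S \<and> rk u \<le> m \<and> rk v \<le> m \<and> (u, v) \<notin> \<sigma>)" for m
      have xyD: "x \<in> ideal r" "y \<in> ideal r" "(x, y) \<in> nabla S"
        using xy(1) unfolding nabla_sub by (auto simp: nabla_def dest: ideal_arrows)
      have Pmax: "P (max (rk x) (rk y))"
        unfolding P_def using xyD xy(2) by (intro exI[of _ x] exI[of _ y]) simp
      define m where "m = (LEAST m. P m)"
      have Pm: "P m" and mle: "m \<le> max (rk x) (rk y)" and least: "\<And>n. n < m \<Longrightarrow> \<not> P n"
        unfolding m_def using LeastI[of P, OF Pmax] Least_le[of P, OF Pmax] not_less_Least[of _ P] by blast+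
      have "enat (max (rk x) (rk y)) \<le> r"
        using xyD by (auto simp: ideal_def max_def)
      then have mr: "enat m \<le> r"
        using mle by (meson enat_ord_simps(1) order_trans)
      \<comment> \<open>Level zero always collapses, since parallel arrows of rank zero coincide. So
        the least level is \<open>Suc q\<close> with \<open>q\<close> the last collapsed
        one.\<close>
      have "m \<noteq> 0"
      proof
        assume "m = 0"
        then obtain u v where uv: "(u, v) \<in> nabla S" "rk u = 0" "rk v = 0" "(u, v) \<notin> \<sigma>"
          using Pm unfolding P_def by auto
        then have "u = v" "u \<in> ideal r"
          using zero_unique nablaD[OF uv(1)] by (auto simp: ideal_def zero_enat_def[symmetric])
        then show False
          using \<sigma>_refl uv by blast
      qed
      then obtain q where q: "m = Suc q"
        using not0_implies_Suc by blast
      have qr: "enat q < r"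
        using mr q by (simp add: Suc_ile_eq)
      interpret group_class_congruence S rk "G (Suc q)" "Suc q" r \<sigma> q
        using gc[OF qr] ideal_congruence_axioms qr Pm least[of q] q
        by (simp add: group_class_congruence_def group_class_congruence_axioms_def P_def)
      show ?thesis
        using congruence_eq kernel_normal qr by blast
    qed simp
  qed
qed

end

section \<open>The projective linear category\<close>

locale linear_category =
  fixes F :: "'f ring" and C :: "('f, 'v) module set"
  assumes field: "field F" and fdvs: "V \<in> C \<Longrightarrow> fdvs F V"
begin

abbreviation "L \<equiv> lin_cat F C"
abbreviation "P \<equiv> proj_lin_cat F C"
abbreviation "\<zeta> \<equiv> scalar_rel F C"
abbreviation "scalars \<equiv> carrier F - {\<zero>\<^bsub>F\<^esub>}"

sublocale F: field F
  by (rule field)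

lemma vs: "V \<in> C \<Longrightarrow> vectorspace F V"
  using fdvs fdvsD(1) by blast

lemma arrows_L: "(U, f, V) \<in> arrows L \<longleftrightarrow>
    U \<in> C \<and> V \<in> C \<and> linear_map F U V f \<and> f \<in> extensional (carrier U)"
  by (simp add: lin_cat_def)

lemma restrict_arrow:
  assumes "U \<in> C" "V \<in> C" "linear_map F U V f"
  shows "(U, restrict f (carrier U), V) \<in> arrows L"
  using assms linear_map_cong[OF assms(3), of "restrict f (carrier U)"] by (simp add: arrows_L)

lemma scalar_rel_iff: "((U, f, V), (U', g, V')) \<in> \<zeta> \<longleftrightarrow>
    U' = U \<and> V' = V \<and> (U, f, V) \<in> arrows L \<and> (U, g, V) \<in> arrows L \<and>
    (\<exists>c\<in>scalars. \<forall>u\<in>carrier U. f u = c \<odot>\<^bsub>V\<^esub> g u)"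
  unfolding scalar_rel_def nabla_def lin_cat_def by auto

lemma scalars_one: "\<one>\<^bsub>F\<^esub> \<in> scalars"
  by simp

lemma scalars_inv: "c \<in> scalars \<Longrightarrow> inv\<^bsub>F\<^esub> c \<in> scalars"
  using F.Units_inv_Units[of c] by (simp add: F.field_Units)

lemma scalars_mult: "c \<in> scalars \<Longrightarrow> d \<in> scalars \<Longrightarrow> c \<otimes>\<^bsub>F\<^esub> d \<in> scalars"
  using F.Units_m_closed[of c d] by (simp add: F.field_Units)

lemma proportional_sym:
  assumes "linear_map F U V f" "linear_map F U V g"
    and "\<exists>c\<in>scalars. \<forall>u\<in>carrier U. f u = c \<odot>\<^bsub>V\<^esub> g u"
  shows "\<exists>c\<in>scalars. \<forall>u\<in>carrier U. g u = c \<odot>\<^bsub>V\<^esub> f u"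
proof -
  interpret V: vectorspace F V
    using assms(1) by (simp add: linear_map_def)
  interpret f: linear_map F U V f by fact
  interpret g: linear_map F U V g by fact
  obtain c where c: "c \<in> scalars" "\<And>u. u \<in> carrier U \<Longrightarrow> f u = c \<odot>\<^bsub>V\<^esub> g u"
    using assms(3) by blast
  have "g u = inv\<^bsub>F\<^esub> c \<odot>\<^bsub>V\<^esub> f u" if "u \<in> carrier U" for u
    using c(1) c(2)[OF that] that by (intro V.mult_inverse) simp_all
  then show ?thesis
    using scalars_inv[OF c(1)] by blast
qed

lemma equiv_scalar_rel: "equiv (arrows L) \<zeta>"
proof (rule equivI)
  show "\<zeta> \<subseteq> arrows L \<times> arrows L"
    unfolding scalar_rel_def nabla_def by auto
  show "refl_on (arrows L) \<zeta>"
  proof (rule refl_onI)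
    fix x
    assume x: "x \<in> arrows L"
    obtain U f V where xe: "x = (U, f, V)"
      by (cases x)
    then interpret f: linear_map F U V f
      using x by (simp add: arrows_L)
    have "\<forall>u\<in>carrier U. f u = \<one>\<^bsub>F\<^esub> \<odot>\<^bsub>V\<^esub> f u"
      by simp
    then show "(x, x) \<in> \<zeta>"
      using x scalars_one unfolding xe scalar_rel_iff by blast
  qed
  show "sym \<zeta>"
  proof (rule symI)
    fix x y
    assume xy: "(x, y) \<in> \<zeta>"
    obtain U f V U' g V' where e: "x = (U, f, V)" "y = (U', g, V')"
      by (cases x, cases y)
    show "(y, x) \<in> \<zeta>"
      using xy proportional_sym[of U V f g] unfolding e scalar_rel_iff by (simp add: arrows_L)
  qed
  show "trans \<zeta>"
  proof (rule transI)
    fix x y z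
    assume xy: "(x, y) \<in> \<zeta>" and yz: "(y, z) \<in> \<zeta>"
    obtain U f V where x: "x = (U, f, V)"
      by (cases x)
    obtain g where y: "y = (U, g, V)"
      using xy x by (cases y) (simp add: scalar_rel_iff)
    obtain h where z: "z = (U, h, V)"
      using yz y by (cases z) (simp add: scalar_rel_iff)
    obtain c d where c: "c \<in> scalars" "\<And>u. u \<in> carrier U \<Longrightarrow> f u = c \<odot>\<^bsub>V\<^esub> g u"
      and d: "d \<in> scalars" "\<And>u. u \<in> carrier U \<Longrightarrow> g u = d \<odot>\<^bsub>V\<^esub> h u"
      using xy yz unfolding x y z scalar_rel_iff by blast
    have ar: "(U, f, V) \<in> arrows L" "(U, h, V) \<in> arrows L"
      using xy yz unfolding x y z scalar_rel_iff by blast+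
    interpret V: vectorspace F V
      using ar vs by (simp add: arrows_L)
    interpret h: linear_map F U V h
      using ar by (simp add: arrows_L)
    have "f u = (c \<otimes>\<^bsub>F\<^esub> d) \<odot>\<^bsub>V\<^esub> h u" if "u \<in> carrier U" for u
      using c d that by (simp add: V.smult_assoc1)
    then show "(x, z) \<in> \<zeta>"
      unfolding x z scalar_rel_iff using ar scalars_mult[OF c(1) d(1)] by blast
  qed
qed

section \<open>Projective classes of linear maps\<close>

text \<open>Restricting the representative allows any function in place of \<open>f\<close>, such as
  a composite written as a lambda term, whatever its values outside \<open>U\<close>.\<close>

definition arr :: "('f, 'v) module \<Rightarrow> ('v \<Rightarrow> 'v) \<Rightarrow> ('f, 'v) module \<Rightarrow> ('f, 'v) lin_mor set" where
  "arr U f V = \<zeta> `` {(U, restrict f (carrier U), V)}"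

lemma mem_arrD:
  assumes "x \<in> arr U f V"
  obtains g where "x = (U, g, V)" "U \<in> C" "V \<in> C" "linear_map F U V g"
    "\<exists>c\<in>scalars. \<forall>u\<in>carrier U. f u = c \<odot>\<^bsub>V\<^esub> g u"
proof -
  obtain U' g V' where x: "x = (U', g, V')"
    by (cases x)
  have "((U, restrict f (carrier U), V), (U', g, V')) \<in> \<zeta>"
    using assms unfolding arr_def x by blast
  then show thesis
    using that[of g] unfolding x scalar_rel_iff by (simp add: arrows_L)
qed

lemma arr_self:
  assumes "U \<in> C" "V \<in> C" "linear_map F U V f"
  shows "(U, restrict f (carrier U), V) \<in> arr U f V"
  unfolding arr_def using equiv_class_self[OF equiv_scalar_rel restrict_arrow[OF assms]] .

lemma arr_arrow:
  assumes "U \<in> C" "V \<in> C" "linear_map F U V f"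
  shows "arr U f V \<in> arrows P"
  unfolding arr_def proj_lin_cat_def quotient_psemigroup_def
  using restrict_arrow[OF assms] by (simp add: quotientI)

lemma arr_eqI:
  assumes "U \<in> C" "V \<in> C" "linear_map F U V f" "linear_map F U V g"
    and "\<exists>c\<in>scalars. \<forall>u\<in>carrier U. f u = c \<odot>\<^bsub>V\<^esub> g u"
  shows "arr U f V = arr U g V"
  unfolding arr_def
proof (rule equiv_class_eq[OF equiv_scalar_rel])
  show "((U, restrict f (carrier U), V), (U, restrict g (carrier U), V)) \<in> \<zeta>"
    unfolding scalar_rel_iff using assms restrict_arrow by simp
qed

lemma arr_cong:
  assumes "U \<in> C" "V \<in> C" "linear_map F U V f" "\<And>u. u \<in> carrier U \<Longrightarrow> g u = f u"
  shows "arr U g V = arr U f V"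
proof -
  have "restrict g (carrier U) = restrict f (carrier U)"
    using assms(4) by (simp add: restrict_def fun_eq_iff)
  then show ?thesis
    by (simp add: arr_def)
qed

lemma arr_eqD:
  assumes "U \<in> C" "V \<in> C" "linear_map F U V f" "linear_map F U V g" "arr U f V = arr U g V"
  shows "\<exists>c\<in>scalars. \<forall>u\<in>carrier U. f u = c \<odot>\<^bsub>V\<^esub> g u"
proof -
  have "((U, restrict f (carrier U), V), (U, restrict g (carrier U), V)) \<in> \<zeta>"
    using assms(5) eq_equiv_class_iff[OF equiv_scalar_rel restrict_arrow[OF assms(1-3)]
        restrict_arrow[OF assms(1,2,4)]] by (simp add: arr_def)
  then show ?thesis
    unfolding scalar_rel_iff by simp
qed

lemma class_eq_arr: "(U, f, V) \<in> arrows L \<Longrightarrow> \<zeta> `` {(U, f, V)} = arr U f V"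
  by (simp add: arr_def arrows_L extensional_restrict)

lemma arrE:
  assumes "X \<in> arrows P"
  obtains U f V where "U \<in> C" "V \<in> C" "linear_map F U V f" "X = arr U f V"
proof -
  have "X \<in> arrows L // \<zeta>"
    using assms by (simp add: proj_lin_cat_def quotient_psemigroup_def)
  then obtain x where x: "x \<in> arrows L" "X = \<zeta> `` {x}"
    by (rule quotientE)
  obtain U f V where "x = (U, f, V)"
    by (cases x)
  then show thesis
    using that[of U V f] x class_eq_arr[of U f V] by (simp add: arrows_L)
qed

lemma src_arr [simp]:
  assumes "U \<in> C" "V \<in> C" "linear_map F U V f"
  shows "src P (arr U f V) = U" and "tgt P (arr U f V) = V"
proof -
  have "src L x = U \<and> tgt L x = V" if "x \<in> arr U f V" for x
    using that by (rule mem_arrD) (simp add: lin_cat_def)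
  then have "src L ` arr U f V = {U}" "tgt L ` arr U f V = {V}"
    using arr_self[OF assms] by force+
  then show "src P (arr U f V) = U" "tgt P (arr U f V) = V"
    by (simp_all add: proj_lin_cat_def quotient_psemigroup_def)
qed

text \<open>The product in the quotient is a union over representatives. All of them yield the same
  class, since the scalars \<open>c\<close> and \<open>d\<close> of the two factors combine to
  \<open>d c\<close> by linearity.\<close>

lemma comp_arr [simp]:
  assumes C: "U \<in> C" "V \<in> C" "W \<in> C" and f: "linear_map F U V f" and g: "linear_map F V W g"
  shows "arr U f V \<star>\<^bsub>P\<^esub> arr V g W = arr U (\<lambda>u. g (f u)) W"
proof -
  have lin: "linear_map F U W (\<lambda>u. g (f u))"
    by (rule linear_map_comp[OF f g])
  have eq: "\<zeta> `` {x \<star>\<^bsub>L\<^esub> y} = arr U (\<lambda>u. g (f u)) W" if x: "x \<in> arr U f V" and y: "y \<in> arr V g W" for x y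
  proof -
    obtain f' c where f': "x = (U, f', V)" "linear_map F U V f'"
      and c: "c \<in> scalars" "\<And>u. u \<in> carrier U \<Longrightarrow> f u = c \<odot>\<^bsub>V\<^esub> f' u"
      using mem_arrD[OF x] by metis
    obtain g' d where g': "y = (V, g', W)" "linear_map F V W g'"
      and d: "d \<in> scalars" "\<And>v. v \<in> carrier V \<Longrightarrow> g v = d \<odot>\<^bsub>W\<^esub> g' v"
      using mem_arrD[OF y] by metis
    interpret W: vectorspace F W
      using C vs by simp
    interpret f': linear_map F U V f' by fact
    interpret g': linear_map F V W g' by fact
    have lin': "linear_map F U W (\<lambda>u. g' (f' u))"
      by (rule linear_map_comp[OF f'(2) g'(2)])
    have "x \<star>\<^bsub>L\<^esub> y = (U, restrict (\<lambda>u. g' (f' u)) (carrier U), W)"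
      by (simp add: f' g' lin_cat_def compose_def)
    then have "\<zeta> `` {x \<star>\<^bsub>L\<^esub> y} = arr U (\<lambda>u. g' (f' u)) W"
      by (simp add: arr_def)
    also have "\<dots> = arr U (\<lambda>u. g (f u)) W"
    proof (rule arr_eqI[OF C(1,3) lin lin', symmetric])
      have "g (f u) = (d \<otimes>\<^bsub>F\<^esub> c) \<odot>\<^bsub>W\<^esub> g' (f' u)" if u: "u \<in> carrier U" for u
      proof -
        have "g (f u) = d \<odot>\<^bsub>W\<^esub> (c \<odot>\<^bsub>W\<^esub> g' (f' u))"
          using c(1) u by (simp add: c(2) d(2))
        then show ?thesis
          using c(1) d(1) u by (simp add: W.smult_assoc1)
      qed
      then show "\<exists>c\<in>scalars. \<forall>u\<in>carrier U. g (f u) = c \<odot>\<^bsub>W\<^esub> g' (f' u)"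
        using scalars_mult[OF d(1) c(1)] by blast
    qed
    finally show ?thesis .
  qed
  have "arr U f V \<star>\<^bsub>P\<^esub> arr V g W = (\<Union>x\<in>arr U f V. \<Union>y\<in>arr V g W. \<zeta> `` {x \<star>\<^bsub>L\<^esub> y})"
    by (simp add: proj_lin_cat_def quotient_psemigroup_def)
  also have "\<dots> = (\<Union>x\<in>arr U f V. \<Union>y\<in>arr V g W. arr U (\<lambda>u. g (f u)) W)"
    using eq by (intro SUP_cong) simp_all
  also have "\<dots> = arr U (\<lambda>u. g (f u)) W"
    using arr_self[OF C(1,2) f] arr_self[OF C(2,3) g] by blast
  finally show ?thesis .
qed

text \<open>Well defined, because proportional maps have the same kernel and hence, by rank-nullity,
  the same rank.\<close>

definition prank :: "('f, 'v) lin_mor set \<Rightarrow> nat" where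
  "prank X = the_elem (lin_rank F ` X)"

lemma proportional_ker:
  assumes "linear_map F U V f" "linear_map F U V g"
    and "\<exists>c\<in>scalars. \<forall>u\<in>carrier U. f u = c \<odot>\<^bsub>V\<^esub> g u"
  shows "map_ker U V g \<subseteq> map_ker U V f"
proof -
  interpret V: vectorspace F V
    using assms(1) by (simp add: linear_map_def)
  show ?thesis
    using assms(3) unfolding map_ker_def by auto
qed

lemma proportional_map_rank:
  assumes "U \<in> C" "linear_map F U V f" "linear_map F U V g"
    and "\<exists>c\<in>scalars. \<forall>u\<in>carrier U. f u = c \<odot>\<^bsub>V\<^esub> g u"
  shows "map_rank F U V f = map_rank F U V g"
  using proportional_ker[OF assms(2-4)]
    proportional_ker[OF assms(3,2) proportional_sym[OF assms(2-4)]]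
  by (intro map_rank_eq_ker[OF fdvs[OF assms(1)] assms(2,3)] equalityI)

lemma prank_arr [simp]:
  assumes "U \<in> C" "V \<in> C" "linear_map F U V f"
  shows "prank (arr U f V) = map_rank F U V f"
proof -
  have "lin_rank F x = map_rank F U V f" if "x \<in> arr U f V" for x
    using that
    by (rule mem_arrD) (simp add: lin_rank_def map_rank_def[symmetric] proportional_map_rank[OF assms(1,3)])
  then have "lin_rank F ` arr U f V = {map_rank F U V f}"
    using arr_self[OF assms] by force
  then show ?thesis
    by (simp add: prank_def)
qed

lemma rank_ideal_eq: "rank_ideal F C r = {X \<in> arrows P. enat (prank X) \<le> r}"
  and rank_class_eq: "rank_class F C q = {X \<in> arrows P. prank X = q}"
proof -
  have 1: "\<zeta> `` {x} \<in> arrows P" "prank (\<zeta> `` {x}) = lin_rank F x" if "x \<in> arrows L" for x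
  proof -
    obtain U f V where x: "x = (U, f, V)"
      by (cases x)
    then show "\<zeta> `` {x} \<in> arrows P" "prank (\<zeta> `` {x}) = lin_rank F x"
      using that class_eq_arr[of U f V] arr_arrow[of U V f]
      by (simp_all add: arrows_L lin_rank_def map_rank_def)
  qed
  \<comment> \<open>One argument serves both claims, with \<open>Q\<close> an arbitrary condition on
    the rank.\<close>
  have "{\<zeta> `` {x} | x. x \<in> arrows L \<and> Q (lin_rank F x)} = {X \<in> arrows P. Q (prank X)}" for Q
  proof (intro subset_antisym subsetI)
    fix X
    assume "X \<in> {\<zeta> `` {x} | x. x \<in> arrows L \<and> Q (lin_rank F x)}"
    then obtain x where "X = \<zeta> `` {x}" "x \<in> arrows L" "Q (lin_rank F x)"
      by (elim CollectE exE conjE)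
    then show "X \<in> {X \<in> arrows P. Q (prank X)}"
      using 1[of x] by simp
  next
    fix X
    assume X: "X \<in> {X \<in> arrows P. Q (prank X)}"
    then have "X \<in> arrows L // \<zeta>"
      by (simp add: proj_lin_cat_def quotient_psemigroup_def)
    then obtain x where "x \<in> arrows L" "X = \<zeta> `` {x}"
      by (rule quotientE)
    then show "X \<in> {\<zeta> `` {x} | x. x \<in> arrows L \<and> Q (lin_rank F x)}"
      using X 1[of x] by (intro CollectI exI[of _ x]) simp
  qed
  then show "rank_ideal F C r = {X \<in> arrows P. enat (prank X) \<le> r}"
    "rank_class F C q = {X \<in> arrows P. prank X = q}"
    unfolding rank_ideal_def rank_class_def by this+
qed

lemma parallel_arrE:
  assumes "(X, Y) \<in> nabla P"
  obtains U V f g where "U \<in> C" "V \<in> C" "linear_map F U V f" "linear_map F U V g"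
    "X = arr U f V" "Y = arr U g V"
proof -
  have XY: "X \<in> arrows P" "Y \<in> arrows P" "src P X = src P Y" "tgt P X = tgt P Y"
    using assms by (auto simp: nabla_def)
  obtain U V f where X: "U \<in> C" "V \<in> C" "linear_map F U V f" "X = arr U f V"
    using XY(1) by (rule arrE)
  obtain U' V' g where Y: "U' \<in> C" "V' \<in> C" "linear_map F U' V' g" "Y = arr U' g V'"
    using XY(2) by (rule arrE)
  then show thesis
    using that[of U V f g] X XY(3,4) by simp
qed

lemma arr_fromE:
  assumes "X \<in> arrows P" "src P X = U"
  obtains V f where "U \<in> C" "V \<in> C" "linear_map F U V f" "X = arr U f V"
  using assms(1)
proof (rule arrE)
  fix U' V f
  assume "U' \<in> C" "V \<in> C" "linear_map F U' V f" "X = arr U' f V"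
  then show thesis
    using that[of V f] assms(2) by simp
qed

lemma arr_toE:
  assumes "X \<in> arrows P" "tgt P X = V"
  obtains U f where "U \<in> C" "V \<in> C" "linear_map F U V f" "X = arr U f V"
  using assms(1)
proof (rule arrE)
  fix U V' f
  assume "U \<in> C" "V' \<in> C" "linear_map F U V' f" "X = arr U f V'"
  then show thesis
    using that[of U f] assms(2) by simp
qed

sublocale P: partial_category P
proof
  fix X Y
  assume X: "X \<in> arrows P" and Y: "Y \<in> arrows P" and XY: "tgt P X = src P Y"
  obtain U V f where f: "U \<in> C" "V \<in> C" "linear_map F U V f" "X = arr U f V"
    using X by (rule arrE)
  obtain W g where g: "W \<in> C" "linear_map F V W g" "Y = arr V g W"
    using arr_fromE[OF Y, of V] XY f by (metis src_arr(2))
  have gf: "linear_map F U W (\<lambda>u. g (f u))"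
    by (rule linear_map_comp[OF f(3) g(2)])
  show "X \<star>\<^bsub>P\<^esub> Y \<in> arrows P" "src P (X \<star>\<^bsub>P\<^esub> Y) = src P X" "tgt P (X \<star>\<^bsub>P\<^esub> Y) = tgt P Y"
    using f g gf by (simp_all add: arr_arrow)
  fix Z
  assume Z: "Z \<in> arrows P" and YZ: "tgt P Y = src P Z"
  obtain T h where h: "T \<in> C" "linear_map F W T h" "Z = arr W h T"
    using arr_fromE[OF Z, of W] YZ f g by (metis src_arr(2))
  have hg: "linear_map F V T (\<lambda>v. h (g v))"
    by (rule linear_map_comp[OF g(2) h(2)])
  show "(X \<star>\<^bsub>P\<^esub> Y) \<star>\<^bsub>P\<^esub> Z = X \<star>\<^bsub>P\<^esub> (Y \<star>\<^bsub>P\<^esub> Z)"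
    using f g h gf hg by simp
qed

section \<open>Green's relation \<H> as equality of kernel and image\<close>

text \<open>Equal kernels let each map be obtained from the other by multiplication on the right,
  equal images by multiplication on the left.\<close>

lemma green_H_arrI:
  assumes C: "U \<in> C" "V \<in> C" and f: "linear_map F U V f" and g: "linear_map F U V g"
    and im: "f ` carrier U = g ` carrier U" and ker: "map_ker U V f = map_ker U V g"
  shows "(arr U f V, arr U g V) \<in> green_H P"
proof -
  have post: "\<exists>h. linear_map F V V h \<and> arr U g V = arr U f V \<star>\<^bsub>P\<^esub> arr V h V"
    if f: "linear_map F U V f" and g: "linear_map F U V g" and ker: "map_ker U V f = map_ker U V g" for f g
  proof -
    obtain h where h: "linear_map F V V h" "\<And>u. u \<in> carrier U \<Longrightarrow> h (f u) = g u"
      by (rule linear_factor_right[OF fdvs[OF C(2)] f g equalityD1[OF ker]]) (rule that)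
    then show ?thesis
      using C f g arr_cong[OF C g h(2)] by (intro exI[of _ h]) simp
  qed
  have pre: "\<exists>h. linear_map F U U h \<and> arr U g V = arr U h U \<star>\<^bsub>P\<^esub> arr U f V"
    if f: "linear_map F U V f" and g: "linear_map F U V g" and im: "f ` carrier U = g ` carrier U" for f g
  proof -
    obtain h where h: "linear_map F U U h" "\<And>u. u \<in> carrier U \<Longrightarrow> f (h u) = g u"
      by (rule linear_lift_simple[OF fdvsD(2)[OF fdvs[OF C(1)]] g f equalityD2[OF im]]) (rule that)
    then show ?thesis
      using C f g arr_cong[OF C g h(2)] by (intro exI[of _ h]) simp
  qed
  obtain s t where s: "linear_map F V V s" "arr U g V = arr U f V \<star>\<^bsub>P\<^esub> arr V s V"
    and t: "linear_map F V V t" "arr U f V = arr U g V \<star>\<^bsub>P\<^esub> arr V t V"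
    using post[OF f g ker] post[OF g f ker[symmetric]] by metis
  obtain u v where u: "linear_map F U U u" "arr U g V = arr U u U \<star>\<^bsub>P\<^esub> arr U f V"
    and v: "linear_map F U U v" "arr U f V = arr U v U \<star>\<^bsub>P\<^esub> arr U g V"
    using pre[OF f g im] pre[OF g f im[symmetric]] by metis
  show ?thesis
    by (rule P.green_HI[OF arr_arrow[OF C f] arr_arrow[OF C g]
          arr_arrow[OF C(2,2) s(1)] _ s(2) arr_arrow[OF C(2,2) t(1)] _ t(2)
          arr_arrow[OF C(1,1) u(1)] _ u(2) arr_arrow[OF C(1,1) v(1)] _ v(2)])
      (simp_all add: C f g s(1) t(1) u(1) v(1))
qed

text \<open>A right multiple has a larger kernel and a left multiple a smaller image; the scalar
  ambiguity of the representatives affects neither.\<close>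

lemma green_H_arrD:
  assumes C: "U \<in> C" "V \<in> C" and f: "linear_map F U V f" and g: "linear_map F U V g"
    and H: "(arr U f V, arr U g V) \<in> green_H P"
  shows "f ` carrier U = g ` carrier U" and "map_ker U V f = map_ker U V g"
proof -
  have ker: "map_ker U V g \<subseteq> map_ker U V f"
    if f: "linear_map F U V f" and g: "linear_map F U V g"
      and in_principal: "arr U f V \<in> right_principal P (arr U g V)" for f g
  proof -
    consider "arr U f V = arr U g V"
      | X where "X \<in> arrows P" "src P X = V" "arr U f V = arr U g V \<star>\<^bsub>P\<^esub> X"
      using in_principal C g unfolding right_principal_def composable_def by auto
    then show ?thesis
    proof cases
      case 1
      then show ?thesis
        using proportional_ker[OF f g arr_eqD[OF C f g]] by simp
    next
      case 2
      obtain W h where h: "W \<in> C" "linear_map F V W h" "X = arr V h W"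
        using 2(1,2) by (rule arr_fromE)
      have eq: "arr U f V = arr U (\<lambda>u. h (g u)) W"
        using 2(3) h C g by simp
      have hg: "linear_map F U W (\<lambda>u. h (g u))"
        by (rule linear_map_comp[OF g h(2)])
      \<comment> \<open>A right multiplier may end in any object of the category. Comparing targets
        forces it to return to \<open>V\<close>, after which representatives can be compared as
        maps.\<close>
      have "W = V"
        using arg_cong[OF eq, of "tgt P"] C f h(1) hg by simp
      then have "map_ker U V (\<lambda>u. h (g u)) \<subseteq> map_ker U V f"
        using proportional_ker[OF f _ arr_eqD[OF C f]] eq hg by simp
      moreover interpret h: linear_map F V W h by (rule h(2))
      have "map_ker U V g \<subseteq> map_ker U V (\<lambda>u. h (g u))"
        using \<open>W = V\<close> h.f0_is_0 unfolding map_ker_def by auto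
      ultimately show ?thesis
        by (rule subset_trans[rotated])
    qed
  qed
  have im: "f ` carrier U \<subseteq> g ` carrier U"
    if f: "linear_map F U V f" and g: "linear_map F U V g"
      and in_principal: "arr U f V \<in> left_principal P (arr U g V)" for f g
  proof -
    interpret U: vectorspace F U
      using C vs by simp
    interpret g: linear_map F U V g by fact
    \<comment> \<open>Linearity moves the scalar into the argument of \<open>g\<close>. With
      \<open>k\<close> the identity this also covers the case of equal classes.\<close>
    have scale: "f ` carrier U \<subseteq> g ` carrier U"
      if k: "linear_map F U U k" and ck: "\<exists>c\<in>scalars. \<forall>u\<in>carrier U. f u = c \<odot>\<^bsub>V\<^esub> g (k u)" for k
    proof
      interpret k: linear_map F U U k by fact
      fix v
      assume "v \<in> f ` carrier U"
      then obtain u where u: "u \<in> carrier U" "v = f u"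
        by (elim imageE) simp
      obtain c where c: "c \<in> scalars" "\<And>u. u \<in> carrier U \<Longrightarrow> f u = c \<odot>\<^bsub>V\<^esub> g (k u)"
        using ck by blast
      then have "v = g (c \<odot>\<^bsub>U\<^esub> k u)" "c \<odot>\<^bsub>U\<^esub> k u \<in> carrier U"
        using u by simp_all
      then show "v \<in> g ` carrier U"
        by blast
    qed
    consider "arr U f V = arr U g V"
      | X where "X \<in> arrows P" "tgt P X = U" "arr U f V = X \<star>\<^bsub>P\<^esub> arr U g V"
      using in_principal C g unfolding left_principal_def composable_def by auto
    then show ?thesis
    proof cases
      case 1
      have "linear_map F U U (\<lambda>u. u)"
        using vs[OF C(1)] by (intro linear_mapI) simp_all
      then show ?thesis
        using scale[of "\<lambda>u. u"] arr_eqD[OF C f g 1] by simp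
    next
      case 2
      obtain W h where h: "W \<in> C" "linear_map F W U h" "X = arr W h U"
        using 2(1,2) by (rule arr_toE)
      have eq: "arr U f V = arr W (\<lambda>u. g (h u)) V"
        using 2(3) h C g by simp
      have gh: "linear_map F W V (\<lambda>u. g (h u))"
        by (rule linear_map_comp[OF h(2) g])
      have "W = U"
        using arg_cong[OF eq, of "src P"] C f h(1) gh by simp
      then show ?thesis
        using scale[of h] arr_eqD[OF C f, of "\<lambda>u. g (h u)"] eq gh h by simp
    qed
  qed
  have "arr U f V \<in> right_principal P (arr U g V)" "arr U g V \<in> right_principal P (arr U f V)"
    "arr U f V \<in> left_principal P (arr U g V)" "arr U g V \<in> left_principal P (arr U f V)"
    using H unfolding green_H_def green_R_def green_L_def right_principal_def left_principal_def by auto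
  then show "f ` carrier U = g ` carrier U" "map_ker U V f = map_ker U V g"
    using ker[OF f g] ker[OF g f] im[OF f g] im[OF g f] by (simp_all add: subset_antisym)
qed

section \<open>The axioms hold in the projective linear category\<close>

sublocale P: graded_category P prank
proof
  fix X
  assume X: "X \<in> arrows P"
  obtain U V f where f: "U \<in> C" "V \<in> C" "linear_map F U V f" "X = arr U f V"
    using X by (rule arrE)
  note fdU = fdvs[OF f(1)] and fdV = fdvs[OF f(2)]
  have zero: "linear_map F U V (\<lambda>_. \<zero>\<^bsub>V\<^esub>)"
  proof -
    interpret V: vectorspace F V
      using f vs by simp
    show ?thesis
      using vs f by (intro linear_mapI) simp_all
  qed
  then show "\<exists>Z. (X, Z) \<in> nabla P \<and> prank Z = 0"
    using f map_rank_0_iff[OF fdV zero] X arr_arrow[OF f(1,2) zero]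
    by (intro exI[of _ "arr U (\<lambda>_. \<zero>\<^bsub>V\<^esub>) V"]) (simp add: nabla_def)
  obtain h where h: "linear_map F V U h" "\<And>u. u \<in> carrier U \<Longrightarrow> f (h (f u)) = f u"
    by (rule linear_map_pseudo_inverse[OF fdV f(3)]) (rule that)
  have hf: "linear_map F U U (\<lambda>u. h (f u))"
    by (rule linear_map_comp[OF f(3) h(1)])
  have "X \<star>\<^bsub>P\<^esub> arr V h U \<star>\<^bsub>P\<^esub> X = X"
    using f h(1) hf arr_cong[OF f(1-3) h(2)] by simp
  then show "\<exists>X'\<in>arrows P. src P X' = tgt P X \<and> tgt P X' = src P X \<and> X \<star>\<^bsub>P\<^esub> X' \<star>\<^bsub>P\<^esub> X = X"
    using f h(1) arr_arrow[OF f(2,1) h(1)] by (intro bexI[of _ "arr V h U"]) simp_all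
  {
    fix Y
    assume Y: "Y \<in> arrows P" and XY: "tgt P X = src P Y"
    obtain W g where g: "W \<in> C" "linear_map F V W g" "Y = arr V g W"
      using arr_fromE[OF Y, of V] XY f by (metis src_arr(2))
    note fdW = fdvs[OF g(1)]
    have gf: "linear_map F U W (\<lambda>u. g (f u))"
      by (rule linear_map_comp[OF f(3) g(2)])
    have XYeq: "X \<star>\<^bsub>P\<^esub> Y = arr U (\<lambda>u. g (f u)) W"
      using f g by simp
    show "prank (X \<star>\<^bsub>P\<^esub> Y) \<le> prank X" "prank (X \<star>\<^bsub>P\<^esub> Y) \<le> prank Y"
      using f g gf map_rank_comp_le[OF fdU fdW f(3) g(2)] by simp_all
    {
      \<comment> \<open>Stability on the left: equal rank forces the composite to have the whole
        image of \<open>g\<close>, so \<open>g\<close> lifts back through it.\<close>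
      assume "prank (X \<star>\<^bsub>P\<^esub> Y) = prank Y"
      then have "map_rank F U W (\<lambda>u. g (f u)) = map_rank F V W g"
        using f g gf by simp
      moreover interpret f: linear_map F U V f by (rule f(3))
      have "(\<lambda>u. g (f u)) ` carrier U \<subseteq> g ` carrier V"
        by auto
      ultimately have "(\<lambda>u. g (f u)) ` carrier U = g ` carrier V"
        using map_rank_im_mono(2)[OF fdW gf g(2)] by blast
      then have "g ` carrier V \<subseteq> (\<lambda>u. g (f u)) ` carrier U"
        by simp
      then obtain a where a: "linear_map F V U a" "\<And>v. v \<in> carrier V \<Longrightarrow> g (f (a v)) = g v"
        using linear_lift_simple[OF fdvsD(2)[OF fdV] g(2) gf] by metis
      have "arr V a U \<star>\<^bsub>P\<^esub> (X \<star>\<^bsub>P\<^esub> Y) = Y"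
        unfolding XYeq using f g gf a(1) arr_cong[OF f(2) g(1,2) a(2)] by simp
      then show "\<exists>A\<in>arrows P. tgt P A = src P X \<and> A \<star>\<^bsub>P\<^esub> (X \<star>\<^bsub>P\<^esub> Y) = Y"
        using f a(1) arr_arrow[OF f(2,1) a(1)] by (intro bexI[of _ "arr V a U"]) simp_all
    next
      \<comment> \<open>Stability on the right: equal rank forces the composite to have the same
        kernel as \<open>f\<close>, so \<open>f\<close> factors through it.\<close>
      assume "prank (X \<star>\<^bsub>P\<^esub> Y) = prank X"
      then have eq: "map_rank F U W (\<lambda>u. g (f u)) = map_rank F U V f"
        using f g gf by simp
      interpret g: linear_map F V W g by (rule g(2))
      have "map_ker U V f \<subseteq> map_ker U W (\<lambda>u. g (f u))"
        unfolding map_ker_def by auto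
      then have "map_ker U W (\<lambda>u. g (f u)) \<subseteq> map_ker U V f"
        using map_rank_ker_antimono(2)[OF fdU f(3) gf] eq by force
      then obtain b where b: "linear_map F W V b" "\<And>u. u \<in> carrier U \<Longrightarrow> b (g (f u)) = f u"
        using linear_factor_right[OF fdW gf f(3)] by metis
      have "(X \<star>\<^bsub>P\<^esub> Y) \<star>\<^bsub>P\<^esub> arr W b V = X"
        unfolding XYeq using f g gf b(1) arr_cong[OF f(1-3) b(2)] by simp
      then show "\<exists>B\<in>arrows P. src P B = tgt P Y \<and> (X \<star>\<^bsub>P\<^esub> Y) \<star>\<^bsub>P\<^esub> B = X"
        using f g b(1) arr_arrow[OF g(1) f(2) b(1)] by (intro bexI[of _ "arr W b V"]) simp_all
    }
  }
  {
    fix Z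
    assume Z: "Z \<in> arrows P" and le: "prank X \<le> prank Z"
    obtain W Y g where g: "W \<in> C" "Y \<in> C" "linear_map F W Y g" "Z = arr W g Y"
      using Z by (rule arrE)
    have le': "map_rank F U V f \<le> map_rank F W Y g"
      using le f g by simp
    obtain a b where ab: "linear_map F U W a" "linear_map F Y V b" "\<And>u. u \<in> carrier U \<Longrightarrow> b (g (a u)) = f u"
      using linear_factor[OF fdU fdV fdvs[OF g(1)] fdvs[OF g(2)] f(3) g(3) le'] by metis
    have ga: "linear_map F U Y (\<lambda>u. g (a u))"
      by (rule linear_map_comp[OF ab(1) g(3)])
    have "X = arr U a W \<star>\<^bsub>P\<^esub> Z \<star>\<^bsub>P\<^esub> arr Y b V"
      using f g ab(1,2) ga arr_cong[OF f(1-3) ab(3)] by simp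
    then show "\<exists>A\<in>arrows P. \<exists>B\<in>arrows P. tgt P A = src P Z \<and> tgt P Z = src P B \<and> X = A \<star>\<^bsub>P\<^esub> Z \<star>\<^bsub>P\<^esub> B"
      using f g ab(1,2) arr_arrow[OF f(1) g(1) ab(1)] arr_arrow[OF g(2) f(2) ab(2)]
      by (intro bexI[of _ "arr U a W"] bexI[of _ "arr Y b V"] conjI) simp_all
  }
next
  fix X Y
  assume XY: "(X, Y) \<in> nabla P"
  obtain U V f g where UV: "U \<in> C" "V \<in> C" and f: "linear_map F U V f" and g: "linear_map F U V g"
    and X: "X = arr U f V" and Y: "Y = arr U g V"
    using XY by (rule parallel_arrE)
  note fdU = fdvs[OF UV(1)] and fdV = fdvs[OF UV(2)]
  have post: "arr U h V \<star>\<^bsub>P\<^esub> arr V b V = arr U (\<lambda>u. b (h u)) V"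
      "prank (arr U h V \<star>\<^bsub>P\<^esub> arr V b V) = map_rank F U V (\<lambda>u. b (h u))"
    if "linear_map F U V h" "linear_map F V V b" for h b
    using UV that linear_map_comp[OF that] by simp_all
  have pre: "prank (arr U a U \<star>\<^bsub>P\<^esub> arr U h V) = map_rank F U V (\<lambda>u. h (a u))"
    if "linear_map F U V h" "linear_map F U U a" for h a
    using UV that linear_map_comp[OF that(2,1)] by simp
  {
    assume "prank X = 0" "prank Y = 0"
    then have "f u = g u" if "u \<in> carrier U" for u
      using map_rank_0_iff[OF fdV f] map_rank_0_iff[OF fdV g] UV f g X Y that by simp
    then show "X = Y"
      unfolding X Y by (rule arr_cong[OF UV g])
  next
    assume le: "prank Y \<le> prank X" and H: "(X, Y) \<notin> green_H P"
    have "map_rank F U V g \<le> map_rank F U V f"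
      using le UV f g X Y by simp
    moreover have "\<not> (f ` carrier U = g ` carrier U \<and> map_ker U V f = map_ker U V g)"
      using green_H_arrI[OF UV f g] H X Y by blast
    ultimately consider
      a where "linear_map F U U a" "map_rank F U U a \<le> map_rank F U V f"
        "map_rank F U V (\<lambda>u. f (a u)) = map_rank F U V f"
        "map_rank F U V (\<lambda>u. g (a u)) < map_rank F U V f"
      | b where "linear_map F V V b" "map_rank F V V b \<le> map_rank F U V f"
        "map_rank F U V (\<lambda>u. b (f u)) = map_rank F U V f"
        "map_rank F U V (\<lambda>u. b (g u)) < map_rank F U V f"
      using linear_separate[OF fdU fdV f g] by metis
    then show "(\<exists>A\<in>arrows P. tgt P A = src P X \<and> prank A \<le> prank X \<and>
          prank (A \<star>\<^bsub>P\<^esub> X) = prank X \<and> prank (A \<star>\<^bsub>P\<^esub> Y) < prank X) \<or>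
        (\<exists>B\<in>arrows P. src P B = tgt P X \<and> prank B \<le> prank X \<and>
          prank (X \<star>\<^bsub>P\<^esub> B) = prank X \<and> prank (Y \<star>\<^bsub>P\<^esub> B) < prank X)"
    proof cases
      case 1
      then show ?thesis
        unfolding X Y using UV f g pre[OF f 1(1)] pre[OF g 1(1)] arr_arrow[OF UV(1,1) 1(1)]
        by (intro disjI1 bexI[of _ "arr U a U"]) (simp_all del: comp_arr)
    next
      case 2
      then show ?thesis
        unfolding X Y using UV f g post[OF f 2(1)] post[OF g 2(1)] arr_arrow[OF UV(2,2) 2(1)]
        by (intro disjI2 bexI[of _ "arr V b V"]) (simp_all del: comp_arr)
    qed
  next
    assume less: "prank Y < prank X"
    have "map_rank F U V g < map_rank F U V f"
      using less UV f g X Y by simp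
    then obtain b where b: "linear_map F V V b" "map_rank F V V b \<le> map_rank F U V f"
      "map_rank F U V (\<lambda>u. b (g u)) < map_rank F U V (\<lambda>u. b (f u))"
      "Suc (map_rank F U V (\<lambda>u. b (f u))) = map_rank F U V f \<or>
        map_rank F U V (\<lambda>u. b (f u)) = map_rank F U V f \<and> map_rank F U V (\<lambda>u. b (g u)) = 0"
      using linear_descend[OF fdU fdV f g] by metis
    then show "\<exists>B\<in>arrows P. src P B = tgt P X \<and> prank B \<le> prank X \<and> prank (Y \<star>\<^bsub>P\<^esub> B) < prank (X \<star>\<^bsub>P\<^esub> B) \<and>
        (Suc (prank (X \<star>\<^bsub>P\<^esub> B)) = prank X \<or> prank (X \<star>\<^bsub>P\<^esub> B) = prank X \<and> prank (Y \<star>\<^bsub>P\<^esub> B) = 0)"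
      unfolding X Y using UV f g post[OF f b(1)] post[OF g b(1)] arr_arrow[OF UV(2,2) b(1)]
      by (intro bexI[of _ "arr V b V"]) (simp_all del: comp_arr)
  next
    assume H: "(X, Y) \<in> green_H P" and neq: "X \<noteq> Y"
    \<comment> \<open>The quotient by \<open>\<zeta>\<close> matters at this point: distinct classes
      are never represented by proportional maps, so some value of \<open>g\<close> is not parallel
      to that of \<open>f\<close>.\<close>
    have "\<not> (\<exists>c\<in>scalars. \<forall>u\<in>carrier U. g u = c \<odot>\<^bsub>V\<^esub> f u)"
      using arr_eqI[OF UV g f] neq X Y by blast
    then obtain b where b: "linear_map F V V b" "map_rank F V V b \<le> map_rank F U V f"
      "Suc (map_rank F U V (\<lambda>u. b (f u))) = map_rank F U V f"
      "map_rank F U V (\<lambda>u. b (g u)) = map_rank F U V (\<lambda>u. b (f u))"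
      "map_ker U V (\<lambda>u. b (f u)) \<noteq> map_ker U V (\<lambda>u. b (g u))"
      using linear_descend_parallel[OF fdU fdV f g] green_H_arrD[OF UV f g] H X Y by metis
    then have "(X \<star>\<^bsub>P\<^esub> arr V b V, Y \<star>\<^bsub>P\<^esub> arr V b V) \<notin> green_H P"
      unfolding X Y post(1)[OF f b(1)] post(1)[OF g b(1)]
      using green_H_arrD(2)[OF UV linear_map_comp[OF f b(1)] linear_map_comp[OF g b(1)]] by blast
    then show "\<exists>B\<in>arrows P. src P B = tgt P X \<and> prank B \<le> prank X \<and> Suc (prank (X \<star>\<^bsub>P\<^esub> B)) = prank X \<and>
        prank (Y \<star>\<^bsub>P\<^esub> B) = prank (X \<star>\<^bsub>P\<^esub> B) \<and> (X \<star>\<^bsub>P\<^esub> B, Y \<star>\<^bsub>P\<^esub> B) \<notin> green_H P"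
      using b UV f g post[OF f b(1)] post[OF g b(1)] arr_arrow[OF UV(2,2) b(1)] unfolding X Y
      by (intro bexI[of _ "arr V b V"]) (simp_all del: comp_arr)
  }
qed

end

theorem theorem11p10:
  fixes F :: "'f ring"
    and C :: "('f, 'v) module set"
    and G :: "nat \<Rightarrow> ('f, 'v) lin_mor set set"
    and r :: enat
  assumes "field F"
    and "C \<noteq> {}"
    and "\<forall>V\<in>C. vectorspace F V \<and> vectorspace.fin_dim F V"
    and "\<forall>q. enat q < dim_bound F C \<longrightarrow>
           group_H_class (proj_lin_cat F C) (G q) \<and> G q \<subseteq> rank_class F C q"
    and "r < dim_bound F C \<or> (r = \<infinity> \<and> dim_bound F C = \<infinity>)"
  shows "Cong (rank_ideal_psg F C r) =
           {rees_nu F C r q N | q N.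
              enat q < r \<and> N \<lhd> monoid_on (proj_lin_cat F C) (G (Suc q))}
           \<union> {nabla (rank_ideal_psg F C r)}"
proof -
  interpret linear_category F C
    using assms(1,3) by (simp add: linear_category_def fdvs_def)
  \<comment> \<open>The groups are given only below \<open>dim_bound\<close>. From
    \<open>q < r\<close> follows \<open>Suc q \<le> r\<close>; then either \<open>r\<close> is below
    the bound, or the bound is infinite and exceeds the finite \<open>Suc q\<close>.\<close>
  have "enat (Suc q) < dim_bound F C" if "enat q < r" for q
  proof -
    have "enat (Suc q) \<le> r"
      using that by (simp add: Suc_ile_eq)
    then show ?thesis
      using assms(5) by auto
  qed
  then have G: "group_H_class P (G (Suc q)) \<and> G (Suc q) \<subseteq> {X \<in> arrows P. prank X = Suc q}"
    if "enat q < r" for q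
    using assms(4) that unfolding rank_class_eq by blast
  have ideal: "rank_ideal F C s = P.ideal s" for s
    by (simp add: rank_ideal_eq P.ideal_def)
  show ?thesis
    unfolding rees_nu_def rank_ideal_psg_def ideal rank_class_eq
    by (rule P.Cong_ideal[OF G])
qed

end
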